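(* Let $1\le s\le r\le N$. The leading term of $d_{rs}\in U=U_q(\mathfrak{gl}_N)$ with respect to the De Concini-Kac filtration (for the decomposition $w_0=(s_1s_2\cdots s_{N-1})(s_1s_2\cdots s_{N-2})\cdots(s_1s_2)s_1$ of the longest Weyl group element) is $$\mathrm{lt}(d_{rs})=\lambda\cdot t_{1+s,1}^{(0)}\,t_{2+s,2}^{(0)}\cdots t_{r,r-s}^{(0)}\cdot t_{1,r-s+1}^{(1)}\,t_{2,r-s+2}^{(1)}\cdots t_{s,r}^{(1)}$$ for some nonzero $\lambda\in\mathbb{C}$.
   Context: Fix $N\ge 1$ and $q\in\mathbb{C}$ nonzero and not a root of unity. $U=U_q(\mathfrak{gl}_N)$ is the unital associative $\mathbb{C}$-algebra with (RTT) generators $t_{ij},\bar t_{ij}$, $1\le i,j\le N$, and relations: $t_{ij}=0=\bar t_{ji}$ for $i<j$; $t_{ii}\bar t_{ii}=1=\bar t_{ii}t_{ii}$; and for all $i,a,j,b$, $$q^{\delta_{ij}}t_{ia}t_{jb}-q^{\delta_{ab}}t_{jb}t_{ia}=(q-q^{-1})(\delta_{b<a}-\delta_{i<j})t_{ja}t_{ib},$$ $$q^{\delta_{ij}}\bar t_{ia}\bar t_{jb}-q^{\delta_{ab}}\bar t_{jb}\bar t_{ia}=(q-q^{-1})(\delta_{b<a}-\delta_{i<j})\bar t_{ja}\bar t_{ib},$$ $$q^{\delta_{ij}}\bar t_{ia}t_{jb}-q^{\delta_{ab}}t_{jb}\bar t_{ia}=(q-q^{-1})(\delta_{b<a}t_{ja}\bar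 t_{ib}-\delta_{i<j}\bar t_{ja}t_{ib}),$$ where $\delta_S$ is $1$ if $S$ is true and $0$ otherwise. Write $t_{ij}^{(0)}=t_{ij}$ and $t_{ij}^{(1)}=\bar t_{ij}$. In terms of the usual generators and root vectors, $t_{ii}=K_i$, $\bar t_{ii}=K_i^{-1}$, and for $i<j$: $\bar t_{ij}=(-1)^{i-j+1}(q-q^{-1})K_i^{-1}E_{\beta_{ij}}$, $t_{ji}=-(q-q^{-1})F_{\beta_{ij}}K_i$, where $E_{\beta_{ij}},F_{\beta_{ij}}$ are the root vectors for the positive root $\beta_{ij}=\varepsilon_i-\varepsilon_j$ associated with the decomposition $w_0=(s_1s_2\cdots s_{N-1})(s_1s_2\cdots s_{N-2})\cdots(s_1s_2)s_1$ of the longest element $w_0$ of the Weyl group $S_N$, where $s_i=(i\ i+1)$. Let $M=N(N-1)/2$ and enumerate the positive roots as $(\beta_1,\ldots,\beta_M)=(\beta_{12},\beta_{13},\ldots,\beta_{1N},\beta_{23},\ldots,\beta_{2N},\ldots,\beta_{N-1,N})$. The height of $\beta_{ij}$ is $\mathrm{ht}(\beta_{ij})=j-i$. The ordered monomials $F^{\mathbf r}K_\mu E^{\mathbf k}=F_{\beta_1}^{r_1}\cdots F_{\beta_M}^{r_M}K_1^{\mu_1}\cdots K_N^{\mu_N}E_{\beta_1}^{k_1}\cdots E_{\beta_M}^{k_M}$ ($\mathbf r,\mathbf k\in\mathbb{Z}_{\ge0}^M$, $\mu\in\mathbb{Z}^N$) form a basis of $U$. The total degree of such a monomial is $$d(F^{\mathbf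 r}K_\mu E^{\mathbf k})=\Big(k_M,\ldots,k_1,r_1,\ldots,r_M,\ \sum_{j=1}^M(k_j+r_j)\mathrm{ht}(\beta_j)\Big)\in\mathbb{Z}_{\ge0}^{2M+1},$$ where $\mathbb{Z}_{\ge0}^{2M+1}$ has the lexicographic order in which the last component is most significant, then the next-to-last, and so on. The De Concini-Kac filtration is $\{U_{(m)}\}_{m\in\mathbb{Z}_{\ge0}^{2M+1}}$, with $U_{(m)}$ the span of basis monomials of total degree $\le m$. For nonzero $u\in U$, $d(u)$ is the smallest $m$ with $u\in U_{(m)}$. One has $d(ab)=d(a)+d(b)$ for nonzero $a,b$. The leading term $\mathrm{lt}(u)$ is the part of $u$ of top degree: for nonzero $v$, $\mathrm{lt}(u)=v$ means $d(u)=d(v)$ and either $u=v$ or $d(u-v)<d(u)$ (i.e. $u$ and $v$ have the same nonzero class in the associated graded algebra). For $0\le s\le r\le N$, $r\ge 1$, $$d_{rs}=\sum_{\sigma\in S_r}(-q)^{-l(\sigma)}\sum_{k\in\{0,1\}^r,\ \sum k_i=s}q^{2(k_1+2k_2+\cdots+rk_r)}\,t_{\sigma(1)1}^{(k_1)}\cdots t_{\sigma(r)r}^{(k_r)},$$ where $l(\sigma)$ is the length (number of inversions) of $\sigma$. (When $s=r$ the product of $t^{(0)}$ factors in the claim is empty.) *)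

theory Defs
  imports Complex_Main "HOL-Library.Poly_Mapping" "HOL-Library.FuncSet"
    "HOL-Combinatorics.Permutations" "HOL-Algebra.QuotRing"
begin

section \<open>The free algebra\<close>

text \<open>Words form the free monoid under concatenation. Hence
  \<open>gen list \<Rightarrow>\<^sub>0 complex\<close> with its library convolution product is the free associative
  unital complex algebra on the generators.\<close>

instantiation list :: (type) monoid_add
begin
definition zero_list :: "'a list" where "zero_list = []"
definition plus_list :: "'a list \<Rightarrow> 'a list \<Rightarrow> 'a list" where "plus_list xs ys = xs @ ys"
instance by standard (simp_all add: zero_list_def plus_list_def)
end

datatype gen = T nat nat | Tbar nat nat

type_synonym falg = "gen list \<Rightarrow>\<^sub>0 complex"

definition const :: "complex \<Rightarrow> falg" where
  "const c = Poly_Mapping.single [] c"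

definition var :: "gen \<Rightarrow> falg" where
  "var g = Poly_Mapping.single [g] 1"

definition gens :: "nat \<Rightarrow> gen set" where
  "gens N = {T i j | i j. i \<in> {1..N} \<and> j \<in> {1..N}} \<union> {Tbar i j | i j. i \<in> {1..N} \<and> j \<in> {1..N}}"

definition free_alg :: "nat \<Rightarrow> falg ring" where
  "free_alg N = \<lparr>carrier = {p. Poly_Mapping.keys p \<subseteq> lists (gens N)},
     mult = (*), one = 1, zero = 0, add = (+)\<rparr>"

section \<open>The algebra \<open>U\<^sub>q(gl\<^sub>N)\<close>\<close>

text \<open>A relation \<open>x = y\<close> is recorded as the relator \<open>x - y\<close>.\<close>

definition rtt_rel :: "complex \<Rightarrow> nat \<Rightarrow> nat \<Rightarrow> nat \<Rightarrow> nat \<Rightarrow> falg" where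
  "rtt_rel q i a j b =
     const (q ^ of_bool (i = j)) * var (T i a) * var (T j b)
   - const (q ^ of_bool (a = b)) * var (T j b) * var (T i a)
   - const ((q - inverse q) * (of_bool (b < a) - of_bool (i < j))) * var (T j a) * var (T i b)"

definition rtt_rel_bar :: "complex \<Rightarrow> nat \<Rightarrow> nat \<Rightarrow> nat \<Rightarrow> nat \<Rightarrow> falg" where
  "rtt_rel_bar q i a j b =
     const (q ^ of_bool (i = j)) * var (Tbar i a) * var (Tbar j b)
   - const (q ^ of_bool (a = b)) * var (Tbar j b) * var (Tbar i a)
   - const ((q - inverse q) * (of_bool (b < a) - of_bool (i < j))) * var (Tbar j a) * var (Tbar i b)"

definition rtt_rel_mixed :: "complex \<Rightarrow> nat \<Rightarrow> nat \<Rightarrow> nat \<Rightarrow> nat \<Rightarrow> falg" where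
  "rtt_rel_mixed q i a j b =
     const (q ^ of_bool (i = j)) * var (Tbar i a) * var (T j b)
   - const (q ^ of_bool (a = b)) * var (T j b) * var (Tbar i a)
   - const (q - inverse q) *
       (const (of_bool (b < a)) * var (T j a) * var (Tbar i b)
        - const (of_bool (i < j)) * var (Tbar j a) * var (T i b))"

definition relators :: "nat \<Rightarrow> complex \<Rightarrow> falg set" where
  "relators N q =
     {var (T i j) | i j. i \<in> {1..N} \<and> j \<in> {1..N} \<and> i < j}
   \<union> {var (Tbar j i) | i j. i \<in> {1..N} \<and> j \<in> {1..N} \<and> i < j}
   \<union> {var (T i i) * var (Tbar i i) - 1 | i. i \<in> {1..N}}
   \<union> {var (Tbar i i) * var (T i i) - 1 | i. i \<in> {1..N}}
   \<union> {rtt_rel q i a j b | i a j b. {i, a, j, b} \<subseteq> {1..N}}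
   \<union> {rtt_rel_bar q i a j b | i a j b. {i, a, j, b} \<subseteq> {1..N}}
   \<union> {rtt_rel_mixed q i a j b | i a j b. {i, a, j, b} \<subseteq> {1..N}}"

text \<open>Ideals of \<open>HOL-Algebra\<close> are two-sided, and those of \<open>free_alg N\<close> are automatically
  complex subspaces because the constants lie in the carrier.\<close>

definition rel_ideal :: "nat \<Rightarrow> complex \<Rightarrow> falg set" where
  "rel_ideal N q = Idl\<^bsub>free_alg N\<^esub> (relators N q)"

definition Uq :: "nat \<Rightarrow> complex \<Rightarrow> falg set ring" where
  "Uq N q = free_alg N Quot rel_ideal N q"

definition proj :: "nat \<Rightarrow> complex \<Rightarrow> falg \<Rightarrow> falg set" where
  "proj N q x = rel_ideal N q +>\<^bsub>free_alg N\<^esub> x"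

definition smul :: "nat \<Rightarrow> complex \<Rightarrow> complex \<Rightarrow> falg set \<Rightarrow> falg set" where
  "smul N q c u = proj N q (const c) \<otimes>\<^bsub>Uq N q\<^esub> u"

text \<open>Ordered (noncommutative) product of a list, leftmost factor first.\<close>

definition uprod :: "nat \<Rightarrow> complex \<Rightarrow> falg set list \<Rightarrow> falg set" where
  "uprod N q us = foldr (\<lambda>u v. u \<otimes>\<^bsub>Uq N q\<^esub> v) us \<one>\<^bsub>Uq N q\<^esub>"

text \<open>\<open>tk N q k i j\<close> is \<open>t\<^sub>i\<^sub>j\<close> with superscript \<open>(k)\<close>, for \<open>k \<in> {0, 1}\<close>.\<close>

definition tk :: "nat \<Rightarrow> complex \<Rightarrow> nat \<Rightarrow> nat \<Rightarrow> nat \<Rightarrow> falg set" where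
  "tk N q k i j = proj N q (var (if k = 0 then T i j else Tbar i j))"

section \<open>Root vectors and ordered monomials\<close>

definition Kgen :: "nat \<Rightarrow> complex \<Rightarrow> nat \<Rightarrow> falg set" where
  "Kgen N q i = tk N q 0 i i"

definition Kinv :: "nat \<Rightarrow> complex \<Rightarrow> nat \<Rightarrow> falg set" where
  "Kinv N q i = tk N q 1 i i"

text \<open>The root \<open>\<epsilon>\<^sub>i - \<epsilon>\<^sub>j\<close> (with \<open>i < j\<close>) is encoded as \<open>(i, j)\<close>. Its root vectors, for the
  reduced decomposition \<open>(s\<^sub>1 s\<^sub>2 \<dots> s\<^bsub>N-1\<^esub>) (s\<^sub>1 \<dots> s\<^bsub>N-2\<^esub>) \<dots> (s\<^sub>1 s\<^sub>2) s\<^sub>1\<close> of the longest element, are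
  given in the RTT presentation by
  \<open>tbar\<^sub>i\<^sub>j = (-1)^(i-j+1) (q - q\<^sup>-\<^sup>1) K\<^sub>i\<^sup>-\<^sup>1 E\<^sub>i\<^sub>j\<close> and \<open>t\<^sub>j\<^sub>i = -(q - q\<^sup>-\<^sup>1) F\<^sub>i\<^sub>j K\<^sub>i\<close>;
  the definitions below solve these two equations for \<open>E\<^sub>i\<^sub>j\<close> and \<open>F\<^sub>i\<^sub>j\<close>.\<close>

definition Eroot :: "nat \<Rightarrow> complex \<Rightarrow> nat \<times> nat \<Rightarrow> falg set" where
  "Eroot N q = (\<lambda>(i, j).
     smul N q (inverse ((-1) powi (int i - int j + 1) * (q - inverse q)))
       (Kgen N q i \<otimes>\<^bsub>Uq N q\<^esub> tk N q 1 i j))"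

definition Froot :: "nat \<Rightarrow> complex \<Rightarrow> nat \<times> nat \<Rightarrow> falg set" where
  "Froot N q = (\<lambda>(i, j).
     smul N q (inverse (- (q - inverse q))) (tk N q 0 j i \<otimes>\<^bsub>Uq N q\<^esub> Kinv N q i))"

definition pos_roots :: "nat \<Rightarrow> (nat \<times> nat) list" where
  "pos_roots N = concat (map (\<lambda>i. map (\<lambda>j. (i, j)) [Suc i..<Suc N]) [1..<Suc N])"

definition num_roots :: "nat \<Rightarrow> nat" where
  "num_roots N = N * (N - 1) div 2"

definition height :: "nat \<times> nat \<Rightarrow> nat" where
  "height = (\<lambda>(i, j). j - i)"

text \<open>Exponent data \<open>(r, \<mu>, k)\<close> of the monomial \<open>F\<^sup>r K\<^sub>\<mu> E\<^sup>k\<close>.\<close>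

type_synonym expo = "nat list \<times> int list \<times> nat list"

definition expos :: "nat \<Rightarrow> expo set" where
  "expos N = {(r, \<mu>, k). length r = num_roots N \<and> length \<mu> = N \<and> length k = num_roots N}"

definition pbw_monom :: "nat \<Rightarrow> complex \<Rightarrow> expo \<Rightarrow> falg set" where
  "pbw_monom N q = (\<lambda>(r, \<mu>, k). uprod N q
     (map2 (\<lambda>\<beta> e. Froot N q \<beta> [^]\<^bsub>Uq N q\<^esub> e) (pos_roots N) r
      @ map2 (\<lambda>i m. Kgen N q i [^]\<^bsub>Uq N q\<^esub> m) [1..<Suc N] \<mu>
      @ map2 (\<lambda>\<beta> e. Eroot N q \<beta> [^]\<^bsub>Uq N q\<^esub> e) (pos_roots N) k))"

section \<open>Total degree, De Concini--Kac filtration, leading terms\<close>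

definition total_degree :: "nat \<Rightarrow> expo \<Rightarrow> nat list" where
  "total_degree N = (\<lambda>(r, \<mu>, k).
     rev k @ r @ [(\<Sum>j<num_roots N. (k ! j + r ! j) * height (pos_roots N ! j))])"

definition degs :: "nat \<Rightarrow> nat list set" where
  "degs N = {m. length m = 2 * num_roots N + 1}"

text \<open>Lexicographic order on lists of equal length whose \<^emph>\<open>last\<close> entry is most significant.\<close>

definition deg_less :: "nat list \<Rightarrow> nat list \<Rightarrow> bool" where
  "deg_less m m' \<longleftrightarrow> (rev m, rev m') \<in> lex less_than"

definition deg_le :: "nat list \<Rightarrow> nat list \<Rightarrow> bool" where
  "deg_le m m' \<longleftrightarrow> deg_less m m' \<or> m = m'"

definition DCK_filtration :: "nat \<Rightarrow> complex \<Rightarrow> nat list \<Rightarrow> falg set set" where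
  "DCK_filtration N q m =
     {finsum (Uq N q) (\<lambda>x. smul N q (c x) (pbw_monom N q x)) A | c A.
        finite A \<and> A \<subseteq> {x \<in> expos N. deg_le (total_degree N x) m}}"

text \<open>Only meaningful for nonzero \<open>u\<close>; the minimum exists since \<open>deg_less\<close> is a well-order
  on \<open>degs N\<close> and the ordered monomials span.\<close>

definition deg :: "nat \<Rightarrow> complex \<Rightarrow> falg set \<Rightarrow> nat list" where
  "deg N q u = (THE m. m \<in> degs N \<and> u \<in> DCK_filtration N q m \<and>
     (\<forall>m'\<in>degs N. u \<in> DCK_filtration N q m' \<longrightarrow> deg_le m m'))"

text \<open>\<open>has_lt N q u v\<close> means \<open>lt(u) = v\<close>, that is, \<open>u\<close> and \<open>v\<close> have the same nonzero class in
  the associated graded algebra.\<close>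

definition has_lt :: "nat \<Rightarrow> complex \<Rightarrow> falg set \<Rightarrow> falg set \<Rightarrow> bool" where
  "has_lt N q u v \<longleftrightarrow>
     u \<in> carrier (Uq N q) \<and> v \<in> carrier (Uq N q) \<and>
     u \<noteq> \<zero>\<^bsub>Uq N q\<^esub> \<and> v \<noteq> \<zero>\<^bsub>Uq N q\<^esub> \<and>
     deg N q u = deg N q v \<and>
     (u = v \<or> deg_less (deg N q (u \<ominus>\<^bsub>Uq N q\<^esub> v)) (deg N q u))"

section \<open>The elements \<open>d\<^sub>r\<^sub>s\<close>\<close>

definition perm_length :: "nat \<Rightarrow> (nat \<Rightarrow> nat) \<Rightarrow> nat" where
  "perm_length r \<sigma> = card {(i, j). 1 \<le> i \<and> i < j \<and> j \<le> r \<and> \<sigma> j < \<sigma> i}"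

definition drs :: "nat \<Rightarrow> complex \<Rightarrow> nat \<Rightarrow> nat \<Rightarrow> falg set" where
  "drs N q r s =
     (\<Oplus>\<^bsub>Uq N q\<^esub>\<sigma>\<in>{\<sigma>. \<sigma> permutes {1..r}}.
        smul N q ((- q) powi (- int (perm_length r \<sigma>)))
          (\<Oplus>\<^bsub>Uq N q\<^esub>k\<in>{k \<in> {1..r} \<rightarrow>\<^sub>E {0, 1::nat}. (\<Sum>i=1..r. k i) = s}.
             smul N q (q ^ (2 * (\<Sum>i=1..r. i * k i)))
               (uprod N q (map (\<lambda>i. tk N q (k i) (\<sigma> i) i) [1..<Suc r]))))"

end

theory Submission
  imports Defs "HOL-Library.Product_Lexorder"
begin

text \<open>Put \<open>n = r - s\<close>. A summand of \<open>d\<^sub>r\<^sub>s\<close> given by \<open>\<sigma>\<close> and \<open>k\<close> is zero unless \<open>\<sigma>(i) \<ge> i\<close> where \<open>k\<^sub>i = 0\<close>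
  and \<open>\<sigma>(i) \<le> i\<close> where \<open>k\<^sub>i = 1\<close>, and then its height is \<open>2 \<Sum> (\<sigma>(i) - i)\<close> over the \<open>n\<close> indices with \<open>k\<^sub>i = 0\<close>.
  This is at most \<open>2ns\<close>, with equality only if \<open>k = (0\<^sup>n, 1\<^sup>s)\<close> and \<open>\<sigma>\<close> maps \<open>{1..n}\<close> onto \<open>{s+1..r}\<close>.
  Summands of smaller height are lower terms, because straightening a word into ordered monomials never
  raises the height. Summands of height \<open>2ns\<close> are ordered monomials up to a scalar, since the
  letters that must be exchanged commute up to scalars, and the lexicographic comparison of exponents
  singles out \<open>\<sigma>(i) = i + s\<close> modulo \<open>r\<close>.

  What remains is that the leading monomial is not a combination of lower ones. On the tensor power
  \<open>V\<^sup>\<otimes>\<^sup>r\<close> of the vector representation, consider the matrix entry with row index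
  \<open>(s+1, \<dots>, r, s, \<dots>, 1)\<close> and column index \<open>(1, \<dots>, n, r, \<dots>, n+1)\<close>. The first \<open>n\<close> slots have to rise and the last \<open>s\<close>
  slots to fall by a total of \<open>2ns\<close>, so monomials of smaller height vanish there, and in those of height
  \<open>2ns\<close> the \<open>F\<close> act on the first \<open>n\<close> slots only and the \<open>E\<close> on the last \<open>s\<close> only. Following the slots one
  by one shows that the entry vanishes on all lower monomials but not on the leading one.\<close>

section \<open>The tensor powers of the vector representation\<close>

text \<open>\<open>deg\<close> is defined through membership in the filtration, so a leading term is
  certified by two facts: the rest lies in the span of ordered monomials of smaller degree, and the
  candidate itself does not. The second fact is settled by a linear functional on U, a matrix entry
  on a tensor power. There are r = n + s slots, one for each letter of the leading word, and the two
  indices differ by exactly the moves of these letters. Whether an entry can be nonzero is a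
  question about paths of indices, with coefficients forgotten; for the leading word the path is
  unique, so nothing cancels. The last s slots carry their contents in decreasing order, which puts
  the smallest content into the last slot: a chain of index changes that starts there also ends
  there. Scalars are only kept nonzero, since the claim leaves \<lambda> open. For n = 0 the pairs
  (i, n + i) are not roots; then d_rs is itself a multiple of a product of diagonal letters, and the
  trivial representation shows that it is nonzero.\<close>

definition matmul :: "'a set \<Rightarrow> ('a \<Rightarrow> 'a \<Rightarrow> complex) \<Rightarrow> ('a \<Rightarrow> 'a \<Rightarrow> complex) \<Rightarrow> 'a \<Rightarrow> 'a \<Rightarrow> complex" where
  "matmul I F G x z = (\<Sum>y\<in>I. F x y * G y z)"

text \<open>The three families of quadratic relations are the entries of \<open>R A\<^sub>1 B\<^sub>2 = B\<^sub>2 A\<^sub>1 R\<close> for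
  \<open>(A, B)\<close> equal to \<open>(t, t)\<close>, \<open>(tbar, tbar)\<close> and \<open>(tbar, t)\<close>.\<close>

definition rtt :: "nat \<Rightarrow> complex \<Rightarrow> 'a set \<Rightarrow> (nat \<Rightarrow> nat \<Rightarrow> 'a \<Rightarrow> 'a \<Rightarrow> complex) \<Rightarrow>
    (nat \<Rightarrow> nat \<Rightarrow> 'a \<Rightarrow> 'a \<Rightarrow> complex) \<Rightarrow> bool" where
  "rtt N q I A B \<longleftrightarrow> (\<forall>i\<in>{1..N}. \<forall>j\<in>{1..N}. \<forall>a\<in>{1..N}. \<forall>b\<in>{1..N}. \<forall>x\<in>I. \<forall>z\<in>I.
     q ^ of_bool (i = j) * matmul I (A i a) (B j b) x z
       + (q - inverse q) * of_bool (i < j) * matmul I (A j a) (B i b) x z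
     = q ^ of_bool (a = b) * matmul I (B j b) (A i a) x z
       + (q - inverse q) * of_bool (b < a) * matmul I (B j a) (A i b) x z)"

text \<open>With R the matrix of coefficients in \<open>rtt\<close>, the matrices of
  \<open>Tbar i j\<close> are the transposed blocks of the inverse of R, and those of
  \<open>T i j\<close> the transposed blocks of R with its tensor factors exchanged. The relations
  for them are forms of the Yang-Baxter equation.\<close>

fun vrep :: "complex \<Rightarrow> gen \<Rightarrow> nat \<Rightarrow> nat \<Rightarrow> complex" where
  "vrep q (T i j) x y = (if i = j then of_bool (x = y) * (if x = i then q else 1)
     else of_bool (j < i \<and> x = i \<and> y = j) * (q - inverse q))"
| "vrep q (Tbar i j) x y = (if i = j then of_bool (x = y) * (if x = i then inverse q else 1)
     else - of_bool (i < j \<and> x = i \<and> y = j) * (q - inverse q))"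

text \<open>A row of a generator has at most one nonzero entry, so the product is a single term. The
  relations then become finitely many rational identities in \<open>q\<close>, one for each pattern
  of coinciding indices.\<close>

lemma matmul_vrep_left:
  assumes "a \<in> {1..N}" "x \<in> {1..N}" "C = T \<or> C = Tbar"
  shows "matmul {1..N} (vrep q (C i a)) G x z = (if i = a then vrep q (C i a) x x * G x z else vrep q (C i a) x a * G a z)"
proof -
  let ?y = "if i = a then x else a"
  have "matmul {1..N} (vrep q (C i a)) G x z = (\<Sum>y\<in>{?y}. vrep q (C i a) x y * G y z)"
    unfolding matmul_def using assms by (intro sum.mono_neutral_right) auto
  then show ?thesis by simp
qed

lemma rtt_vrep:
  assumes "q \<noteq> 0" and "C = D \<or> C = Tbar \<and> D = T" "C = T \<or> C = Tbar"
  shows "rtt N q {1..N} (\<lambda>i j. vrep q (C i j)) (\<lambda>i j. vrep q (D i j))"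
proof -
  have CD: "D = T \<or> D = Tbar" using assms by auto
  have "q ^ of_bool (i = j) * matmul {1..N} (vrep q (C i a)) (vrep q (D j b)) x z
       + (q - inverse q) * of_bool (i < j) * matmul {1..N} (vrep q (C j a)) (vrep q (D i b)) x z
     = q ^ of_bool (a = b) * matmul {1..N} (vrep q (D j b)) (vrep q (C i a)) x z
       + (q - inverse q) * of_bool (b < a) * matmul {1..N} (vrep q (D j a)) (vrep q (C i b)) x z"
    if "i \<in> {1..N}" "j \<in> {1..N}" "a \<in> {1..N}" "b \<in> {1..N}" "x \<in> {1..N}" "z \<in> {1..N}" for i j a b x z
  proof -
    have *: "(C = T \<and> D = T) \<or> (C = Tbar \<and> D = Tbar) \<or> (C = Tbar \<and> D = T)"
      using assms by auto
    show ?thesis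
      unfolding matmul_vrep_left[OF that(3,5) assms(3)] matmul_vrep_left[OF that(4,5) CD]
         matmul_vrep_left[OF that(4,5) assms(3)] matmul_vrep_left[OF that(3,5) CD]
      using * assms(1)
      apply (cases "i = a"; cases "j = b"; cases "i = b"; cases "j = a"; simp)
      apply (auto simp: field_simps)
      done
  qed
  then show ?thesis unfolding rtt_def by blast
qed

definition tensor_index :: "nat \<Rightarrow> nat \<Rightarrow> nat list set" where
  "tensor_index N m = {xs. length xs = m \<and> set xs \<subseteq> {1..N}}"

text \<open>The action of the generators on \<open>V\<^sup>\<otimes>\<^sup>m\<close> through the coproduct \<open>t\<^sub>i\<^sub>j \<mapsto> \<Sum>\<^sub>k t\<^sub>i\<^sub>k \<otimes> t\<^sub>k\<^sub>j\<close>.\<close>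

fun trep :: "nat \<Rightarrow> complex \<Rightarrow> (nat \<Rightarrow> nat \<Rightarrow> gen) \<Rightarrow> nat \<Rightarrow> nat \<Rightarrow> nat list \<Rightarrow> nat list \<Rightarrow> complex" where
  "trep N q C i j [] [] = of_bool (i = j)"
| "trep N q C i j (x # xs) (y # ys) = (\<Sum>k=1..N. vrep q (C i k) x y * trep N q C k j xs ys)"
| "trep N q C i j _ _ = 0"

lemma finite_tensor_index [simp]: "finite (tensor_index N m)"
proof -
  have "tensor_index N m = {xs. set xs \<subseteq> {1..N} \<and> length xs = m}"
    by (auto simp: tensor_index_def)
  then show ?thesis using finite_lists_length_eq[of "{1..N}" m] by simp
qed

lemma tensor_index_0: "tensor_index N 0 = {[]}"
  by (auto simp: tensor_index_def)

lemma tensor_index_Suc: "tensor_index N (Suc m) = (\<lambda>(x, xs). x # xs) ` ({1..N} \<times> tensor_index N m)"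
  by (auto simp: tensor_index_def length_Suc_conv image_iff)

lemma sum_tensor_index_Suc:
  "(\<Sum>zs\<in>tensor_index N (Suc m). f zs) = (\<Sum>z=1..N. \<Sum>zs\<in>tensor_index N m. f (z # zs))"
  unfolding tensor_index_Suc
  by (subst sum.reindex) (auto simp: inj_on_def sum.cartesian_product intro!: sum.cong)

text \<open>Multiplicativity of the coproduct: the first slot and the remaining slots multiply
  separately, and \<open>k\<close>, \<open>l\<close> are the coproduct indices between them.\<close>

lemma matmul_trep_Suc:
  "matmul (tensor_index N (Suc m)) (trep N q C i a) (trep N q D j b) (x # xs) (z # zs) =
   (\<Sum>k=1..N. \<Sum>l=1..N. matmul {1..N} (vrep q (C i k)) (vrep q (D j l)) x z
      * matmul (tensor_index N m) (trep N q C k a) (trep N q D l b) xs zs)"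
proof -
  have "matmul (tensor_index N (Suc m)) (trep N q C i a) (trep N q D j b) (x # xs) (z # zs)
     = (\<Sum>y=1..N. \<Sum>ys\<in>tensor_index N m. \<Sum>k=1..N. \<Sum>l=1..N.
         (vrep q (C i k) x y * vrep q (D j l) y z) * (trep N q C k a xs ys * trep N q D l b ys zs))"
    unfolding matmul_def sum_tensor_index_Suc by (simp add: sum_product algebra_simps)
  also have "\<dots> = (\<Sum>y=1..N. \<Sum>k=1..N. \<Sum>l=1..N. \<Sum>ys\<in>tensor_index N m. 
         (vrep q (C i k) x y * vrep q (D j l) y z) * (trep N q C k a xs ys * trep N q D l b ys zs))"
    by (subst sum.swap, subst (2) sum.swap) simp
  also have "\<dots> = (\<Sum>k=1..N. \<Sum>l=1..N. \<Sum>y=1..N. \<Sum>ys\<in>tensor_index N m. 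
         (vrep q (C i k) x y * vrep q (D j l) y z) * (trep N q C k a xs ys * trep N q D l b ys zs))"
    by (subst sum.swap, subst (2) sum.swap) simp
  also have "\<dots> = (\<Sum>k=1..N. \<Sum>l=1..N. matmul {1..N} (vrep q (C i k)) (vrep q (D j l)) x z
      * matmul (tensor_index N m) (trep N q C k a) (trep N q D l b) xs zs)"
    unfolding matmul_def sum_product by simp
  finally show ?thesis .
qed

lemma rtt_trep_0: "rtt N q (tensor_index N 0) (trep N q C) (trep N q D)"
  unfolding rtt_def tensor_index_0 matmul_def by (auto split: if_splits)

text \<open>The coefficients that make up R are carried from the row indices \<open>i\<close>,
  \<open>j\<close> past the first slot to the middle indices \<open>k\<close>, \<open>l\<close>, and
  from there past the remaining slots to the column indices \<open>a\<close>, \<open>b\<close>. This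
  is the usual reason why the coproduct respects RTT relations.\<close>

lemma rtt_trep_Suc:
  assumes V: "rtt N q {1..N} (\<lambda>i j. vrep q (C i j)) (\<lambda>i j. vrep q (D i j))"
    and W: "rtt N q (tensor_index N m) (trep N q C) (trep N q D)"
  shows "rtt N q (tensor_index N (Suc m)) (trep N q C) (trep N q D)"
  unfolding rtt_def
proof (intro ballI)
  fix i j a b xs' zs'
  assume ij: "i \<in> {1..N}" "j \<in> {1..N}" "a \<in> {1..N}" "b \<in> {1..N}"
    and xz: "xs' \<in> tensor_index N (Suc m)" "zs' \<in> tensor_index N (Suc m)"
  obtain x xs z zs where x: "xs' = x # xs" "x \<in> {1..N}" "xs \<in> tensor_index N m"
    and z: "zs' = z # zs" "z \<in> {1..N}" "zs \<in> tensor_index N m"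
    using xz unfolding tensor_index_Suc by auto
  define h where "h = q - inverse q"
  define X where "X i j a b = matmul {1..N} (vrep q (C i a)) (vrep q (D j b)) x z" for i j a b
  define Y where "Y i j a b = matmul {1..N} (vrep q (D j b)) (vrep q (C i a)) x z" for i j a b
  define X' where "X' i j a b = matmul (tensor_index N m) (trep N q C i a) (trep N q D j b) xs zs" for i j a b
  define Y' where "Y' i j a b = matmul (tensor_index N m) (trep N q D j b) (trep N q C i a) xs zs" for i j a b
  have V': "q ^ of_bool (i = j) * X i j a b + h * of_bool (i < j) * X j i a b
     = q ^ of_bool (a = b) * Y i j a b + h * of_bool (b < a) * Y i j b a"
    if "a \<in> {1..N}" "b \<in> {1..N}" for a b
    using V ij x z that unfolding rtt_def h_def X_def Y_def by blast
  have W': "q ^ of_bool (i = j) * X' i j a b + h * of_bool (i < j) * X' j i a b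
     = q ^ of_bool (a = b) * Y' i j a b + h * of_bool (b < a) * Y' i j b a"
    if "i \<in> {1..N}" "j \<in> {1..N}" for i j
    using W ij x z that unfolding rtt_def h_def X'_def Y'_def by blast
  have swap: "(\<Sum>k=1..N. \<Sum>l=1..N. f k l) = (\<Sum>k=1..N. \<Sum>l=1..N. f l k)" for f :: "nat \<Rightarrow> nat \<Rightarrow> complex"
    by (rule sum.swap)
  have "q ^ of_bool (i = j) * (\<Sum>k=1..N. \<Sum>l=1..N. X i j k l * X' k l a b)
       + h * of_bool (i < j) * (\<Sum>k=1..N. \<Sum>l=1..N. X j i k l * X' k l a b)
     = (\<Sum>k=1..N. \<Sum>l=1..N. (q ^ of_bool (i = j) * X i j k l + h * of_bool (i < j) * X j i k l) * X' k l a b)"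
    by (simp add: sum_distrib_left sum.distrib algebra_simps)
  also have "\<dots> = (\<Sum>k=1..N. \<Sum>l=1..N. (q ^ of_bool (k = l) * Y i j k l + h * of_bool (l < k) * Y i j l k) * X' k l a b)"
    by (intro sum.cong refl) (simp add: V')
  also have "\<dots> = (\<Sum>k=1..N. \<Sum>l=1..N. Y i j k l * (q ^ of_bool (k = l) * X' k l a b))
       + (\<Sum>k=1..N. \<Sum>l=1..N. h * of_bool (l < k) * Y i j l k * X' k l a b)"
    by (simp add: sum.distrib algebra_simps)
  \<comment> \<open>Renaming \<open>k\<close> and \<open>l\<close> turns the condition
    \<open>l < k\<close> on the column indices of the first slot into \<open>k < l\<close> on the
    row indices of the rest, which is the shape of the left-hand side for the rest.\<close>
  also have "(\<Sum>k=1..N. \<Sum>l=1..N. h * of_bool (l < k) * Y i j l k * X' k l a b)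
      = (\<Sum>k=1..N. \<Sum>l=1..N. h * of_bool (k < l) * Y i j k l * X' l k a b)"
    by (rule swap)
  also have "(\<Sum>k=1..N. \<Sum>l=1..N. Y i j k l * (q ^ of_bool (k = l) * X' k l a b)) + \<dots>
     = (\<Sum>k=1..N. \<Sum>l=1..N. Y i j k l * (q ^ of_bool (k = l) * X' k l a b + h * of_bool (k < l) * X' l k a b))"
    by (simp add: sum.distrib algebra_simps)
  also have "\<dots> = (\<Sum>k=1..N. \<Sum>l=1..N. Y i j k l * (q ^ of_bool (a = b) * Y' k l a b + h * of_bool (b < a) * Y' k l b a))"
    by (intro sum.cong refl) (simp add: W')
  also have "\<dots> = q ^ of_bool (a = b) * (\<Sum>k=1..N. \<Sum>l=1..N. Y i j k l * Y' k l a b)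
       + h * of_bool (b < a) * (\<Sum>k=1..N. \<Sum>l=1..N. Y i j k l * Y' k l b a)"
    by (simp add: sum_distrib_left sum.distrib algebra_simps)
  finally have main: "q ^ of_bool (i = j) * (\<Sum>k=1..N. \<Sum>l=1..N. X i j k l * X' k l a b)
       + h * of_bool (i < j) * (\<Sum>k=1..N. \<Sum>l=1..N. X j i k l * X' k l a b)
     = q ^ of_bool (a = b) * (\<Sum>k=1..N. \<Sum>l=1..N. Y i j k l * Y' k l a b)
       + h * of_bool (b < a) * (\<Sum>k=1..N. \<Sum>l=1..N. Y i j k l * Y' k l b a)" .
  have X_eq: "matmul (tensor_index N (Suc m)) (trep N q C i a) (trep N q D j b) xs' zs'
      = (\<Sum>k=1..N. \<Sum>l=1..N. X i j k l * X' k l a b)" for i j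
    unfolding x z matmul_trep_Suc X_def X'_def ..
  have Y_eq: "matmul (tensor_index N (Suc m)) (trep N q D j b) (trep N q C i a) xs' zs'
      = (\<Sum>k=1..N. \<Sum>l=1..N. Y i j k l * Y' k l a b)" for a b
    unfolding x z matmul_trep_Suc Y_def Y'_def by (rule swap)
  show "q ^ of_bool (i = j) * matmul (tensor_index N (Suc m)) (trep N q C i a) (trep N q D j b) xs' zs'
       + (q - inverse q) * of_bool (i < j) * matmul (tensor_index N (Suc m)) (trep N q C j a) (trep N q D i b) xs' zs'
     = q ^ of_bool (a = b) * matmul (tensor_index N (Suc m)) (trep N q D j b) (trep N q C i a) xs' zs'
       + (q - inverse q) * of_bool (b < a) * matmul (tensor_index N (Suc m)) (trep N q D j a) (trep N q C i b) xs' zs'"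
    unfolding X_eq Y_eq using main unfolding h_def .
qed

lemma rtt_trep:
  assumes "q \<noteq> 0" and "C = D \<or> C = Tbar \<and> D = T" "C = T \<or> C = Tbar"
  shows "rtt N q (tensor_index N m) (trep N q C) (trep N q D)"
  by (induction m) (intro rtt_trep_0 rtt_trep_Suc rtt_vrep assms; assumption)+

lemma trep_T_zero: "i < j \<Longrightarrow> trep N q T i j xs ys = 0"
proof (induction xs arbitrary: i ys)
  case Nil
  then show ?case by (cases ys) auto
next
  case (Cons x xs)
  show ?case
  proof (cases ys)
    case (Cons y ys')
    have "vrep q (T i k) x y * trep N q T k j xs ys' = 0" for k
      using Cons.prems Cons.IH[of k ys'] by (cases "k < j") auto
    then show ?thesis unfolding Cons trep.simps by (intro sum.neutral ballI)
  qed simp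
qed

lemma trep_Tbar_zero: "j < i \<Longrightarrow> trep N q Tbar i j xs ys = 0"
proof (induction xs arbitrary: i ys)
  case Nil
  then show ?case by (cases ys) auto
next
  case (Cons x xs)
  show ?case
  proof (cases ys)
    case (Cons y ys')
    have "vrep q (Tbar i k) x y * trep N q Tbar k j xs ys' = 0" for k
      using Cons.prems Cons.IH[of k ys'] by (cases "j < k") auto
    then show ?thesis unfolding Cons trep.simps by (intro sum.neutral ballI)
  qed simp
qed

text \<open>If the coproduct index leaves \<open>i\<close>, one of the two factors is a vanishing
  triangular entry, so it stays at \<open>i\<close> through all slots.\<close>

lemma trep_T_diag:
  assumes "i \<in> {1..N}"
  shows "trep N q T i i xs ys = of_bool (xs = ys) * (\<Prod>x\<leftarrow>xs. if x = i then q else 1)"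
proof (induction xs arbitrary: ys)
  case Nil
  then show ?case by (cases ys) auto
next
  case (Cons x xs)
  show ?case
  proof (cases ys)
    case (Cons y ys')
    have "trep N q T i i (x # xs) ys = (\<Sum>k\<in>{i}. vrep q (T i k) x y * trep N q T k i xs ys')"
      unfolding Cons trep.simps using assms
      by (intro sum.mono_neutral_right) (auto simp: trep_T_zero linorder_neq_iff)
    then show ?thesis using Cons Cons.IH by auto
  qed simp
qed

lemma trep_Tbar_diag:
  assumes "i \<in> {1..N}"
  shows "trep N q Tbar i i xs ys = of_bool (xs = ys) * (\<Prod>x\<leftarrow>xs. if x = i then inverse q else 1)"
proof (induction xs arbitrary: ys)
  case Nil
  then show ?case by (cases ys) auto
next
  case (Cons x xs)
  show ?case
  proof (cases ys)
    case (Cons y ys')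
    have "trep N q Tbar i i (x # xs) ys = (\<Sum>k\<in>{i}. vrep q (Tbar i k) x y * trep N q Tbar k i xs ys')"
      unfolding Cons trep.simps using assms
      by (intro sum.mono_neutral_right) (auto simp: trep_Tbar_zero linorder_neq_iff)
    then show ?thesis using Cons Cons.IH by auto
  qed simp
qed

section \<open>Words in the free algebra and their classes\<close>

lemma poly_mapping_eq_sum_single:
  fixes p :: "'a \<Rightarrow>\<^sub>0 'b::comm_monoid_add"
  shows "p = (\<Sum>w\<in>Poly_Mapping.keys p. Poly_Mapping.single w (Poly_Mapping.lookup p w))"
  by (rule poly_mapping_eqI)
    (auto simp: lookup_sum lookup_single when_def in_keys_iff sum.delta)

lemma poly_mapping_single_induct [case_names zero add]:
  fixes p :: "'a \<Rightarrow>\<^sub>0 'b::comm_monoid_add"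
  assumes "P 0" and "\<And>w c p. w \<in> S \<Longrightarrow> P p \<Longrightarrow> P (p + Poly_Mapping.single w c)"
    and "Poly_Mapping.keys p \<subseteq> S"
  shows "P p"
proof -
  have "P (\<Sum>w\<in>A. Poly_Mapping.single w (f w))" if "finite A" "A \<subseteq> S" for A f
    using that
  proof (induction A rule: finite_induct)
    case (insert x A)
    then show ?case using assms(2)[of x "\<Sum>w\<in>A. Poly_Mapping.single w (f w)" "f x"] by (simp add: add.commute)
  qed (simp add: assms)
  from this[of "Poly_Mapping.keys p" "Poly_Mapping.lookup p"] show ?thesis
    using assms(3) by (subst poly_mapping_eq_sum_single) simp
qed

abbreviation monomial :: "gen list \<Rightarrow> complex \<Rightarrow> falg" where
  "monomial \<equiv> Poly_Mapping.single"

abbreviation word :: "gen list \<Rightarrow> falg" where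
  "word w \<equiv> monomial w 1"

lemma single_mult_single:
  "monomial (u :: gen list) c * monomial v d = monomial (u @ v) (c * d :: complex)"
  by (simp add: mult_single plus_list_def)

lemma one_eq_word: "(1 :: falg) = word []"
  by (metis single_one zero_list_def)

definition falg_on :: "nat \<Rightarrow> falg set" where
  "falg_on N = {p. Poly_Mapping.keys p \<subseteq> lists (gens N)}"

lemma falg_on_single [simp]: "monomial w c \<in> falg_on N \<longleftrightarrow> c = 0 \<or> set w \<subseteq> gens N"
  by (auto simp: falg_on_def)

lemma falg_on_0 [simp]: "0 \<in> falg_on N" and falg_on_1 [simp]: "1 \<in> falg_on N"
  by (auto simp: falg_on_def one_eq_word)

lemma falg_on_add [intro]: "p \<in> falg_on N \<Longrightarrow> p' \<in> falg_on N \<Longrightarrow> p + p' \<in> falg_on N"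
  unfolding falg_on_def using Poly_Mapping.keys_add[of p p'] by blast

lemma falg_on_uminus [simp]: "- p \<in> falg_on N \<longleftrightarrow> p \<in> falg_on N"
  by (simp add: falg_on_def)

lemma falg_on_diff [intro]: "p \<in> falg_on N \<Longrightarrow> p' \<in> falg_on N \<Longrightarrow> p - p' \<in> falg_on N"
  using falg_on_add[of p N "- p'"] by simp

lemma falg_on_mult [intro]:
  assumes "p \<in> falg_on N" "p' \<in> falg_on N"
  shows "p * p' \<in> falg_on N"
proof -
  have "Poly_Mapping.keys (p * p') \<subseteq> {a + b |a b. a \<in> Poly_Mapping.keys p \<and> b \<in> Poly_Mapping.keys p'}"
    by (rule keys_mult)
  also have "\<dots> \<subseteq> lists (gens N)"
    using assms unfolding falg_on_def plus_list_def by auto (metis in_listsD subset_eq)+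
  finally show ?thesis by (simp add: falg_on_def)
qed

lemma falg_on_sum [intro]: "(\<And>x. x \<in> A \<Longrightarrow> f x \<in> falg_on N) \<Longrightarrow> sum f A \<in> falg_on N"
  by (induction A rule: infinite_finite_induct) auto

lemma free_alg_simps [simp]:
  "carrier (free_alg N) = falg_on N" "mult (free_alg N) = (*)" "one (free_alg N) = 1"
  "zero (free_alg N) = 0" "add (free_alg N) = (+)"
  by (simp_all add: free_alg_def falg_on_def)

lemma ring_free_alg: "ring (free_alg N)"
proof (rule ringI)
  show "abelian_group (free_alg N)"
  proof (rule abelian_groupI)
    fix x assume "x \<in> carrier (free_alg N)"
    then show "\<exists>y\<in>carrier (free_alg N). y \<oplus>\<^bsub>free_alg N\<^esub> x = \<zero>\<^bsub>free_alg N\<^esub>"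
      by (intro bexI[of _ "- x"]) auto
  qed (auto simp: add_ac)
  show "Group.monoid (free_alg N)"
    by (rule monoidI) (auto simp: mult.assoc)
qed (auto simp: distrib_left distrib_right)

lemma minus_free_alg:
  assumes "p \<in> falg_on N" shows "\<ominus>\<^bsub>free_alg N\<^esub> p = - p"
proof -
  interpret ring "free_alg N" by (rule ring_free_alg)
  show ?thesis using assms minus_equality[of "- p" p] by simp
qed

lemma const_mult_single: "const c * monomial w d = monomial w (c * d)"
  by (simp add: const_def single_mult_single)

lemma const_falg_on [simp]: "const c \<in> falg_on N"
  by (simp add: const_def)

lemma var_falg_on [simp]: "var g \<in> falg_on N \<longleftrightarrow> g \<in> gens N"
  by (simp add: var_def)

lemma gens_simps [simp]:
  "T i j \<in> gens N \<longleftrightarrow> i \<in> {1..N} \<and> j \<in> {1..N}" "Tbar i j \<in> gens N \<longleftrightarrow> i \<in> {1..N} \<and> j \<in> {1..N}"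
  by (auto simp: gens_def)

lemma rtt_rel_falg_on:
  assumes "{i, a, j, b} \<subseteq> {1..N}"
  shows "rtt_rel q i a j b \<in> falg_on N" "rtt_rel_bar q i a j b \<in> falg_on N" "rtt_rel_mixed q i a j b \<in> falg_on N"
  unfolding rtt_rel_def rtt_rel_bar_def rtt_rel_mixed_def
  by (intro falg_on_diff falg_on_mult const_falg_on; use assms in simp)+

lemma relators_subset: "relators N q \<subseteq> falg_on N"
proof -
  have "var (T i j) \<in> falg_on N" "var (Tbar i j) \<in> falg_on N"
    "var (T i i) * var (Tbar i i) - 1 \<in> falg_on N" "var (Tbar i i) * var (T i i) - 1 \<in> falg_on N"
    if "i \<in> {1..N}" "j \<in> {1..N}" for i j
    using that by (simp_all add: falg_on_diff falg_on_mult)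
  then show ?thesis
    unfolding relators_def
    by (intro Un_least subsetI; elim CollectE exE conjE; simp only: rtt_rel_falg_on)
qed

lemma ideal_rel_ideal: "ideal (rel_ideal N q) (free_alg N)"
  unfolding rel_ideal_def using relators_subset by (intro ring.genideal_ideal ring_free_alg) simp

lemma rel_ideal_subset: "rel_ideal N q \<subseteq> falg_on N"
  using ideal.Icarr[OF ideal_rel_ideal] by auto

lemma rel_ideal_carrier [dest]: "p \<in> rel_ideal N q \<Longrightarrow> p \<in> falg_on N"
  using rel_ideal_subset by blast

lemma relator_in_rel_ideal: "p \<in> relators N q \<Longrightarrow> p \<in> rel_ideal N q"
  unfolding rel_ideal_def using ring.genideal_self[OF ring_free_alg, of "relators N q" N] relators_subset by auto

lemma rel_ideal_0 [simp]: "0 \<in> rel_ideal N q"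
  using additive_subgroup.zero_closed[OF ideal.axioms(1)[OF ideal_rel_ideal[of N q]]] by simp

lemma rel_ideal_add: "p \<in> rel_ideal N q \<Longrightarrow> p' \<in> rel_ideal N q \<Longrightarrow> p + p' \<in> rel_ideal N q"
  using additive_subgroup.a_closed[OF ideal.axioms(1)[OF ideal_rel_ideal[of N q]]] by simp

lemma rel_ideal_uminus: "p \<in> rel_ideal N q \<Longrightarrow> - p \<in> rel_ideal N q"
  using additive_subgroup.a_inv_closed[OF ideal.axioms(1)[OF ideal_rel_ideal[of N q]]]
  by (metis minus_free_alg rel_ideal_carrier)

lemma rel_ideal_diff: "p \<in> rel_ideal N q \<Longrightarrow> p' \<in> rel_ideal N q \<Longrightarrow> p - p' \<in> rel_ideal N q"
  using rel_ideal_add[of p N q "- p'"] rel_ideal_uminus by simp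

lemma rel_ideal_mult_left: "p \<in> rel_ideal N q \<Longrightarrow> x \<in> falg_on N \<Longrightarrow> x * p \<in> rel_ideal N q"
  using ideal.I_l_closed[OF ideal_rel_ideal[of N q]] by simp

lemma rel_ideal_mult_right: "p \<in> rel_ideal N q \<Longrightarrow> x \<in> falg_on N \<Longrightarrow> p * x \<in> rel_ideal N q"
  using ideal.I_r_closed[OF ideal_rel_ideal[of N q]] by simp

lemma ring_Uq: "ring (Uq N q)"
  unfolding Uq_def by (rule ideal.quotient_is_ring[OF ideal_rel_ideal])

lemma proj_ring_hom: "ring_hom_ring (free_alg N) (Uq N q) (proj N q)"
proof -
  have "proj N q = (+>\<^bsub>free_alg N\<^esub>) (rel_ideal N q)" by (rule ext) (simp add: proj_def)
  then show ?thesis unfolding Uq_def using ideal.rcos_ring_hom_ring[OF ideal_rel_ideal] by simp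
qed

lemma proj_closed [simp]: "p \<in> falg_on N \<Longrightarrow> proj N q p \<in> carrier (Uq N q)"
  using ring_hom_ring.axioms(3)[OF proj_ring_hom, unfolded ring_hom_ring_axioms_def]
  by (auto simp: ring_hom_def Pi_def)

lemma proj_mult: "p \<in> falg_on N \<Longrightarrow> p' \<in> falg_on N \<Longrightarrow> proj N q (p * p') = proj N q p \<otimes>\<^bsub>Uq N q\<^esub> proj N q p'"
  and proj_add: "p \<in> falg_on N \<Longrightarrow> p' \<in> falg_on N \<Longrightarrow> proj N q (p + p') = proj N q p \<oplus>\<^bsub>Uq N q\<^esub> proj N q p'"
  and proj_one: "proj N q 1 = \<one>\<^bsub>Uq N q\<^esub>"
  using ring_hom_ring.axioms(3)[OF proj_ring_hom[of N q], unfolded ring_hom_ring_axioms_def]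
  by (auto simp: ring_hom_def)

lemma proj_eq_iff:
  assumes "p \<in> falg_on N" "p' \<in> falg_on N"
  shows "proj N q p = proj N q p' \<longleftrightarrow> p - p' \<in> rel_ideal N q"
proof -
  interpret ideal "rel_ideal N q" "free_alg N" by (rule ideal_rel_ideal)
  have mem: "y \<in> rel_ideal N q +>\<^bsub>free_alg N\<^esub> x \<longleftrightarrow> y - x \<in> rel_ideal N q" for x y
    by (force simp: a_r_coset_def' algebra_simps)
  show ?thesis
  proof
    assume "proj N q p = proj N q p'"
    then have "p \<in> rel_ideal N q +>\<^bsub>free_alg N\<^esub> p'" unfolding proj_def
      using mem[of p p] by simp
    then show "p - p' \<in> rel_ideal N q" by (simp add: mem)
  next
    assume *: "p - p' \<in> rel_ideal N q"
    show "proj N q p = proj N q p'" unfolding proj_def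
    proof (rule Set.set_eqI)
      fix y
      show "y \<in> rel_ideal N q +>\<^bsub>free_alg N\<^esub> p \<longleftrightarrow> y \<in> rel_ideal N q +>\<^bsub>free_alg N\<^esub> p'"
        unfolding mem using rel_ideal_add[OF _ *, of "y - p"] rel_ideal_diff[OF _ *, of "y - p'"]
        by (auto simp: algebra_simps)
    qed
  qed
qed

lemma proj_0: "proj N q 0 = \<zero>\<^bsub>Uq N q\<^esub>"
proof -
  interpret ring_hom_ring "free_alg N" "Uq N q" "proj N q" by (rule proj_ring_hom)
  show ?thesis using hom_zero by simp
qed

lemma proj_uminus: "p \<in> falg_on N \<Longrightarrow> proj N q (- p) = \<ominus>\<^bsub>Uq N q\<^esub> proj N q p"
proof -
  interpret ring_hom_ring "free_alg N" "Uq N q" "proj N q" by (rule proj_ring_hom)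
  assume "p \<in> falg_on N"
  then show ?thesis using hom_a_inv[of p] minus_free_alg[of p N] by simp
qed

lemma proj_diff: "p \<in> falg_on N \<Longrightarrow> p' \<in> falg_on N \<Longrightarrow> proj N q (p - p') = proj N q p \<ominus>\<^bsub>Uq N q\<^esub> proj N q p'"
  unfolding a_minus_def using proj_add[of p N "- p'" q] by (simp add: proj_uminus)

lemma smul_proj: "p \<in> falg_on N \<Longrightarrow> smul N q c (proj N q p) = proj N q (const c * p)"
  by (simp add: smul_def proj_mult)

lemma finsum_proj:
  assumes "finite A" "\<And>x. x \<in> A \<Longrightarrow> f x \<in> falg_on N"
  shows "finsum (Uq N q) (\<lambda>x. proj N q (f x)) A = proj N q (sum f A)"
proof -
  interpret ring "Uq N q" by (rule ring_Uq)
  show ?thesis using assms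
  proof (induction A rule: finite_induct)
    case (insert x A)
    have "finsum (Uq N q) (\<lambda>x. proj N q (f x)) (insert x A)
      = proj N q (f x) \<oplus>\<^bsub>Uq N q\<^esub> finsum (Uq N q) (\<lambda>x. proj N q (f x)) A"
      using insert by (intro finsum_insert) auto
    also have "\<dots> = proj N q (f x) \<oplus>\<^bsub>Uq N q\<^esub> proj N q (sum f A)" using insert by simp
    also have "\<dots> = proj N q (f x + sum f A)" using insert by (intro proj_add[symmetric]) auto
    finally show ?case using insert by simp
  qed (simp add: proj_0)
qed

lemma uprod_proj:
  assumes "\<And>p. p \<in> set ps \<Longrightarrow> p \<in> falg_on N"
  shows "uprod N q (map (proj N q) ps) = proj N q (prod_list ps)" "prod_list ps \<in> falg_on N"
  using assms by (induction ps) (auto simp: uprod_def proj_one proj_mult)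

lemma prod_list_var: "prod_list (map var w) = word w"
  by (induction w) (auto simp: one_eq_word var_def single_mult_single)

section \<open>Evaluation of the free algebra on tensor powers\<close>

fun gen_rep :: "nat \<Rightarrow> complex \<Rightarrow> gen \<Rightarrow> nat list \<Rightarrow> nat list \<Rightarrow> complex" where
  "gen_rep N q (T i j) = trep N q T i j"
| "gen_rep N q (Tbar i j) = trep N q Tbar i j"

fun word_rep :: "nat \<Rightarrow> complex \<Rightarrow> nat \<Rightarrow> gen list \<Rightarrow> nat list \<Rightarrow> nat list \<Rightarrow> complex" where
  "word_rep N q m [] xs ys = of_bool (xs = ys)"
| "word_rep N q m (g # w) xs ys = matmul (tensor_index N m) (gen_rep N q g) (word_rep N q m w) xs ys"

definition falg_rep :: "nat \<Rightarrow> complex \<Rightarrow> nat \<Rightarrow> falg \<Rightarrow> nat list \<Rightarrow> nat list \<Rightarrow> complex" where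
  "falg_rep N q m p xs ys = (\<Sum>w\<in>Poly_Mapping.keys p. Poly_Mapping.lookup p w * word_rep N q m w xs ys)"

lemma matmul_assoc: "matmul I (matmul I F G) H xs zs = matmul I F (matmul I G H) xs zs"
  unfolding matmul_def sum_distrib_left sum_distrib_right
  by (subst sum.swap) (simp add: mult.assoc)

lemma matmul_id_left: "finite I \<Longrightarrow> xs \<in> I \<Longrightarrow> matmul I (\<lambda>xs ys. of_bool (xs = ys)) G xs zs = G xs zs"
  unfolding matmul_def of_bool_def by (simp add: if_distrib[of "\<lambda>x. x * _"] cong: if_cong)

lemma matmul_id_right: "finite I \<Longrightarrow> zs \<in> I \<Longrightarrow> matmul I F (\<lambda>xs ys. of_bool (xs = ys)) xs zs = F xs zs"
  unfolding matmul_def of_bool_def by (simp add: if_distrib[of "\<lambda>x. _ * x"] cong: if_cong)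

text \<open>Matrices are functions on all lists, while products sum over
  \<open>tensor_index N m\<close> only; the identity matrix is therefore neutral from the left just
  for rows in that set.\<close>

lemma word_rep_append:
  assumes "xs \<in> tensor_index N m"
  shows "word_rep N q m (u @ v) xs zs = matmul (tensor_index N m) (word_rep N q m u) (word_rep N q m v) xs zs"
  using assms
proof (induction u arbitrary: xs)
  case Nil
  have "word_rep N q m [] = (\<lambda>xs ys. of_bool (xs = ys))" by (intro ext) simp
  then show ?case using Nil by (simp add: matmul_id_left)
next
  case (Cons g u)
  have *: "word_rep N q m (g # u) = matmul (tensor_index N m) (gen_rep N q g) (word_rep N q m u)"
    by (intro ext) simp
  have "word_rep N q m ((g # u) @ v) xs zs = (\<Sum>ys\<in>tensor_index N m. gen_rep N q g xs ys * 
      matmul (tensor_index N m) (word_rep N q m u) (word_rep N q m v) ys zs)"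
    by (auto simp: matmul_def[of _ "gen_rep N q g"] Cons.IH)
  also have "\<dots> = matmul (tensor_index N m) (gen_rep N q g) 
      (matmul (tensor_index N m) (word_rep N q m u) (word_rep N q m v)) xs zs"
    by (simp add: matmul_def[of _ "gen_rep N q g"])
  finally show ?case unfolding * matmul_assoc .
qed

lemma word_rep_single: "ys \<in> tensor_index N m \<Longrightarrow> word_rep N q m [g] xs ys = gen_rep N q g xs ys"
proof -
  assume ys: "ys \<in> tensor_index N m"
  have *: "word_rep N q m [] = (\<lambda>xs ys. of_bool (xs = ys))" by (intro ext) simp
  show ?thesis by (simp only: word_rep.simps(2) * matmul_id_right[OF finite_tensor_index ys])
qed

lemma falg_rep_superset:
  "finite A \<Longrightarrow> Poly_Mapping.keys p \<subseteq> A \<Longrightarrow>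
   falg_rep N q m p xs ys = (\<Sum>w\<in>A. Poly_Mapping.lookup p w * word_rep N q m w xs ys)"
  unfolding falg_rep_def by (intro sum.mono_neutral_left) (auto simp: in_keys_iff)

lemma falg_rep_add: "falg_rep N q m (p + p') xs ys = falg_rep N q m p xs ys + falg_rep N q m p' xs ys"
proof -
  let ?A = "Poly_Mapping.keys p \<union> Poly_Mapping.keys p'"
  have "finite ?A" "Poly_Mapping.keys (p + p') \<subseteq> ?A" using Poly_Mapping.keys_add[of p p'] by auto
  then show ?thesis
    by (simp add: falg_rep_superset[of ?A] lookup_add distrib_right sum.distrib)
qed

lemma falg_rep_0 [simp]: "falg_rep N q m 0 xs ys = 0"
  by (simp add: falg_rep_def)

lemma falg_rep_uminus: "falg_rep N q m (- p) xs ys = - falg_rep N q m p xs ys"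
  using falg_rep_add[of N q m p "- p" xs ys] by (simp add: eq_neg_iff_add_eq_0 add.commute)

lemma falg_rep_diff: "falg_rep N q m (p - p') xs ys = falg_rep N q m p xs ys - falg_rep N q m p' xs ys"
  using falg_rep_add[of N q m p "- p'" xs ys] by (simp add: falg_rep_uminus)

lemma falg_rep_single [simp]: "falg_rep N q m (monomial w c) xs ys = c * word_rep N q m w xs ys"
  by (simp add: falg_rep_def)

lemma falg_rep_mult:
  assumes "xs \<in> tensor_index N m"
  shows "falg_rep N q m (p * p') xs zs = matmul (tensor_index N m) (falg_rep N q m p) (falg_rep N q m p') xs zs"
proof (induction p rule: poly_mapping_single_induct[where S = UNIV])
  case zero
  then show ?case by (simp add: matmul_def)
next
  case (add u c p)
  have "falg_rep N q m (monomial u c * p') xs zs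
    = matmul (tensor_index N m) (falg_rep N q m (monomial u c)) (falg_rep N q m p') xs zs"
  proof (induction p' rule: poly_mapping_single_induct[where S = UNIV])
    case zero
    then show ?case by (simp add: matmul_def)
  next
    case (add v d p')
    have "falg_rep N q m (monomial u c * monomial v d) xs zs
      = matmul (tensor_index N m) (falg_rep N q m (monomial u c)) (falg_rep N q m (monomial v d)) xs zs"
      using assms by (simp add: single_mult_single word_rep_append matmul_def sum_distrib_left mult_ac)
    with add show ?case by (simp add: distrib_left falg_rep_add matmul_def sum.distrib)
  qed simp
  with add show ?case by (simp add: distrib_right falg_rep_add matmul_def sum.distrib)
qed simp

lemma falg_rep_gens:
  assumes "xs \<in> tensor_index N m" "zs \<in> tensor_index N m"
  shows "falg_rep N q m (const c * var g * var g') xs zs = c * matmul (tensor_index N m) (gen_rep N q g) (gen_rep N q g') xs zs"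
proof -
  have "const c * var g * var g' = monomial ([g] @ [g']) c"
    by (simp add: const_def var_def single_mult_single)
  moreover have "word_rep N q m ([g] @ [g']) xs zs = matmul (tensor_index N m) (gen_rep N q g) (gen_rep N q g') xs zs"
    unfolding word_rep_append[OF assms(1)] by (simp add: matmul_def word_rep_single assms)
  ultimately show ?thesis by simp
qed

lemma trep_diag_inverse:
  assumes "q \<noteq> 0" "i \<in> {1..N}" "xs \<in> tensor_index N m" "zs \<in> tensor_index N m"
  shows "matmul (tensor_index N m) (trep N q T i i) (trep N q Tbar i i) xs zs = of_bool (xs = zs)"
    "matmul (tensor_index N m) (trep N q Tbar i i) (trep N q T i i) xs zs = of_bool (xs = zs)"
proof -
  define P where "P xs = (\<Prod>x\<leftarrow>xs. if x = i then q else 1)" for xs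
  define P' where "P' xs = (\<Prod>x\<leftarrow>xs. if x = i then inverse q else 1)" for xs
  have *: "P xs * P' xs = 1" for xs
    by (induction xs) (use assms(1) in \<open>auto simp: P_def P'_def field_simps\<close>)
  have "matmul (tensor_index N m) (trep N q T i i) (trep N q Tbar i i) xs zs
      = (\<Sum>ys\<in>{xs}. trep N q T i i xs ys * trep N q Tbar i i ys zs)"
    unfolding matmul_def using assms(2,3)
    by (intro sum.mono_neutral_right) (auto simp: trep_T_diag)
  also have "\<dots> = of_bool (xs = zs)"
    using assms(2) * by (auto simp: trep_T_diag trep_Tbar_diag P_def P'_def)
  finally show "matmul (tensor_index N m) (trep N q T i i) (trep N q Tbar i i) xs zs = of_bool (xs = zs)" .
  have "matmul (tensor_index N m) (trep N q Tbar i i) (trep N q T i i) xs zs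
      = (\<Sum>ys\<in>{xs}. trep N q Tbar i i xs ys * trep N q T i i ys zs)"
    unfolding matmul_def using assms(2,3)
    by (intro sum.mono_neutral_right) (auto simp: trep_Tbar_diag)
  also have "\<dots> = of_bool (xs = zs)"
    using assms(2) * by (auto simp: trep_T_diag trep_Tbar_diag P_def P'_def mult.commute)
  finally show "matmul (tensor_index N m) (trep N q Tbar i i) (trep N q T i i) xs zs = of_bool (xs = zs)" .
qed

lemma falg_rep_rtt:
  assumes "q \<noteq> 0" "{i, a, j, b} \<subseteq> {1..N}" "xs \<in> tensor_index N m" "zs \<in> tensor_index N m"
  shows "falg_rep N q m (rtt_rel q i a j b) xs zs = 0" "falg_rep N q m (rtt_rel_bar q i a j b) xs zs = 0"
    "falg_rep N q m (rtt_rel_mixed q i a j b) xs zs = 0"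
proof -
  note rtt = rtt_trep[OF assms(1), where m = m and N = N, unfolded rtt_def, rule_format, of _ _ i j a b xs zs]
  show "falg_rep N q m (rtt_rel q i a j b) xs zs = 0"
    unfolding rtt_rel_def falg_rep_diff falg_rep_gens[OF assms(3,4)]
    using rtt[of T T] assms by (simp add: algebra_simps)
  show "falg_rep N q m (rtt_rel_bar q i a j b) xs zs = 0"
    unfolding rtt_rel_bar_def falg_rep_diff falg_rep_gens[OF assms(3,4)]
    using rtt[of Tbar Tbar] assms by (simp add: algebra_simps)
  have *: "const (q - inverse q) * (const (of_bool (b < a)) * var (T j a) * var (Tbar i b)
        - const (of_bool (i < j)) * var (Tbar j a) * var (T i b)) =
      const ((q - inverse q) * of_bool (b < a)) * var (T j a) * var (Tbar i b)
      - const ((q - inverse q) * of_bool (i < j)) * var (Tbar j a) * var (T i b)"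
    by (simp add: const_def var_def single_mult_single right_diff_distrib)
  show "falg_rep N q m (rtt_rel_mixed q i a j b) xs zs = 0"
    unfolding rtt_rel_mixed_def * falg_rep_diff falg_rep_gens[OF assms(3,4)]
    using rtt[of Tbar T] assms by (simp add: algebra_simps)
qed

lemma falg_rep_relator:
  assumes "q \<noteq> 0" "p \<in> relators N q" "xs \<in> tensor_index N m" "zs \<in> tensor_index N m"
  shows "falg_rep N q m p xs zs = 0"
proof -
  have 1: "falg_rep N q m 1 xs zs = of_bool (xs = zs)"
    by (simp add: one_eq_word)
  have 2: "falg_rep N q m (var g) xs zs = gen_rep N q g xs zs" for g
    using assms(4) by (simp add: var_def word_rep_single del: word_rep.simps(2))
  have 3: "falg_rep N q m (var g * var g') xs zs = matmul (tensor_index N m) (gen_rep N q g) (gen_rep N q g') xs zs" for g g'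
    using falg_rep_gens[OF assms(3,4), of q 1 g g'] by (simp add: const_def var_def single_mult_single)
  show ?thesis
    using assms(2) unfolding relators_def
    by (elim UnE CollectE exE conjE; hypsubst)
      (simp_all only: falg_rep_rtt[OF assms(1) _ assms(3,4)] falg_rep_diff 1 2 3 gen_rep.simps
         trep_T_zero trep_Tbar_zero trep_diag_inverse[OF assms(1) _ assms(3,4)] diff_self)
qed

text \<open>The elements that act as zero form a two-sided ideal containing the relators. Hence
  every matrix entry is a well-defined linear functional on \<open>Uq\<close>.\<close>

lemma falg_rep_rel_ideal:
  assumes "q \<noteq> 0" "p \<in> rel_ideal N q" "xs \<in> tensor_index N m" "zs \<in> tensor_index N m"
  shows "falg_rep N q m p xs zs = 0"
proof -
  let ?K = "{p \<in> falg_on N. \<forall>xs\<in>tensor_index N m. \<forall>zs\<in>tensor_index N m. falg_rep N q m p xs zs = 0}"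
  have "ideal ?K (free_alg N)"
  proof (rule idealI[OF ring_free_alg])
    show "subgroup ?K (add_monoid (free_alg N))"
    proof (rule group.subgroupI)
      show "Group.group (add_monoid (free_alg N))"
        using ring.is_abelian_group[OF ring_free_alg] abelian_group.a_group by blast
      fix p assume p: "p \<in> ?K"
      have "inv\<^bsub>add_monoid (free_alg N)\<^esub> p = - p"
        using p minus_free_alg[of p N] by (simp add: a_inv_def)
      with p show "inv\<^bsub>add_monoid (free_alg N)\<^esub> p \<in> ?K" by (simp add: falg_rep_uminus)
    next
      show "?K \<noteq> {}" using falg_on_0[of N] falg_rep_0 by blast
    qed (auto simp: falg_rep_add)
  qed (auto simp: falg_rep_mult matmul_def)
  then have "rel_ideal N q \<subseteq> ?K"
    unfolding rel_ideal_def using relators_subset falg_rep_relator[OF assms(1)]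
    by (intro ring.genideal_minimal[OF ring_free_alg]) auto
  with assms show ?thesis by auto
qed

section \<open>Commutation up to scalars and ordered words\<close>

text \<open>Congruence modulo the relations. Identities of \<open>Uq\<close> are handled on
  representatives in the free algebra, where the operations are ordinary ring operations;
  \<open>proj_eq_iff\<close> translates.\<close>

definition req :: "nat \<Rightarrow> complex \<Rightarrow> falg \<Rightarrow> falg \<Rightarrow> bool" where
  "req N q p p' \<longleftrightarrow> p - p' \<in> rel_ideal N q"

lemma req_refl [simp]: "req N q p p"
  by (simp add: req_def)

lemma req_sym: "req N q p p' \<Longrightarrow> req N q p' p"
  unfolding req_def using rel_ideal_uminus[of "p - p'" N q] by simp

lemma req_trans [trans]: "req N q p p' \<Longrightarrow> req N q p' p'' \<Longrightarrow> req N q p p''"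
  unfolding req_def using rel_ideal_add[of "p - p'" N q "p' - p''"] by simp

lemma req_add: "req N q p p' \<Longrightarrow> req N q r r' \<Longrightarrow> req N q (p + r) (p' + r')"
  unfolding req_def using rel_ideal_add[of "p - p'" N q "r - r'"] by (simp add: algebra_simps)

lemma req_mult_left: "req N q p p' \<Longrightarrow> x \<in> falg_on N \<Longrightarrow> req N q (x * p) (x * p')"
  unfolding req_def using rel_ideal_mult_left[of "p - p'" N q x] by (simp add: algebra_simps)

lemma req_mult_right: "req N q p p' \<Longrightarrow> x \<in> falg_on N \<Longrightarrow> req N q (p * x) (p' * x)"
  unfolding req_def using rel_ideal_mult_right[of "p - p'" N q x] by (simp add: algebra_simps)

lemma req_mult: "req N q p p' \<Longrightarrow> req N q r r' \<Longrightarrow> p' \<in> falg_on N \<Longrightarrow> r \<in> falg_on N \<Longrightarrow> req N q (p * r) (p' * r')"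
  by (meson req_mult_left req_mult_right req_trans)

lemma req_0_iff: "req N q p 0 \<longleftrightarrow> p \<in> rel_ideal N q"
  by (simp add: req_def)

text \<open>Proportionality in \<open>Uq\<close>. Only the fact that the scalar is nonzero is
  recorded, which suffices for a leading term known up to \<lambda>.\<close>

definition wprop :: "nat \<Rightarrow> complex \<Rightarrow> gen list \<Rightarrow> gen list \<Rightarrow> bool" where
  "wprop N q u v \<longleftrightarrow> (\<exists>c. c \<noteq> 0 \<and> req N q (word u) (monomial v c))"

lemma wpropI: "c \<noteq> 0 \<Longrightarrow> req N q (word u) (monomial v c) \<Longrightarrow> wprop N q u v"
  by (auto simp: wprop_def)

lemma wprop_refl [simp]: "wprop N q u u"
  by (auto simp: wprop_def intro: exI[of _ 1])

lemma req_scale: "req N q p p' \<Longrightarrow> req N q (const c * p) (const c * p')"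
  by (rule req_mult_left) simp_all

lemma wprop_trans [trans]: "wprop N q u v \<Longrightarrow> wprop N q v w \<Longrightarrow> wprop N q u w"
proof -
  assume "wprop N q u v" "wprop N q v w"
  then obtain c d where c: "c \<noteq> 0" "req N q (word u) (monomial v c)"
    and d: "d \<noteq> 0" "req N q (word v) (monomial w d)"
    by (auto simp: wprop_def)
  have "req N q (monomial v c) (monomial w (c * d))"
    using req_scale[OF d(2), of c] by (simp add: const_mult_single)
  with c have "req N q (word u) (monomial w (c * d))" by (blast intro: req_trans)
  with c(1) d(1) show ?thesis by (intro wpropI[of "c * d"]) auto
qed

lemma wprop_sym: "wprop N q u v \<Longrightarrow> wprop N q v u"
proof -
  assume "wprop N q u v"
  then obtain c where c: "c \<noteq> 0" "req N q (word u) (monomial v c)"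
    by (auto simp: wprop_def)
  have "req N q (word v) (monomial u (inverse c))"
    using req_sym[OF req_scale[OF c(2), of "inverse c"]] c(1) by (simp add: const_mult_single)
  with c show ?thesis by (auto simp: wprop_def intro: exI[of _ "inverse c"])
qed

lemma wprop_append:
  assumes "wprop N q u v" "wprop N q u' v'" "set v \<subseteq> gens N" "set u' \<subseteq> gens N"
  shows "wprop N q (u @ u') (v @ v')"
proof -
  obtain c d where c: "c \<noteq> 0" "req N q (word u) (monomial v c)"
    and d: "d \<noteq> 0" "req N q (word u') (monomial v' d)"
    using assms by (auto simp: wprop_def)
  have "req N q (word u * word u') (monomial v c * monomial v' d)"
    using c d assms by (intro req_mult) auto
  with c(1) d(1) show ?thesis by (intro wpropI[of "c * d"]) (auto simp: single_mult_single)
qed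

lemma wprop_context:
  assumes "wprop N q x y" "set u \<subseteq> gens N" "set v \<subseteq> gens N" "set x \<subseteq> gens N"  "set y \<subseteq> gens N" 
  shows "wprop N q (u @ x @ v) (u @ y @ v)"
  using assms by (intro wprop_append) auto

lemma single_minus_eq: "monomial w (- c :: complex) = - monomial w c"
  by (simp add: single_uminus)

lemma rtt_relators:
  assumes "{i, a, j, b} \<subseteq> {1..N}"
  shows "rtt_rel q i a j b \<in> relators N q" "rtt_rel_bar q i a j b \<in> relators N q" "rtt_rel_mixed q i a j b \<in> relators N q"
proof -
  have "f i a j b \<in> {f i a j b | i a j b. {i, a, j, b} \<subseteq> {1..N}}" for f :: "nat \<Rightarrow> nat \<Rightarrow> nat \<Rightarrow> nat \<Rightarrow> falg"
    using assms by (intro CollectI exI conjI) (rule refl)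
  from this[of "rtt_rel q"] this[of "rtt_rel_bar q"] this[of "rtt_rel_mixed q"]
  show "rtt_rel q i a j b \<in> relators N q" "rtt_rel_bar q i a j b \<in> relators N q" "rtt_rel_mixed q i a j b \<in> relators N q"
    by (simp_all only: relators_def Un_iff simp_thms)
qed

lemma rtt_T:
  assumes "{i, a, j, b} \<subseteq> {1..N}"
  shows "req N q (monomial [T i a, T j b] (q ^ of_bool (i = j)))
    (monomial [T j b, T i a] (q ^ of_bool (a = b))
     + monomial [T j a, T i b] ((q - inverse q) * (of_bool (b < a) - of_bool (i < j))))"
proof -
  have "rtt_rel q i a j b \<in> rel_ideal N q"
    by (rule relator_in_rel_ideal[OF rtt_relators(1)[OF assms]])
  then show ?thesis
    by (simp add: rtt_rel_def req_def const_def var_def single_mult_single algebra_simps)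
qed

lemma rtt_Tbar:
  assumes "{i, a, j, b} \<subseteq> {1..N}"
  shows "req N q (monomial [Tbar i a, Tbar j b] (q ^ of_bool (i = j)))
    (monomial [Tbar j b, Tbar i a] (q ^ of_bool (a = b))
     + monomial [Tbar j a, Tbar i b] ((q - inverse q) * (of_bool (b < a) - of_bool (i < j))))"
proof -
  have "rtt_rel_bar q i a j b \<in> rel_ideal N q"
    by (rule relator_in_rel_ideal[OF rtt_relators(2)[OF assms]])
  then show ?thesis
    by (simp add: rtt_rel_bar_def req_def const_def var_def single_mult_single algebra_simps)
qed

lemma rtt_mixed:
  assumes "{i, a, j, b} \<subseteq> {1..N}"
  shows "req N q (monomial [Tbar i a, T j b] (q ^ of_bool (i = j)))
    (monomial [T j b, Tbar i a] (q ^ of_bool (a = b))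
     + monomial [T j a, Tbar i b] ((q - inverse q) * of_bool (b < a))
     + monomial [Tbar j a, T i b] (- ((q - inverse q) * of_bool (i < j))))"
proof -
  have "rtt_rel_mixed q i a j b \<in> rel_ideal N q"
    by (rule relator_in_rel_ideal[OF rtt_relators(3)[OF assms]])
  then show ?thesis
    by (simp add: rtt_rel_mixed_def req_def const_def var_def single_mult_single right_diff_distrib single_minus_eq
        add_diff_eq diff_diff_eq diff_add_eq)
qed

section \<open>Vanishing letters and commutation with the diagonal letters\<close>

fun zero_gen :: "gen \<Rightarrow> bool" where
  "zero_gen (T i j) \<longleftrightarrow> i < j"
| "zero_gen (Tbar i j) \<longleftrightarrow> j < i"

lemma zero_gen_rel_ideal:
  assumes "zero_gen g" "g \<in> gens N" shows "word [g] \<in> rel_ideal N q"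
proof -
  have "g \<in> {T i j | i j. i \<in> {1..N} \<and> j \<in> {1..N} \<and> i < j}
      \<or> g \<in> {Tbar j i | i j. i \<in> {1..N} \<and> j \<in> {1..N} \<and> i < j}"
    using assms by (cases g) auto
  then have "var g \<in> {var (T i j) | i j. i \<in> {1..N} \<and> j \<in> {1..N} \<and> i < j}
      \<or> var g \<in> {var (Tbar j i) | i j. i \<in> {1..N} \<and> j \<in> {1..N} \<and> i < j}"
    by blast
  then have "var g \<in> relators N q"
    unfolding relators_def Un_iff by argo
  then show ?thesis using relator_in_rel_ideal by (simp add: var_def)
qed

lemma zero_word_rel_ideal:
  assumes "\<exists>g\<in>set w. zero_gen g" "set w \<subseteq> gens N"
  shows "monomial w c \<in> rel_ideal N q"
proof -
  obtain u g v where w: "w = u @ [g] @ v" "zero_gen g" using assms(1) split_list by fastforce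
  have "monomial u c * (word [g] * word v) \<in> rel_ideal N q"
    using assms w by (intro rel_ideal_mult_left rel_ideal_mult_right zero_gen_rel_ideal) auto
  then show ?thesis using w by (simp add: single_mult_single)
qed

lemma req_zero_word:
  assumes "g \<in> set w" "zero_gen g" "set w \<subseteq> gens N"
  shows "req N q (monomial w c) 0"
  unfolding req_0_iff using assms by (intro zero_word_rel_ideal) auto

lemma req_add_zero: "req N q p (p' + r) \<Longrightarrow> req N q r 0 \<Longrightarrow> req N q p p'"
  using req_trans[of N q p "p' + r" p'] req_add[of N q p' p' r 0] by simp

lemma req_single_scale: "req N q (monomial w c) (monomial w' d) \<Longrightarrow>
    req N q (monomial w (e * c)) (monomial w' (e * d))"
  using req_scale[of N q "monomial w c" "monomial w' d" e] by (simp add: const_mult_single)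

lemma wprop_singleI:
  assumes "c \<noteq> 0" "d \<noteq> 0" "req N q (monomial w c) (monomial w' d)"
  shows "wprop N q w w'"
  using req_single_scale[OF assms(3), of "inverse c"] assms(1,2) by (intro wpropI[of "inverse c * d"]) auto

lemma TTbar_cancel:
  assumes "i \<in> {1..N}" shows "req N q (word [T i i, Tbar i i]) (word [])" "req N q (word [Tbar i i, T i i]) (word [])"
proof -
  have "f i \<in> {f i | i. i \<in> {1..N}}" for f :: "nat \<Rightarrow> falg" using assms by blast
  from this[of "\<lambda>i. var (T i i) * var (Tbar i i) - 1"] this[of "\<lambda>i. var (Tbar i i) * var (T i i) - 1"]
  have "var (T i i) * var (Tbar i i) - 1 \<in> rel_ideal N q" "var (Tbar i i) * var (T i i) - 1 \<in> rel_ideal N q"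
    by (auto intro!: relator_in_rel_ideal simp only: relators_def Un_iff simp_thms)
  then show "req N q (word [T i i, Tbar i i]) (word [])" "req N q (word [Tbar i i, T i i]) (word [])"
    by (simp_all add: req_def var_def single_mult_single one_eq_word)
qed

lemma wprop_TTbar:
  assumes "i \<in> {1..N}" shows "wprop N q [T i i, Tbar i i] []" "wprop N q [Tbar i i, T i i] []"
  using TTbar_cancel[OF assms] by (auto intro: wpropI[of 1])

text \<open>The relation has a third word \<open>[T j i, T i b]\<close>. It contains a zero letter
  if \<open>j < i\<close> or \<open>i < b\<close>; otherwise its coefficient vanishes, or it
  coincides with one of the two words to be compared, or these two are equal.\<close>

lemma wprop_K_T:
  assumes "q \<noteq> 0" "i \<in> {1..N}" "T j b \<in> gens N"
  shows "wprop N q [T i i, T j b] [T j b, T i i]"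
proof (cases "j < b")
  case True
  then show ?thesis
    using assms req_trans[OF req_zero_word req_sym[OF req_zero_word], of "T j b" "[T i i, T j b]" N "T j b" "[T j b, T i i]" q 1 1]
    by (auto intro!: wpropI[of 1])
next
  case False
  have rel: "req N q (monomial [T i i, T j b] (q ^ of_bool (i = j)))
    (monomial [T j b, T i i] (q ^ of_bool (i = b))
     + monomial [T j i, T i b] ((q - inverse q) * (of_bool (b < i) - of_bool (i < j))))"
    using rtt_T[of i i j b N q] assms by simp
  consider "i = j" "b < i" | "i = b" "i < j" | "i = j" "i = b" | "b < i" "i < j" | "j < i" | "i < b"
    using False by linarith
  then show ?thesis
  proof cases
    case 1
    \<comment> \<open>The third word is the left-hand word itself; moving it to the left changes the
      coefficient \<open>q\<close> into \<open>inverse q\<close>.\<close>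
    have "req N q (monomial [T i i, T j b] (q + (- (q - inverse q))))
        (monomial [T j b, T i i] 1 + monomial [T j i, T i b] (q - inverse q) + monomial [T i i, T j b] (- (q - inverse q)))"
      unfolding single_add using rel 1 by (intro req_add) auto
    then have "req N q (monomial [T i i, T j b] (inverse q)) (monomial [T j b, T i i] 1)"
      using 1 by (simp add: single_add[symmetric] add.assoc)
    then show ?thesis using assms(1) by (intro wprop_singleI[of "inverse q" 1]) auto
  next
    case 2
    have "req N q (monomial [T i i, T j b] 1) (monomial [T j b, T i i] (inverse q))"
      using rel 2 by (simp add: single_add[symmetric])
    then show ?thesis using assms(1) by (intro wprop_singleI[of 1 "inverse q"]) auto
  next
    case 3
    then show ?thesis by simp
  next
    case 4
    then have "req N q (monomial [T i i, T j b] 1) (monomial [T j b, T i i] 1)"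
      using rel by simp
    then show ?thesis by (intro wprop_singleI[of 1 1]) auto
  next
    case 5
    then have "req N q (monomial [T i i, T j b] (q ^ of_bool (i = j)))
        (monomial [T j b, T i i] (q ^ of_bool (i = b)))"
      using rel assms by (elim req_add_zero) (intro req_zero_word[of "T j i"], auto)
    then show ?thesis using assms(1) by (intro wprop_singleI) auto
  next
    case 6
    then have "req N q (monomial [T i i, T j b] (q ^ of_bool (i = j)))
        (monomial [T j b, T i i] (q ^ of_bool (i = b)))"
      using rel assms by (elim req_add_zero) (intro req_zero_word[of "T i b"], auto)
    then show ?thesis using assms(1) by (intro wprop_singleI) auto
  qed
qed

text \<open>Opposite triangularity makes this simpler: whenever the coefficient of the third word is
  nonzero, that word contains a zero letter.\<close>

lemma wprop_K_Tbar:
  assumes "q \<noteq> 0" "i \<in> {1..N}" "Tbar j b \<in> gens N"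
  shows "wprop N q [Tbar i i, Tbar j b] [Tbar j b, Tbar i i]"
proof (cases "b < j")
  case True
  then show ?thesis
    using assms req_trans[OF req_zero_word req_sym[OF req_zero_word], of "Tbar j b" "[Tbar i i, Tbar j b]" N "Tbar j b" "[Tbar j b, Tbar i i]" q 1 1]
    by (auto intro!: wpropI[of 1])
next
  case False
  have rel: "req N q (monomial [Tbar i i, Tbar j b] (q ^ of_bool (i = j)))
    (monomial [Tbar j b, Tbar i i] (q ^ of_bool (i = b))
     + monomial [Tbar j i, Tbar i b] ((q - inverse q) * (of_bool (b < i) - of_bool (i < j))))"
    using rtt_Tbar[of i i j b N q] assms by simp
  consider "b < i" | "i < j" | "j \<le> i" "i \<le> b" using False by linarith
  then have "req N q (monomial [Tbar j i, Tbar i b] ((q - inverse q) * (of_bool (b < i) - of_bool (i < j)))) 0"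
  proof cases
    case 1
    then show ?thesis using assms by (intro req_zero_word[of "Tbar i b"]) auto
  next
    case 2
    then show ?thesis using assms by (intro req_zero_word[of "Tbar j i"]) auto
  qed simp
  with rel have "req N q (monomial [Tbar i i, Tbar j b] (q ^ of_bool (i = j)))
    (monomial [Tbar j b, Tbar i i] (q ^ of_bool (i = b)))"
    by (rule req_add_zero)
  then show ?thesis using assms(1) by (intro wprop_singleI) auto
qed

text \<open>Multiply the relation between \<open>k\<close> and \<open>g\<close> by the inverse
  \<open>k'\<close> on both sides. This supplies the cases in which the diagonal letter and
  \<open>g\<close> belong to different families.\<close>

lemma wprop_inverse_commute:
  assumes "wprop N q [k, k'] []" "wprop N q [k', k] []" "wprop N q [k, g] [g, k]"
    and "{k, k', g} \<subseteq> gens N"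
  shows "wprop N q [k', g] [g, k']"
proof -
  have "wprop N q ([k', g] @ [] @ []) ([k', g] @ [k, k'] @ [])"
    using assms by (intro wprop_context wprop_sym[OF assms(1)]) auto
  also have "wprop N q ([k'] @ [g, k] @ [k']) ([k'] @ [k, g] @ [k'])"
    using assms by (intro wprop_context wprop_sym[OF assms(3)]) auto
  then have "wprop N q ([k', g] @ [k, k'] @ []) ([] @ [k', k] @ [g, k'])" by simp
  also have "wprop N q ([] @ [k', k] @ [g, k']) ([] @ [] @ [g, k'])"
    using assms by (intro wprop_context assms(2)) auto
  finally show ?thesis by simp
qed

definition K_gen :: "gen \<Rightarrow> bool" where
  "K_gen k \<longleftrightarrow> (\<exists>i. k = T i i \<or> k = Tbar i i)"

lemma wprop_K:
  assumes "q \<noteq> 0" "K_gen k" "k \<in> gens N" "g \<in> gens N"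
  shows "wprop N q [k, g] [g, k]"
proof -
  obtain i where k: "k = T i i \<or> k = Tbar i i" and i: "i \<in> {1..N}"
    using assms unfolding K_gen_def by auto
  have "wprop N q [T i i, g] [g, T i i] \<and> wprop N q [Tbar i i, g] [g, Tbar i i]"
  proof (cases g)
    case (T j b)
    then have "wprop N q [T i i, g] [g, T i i]" using wprop_K_T[OF assms(1) i] assms by simp
    with wprop_inverse_commute[of N q "T i i" "Tbar i i" g] show ?thesis
      using wprop_TTbar[OF i] i assms by simp
  next
    case (Tbar j b)
    then have "wprop N q [Tbar i i, g] [g, Tbar i i]" using wprop_K_Tbar[OF assms(1) i] assms by simp
    with wprop_inverse_commute[of N q "Tbar i i" "T i i" g] show ?thesis
      using wprop_TTbar[OF i] i assms by simp
  qed
  with k show ?thesis by auto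
qed

lemma wprop_K_word:
  assumes "q \<noteq> 0" "K_gen k" "k \<in> gens N" "set w \<subseteq> gens N"
  shows "wprop N q (k # w) (w @ [k])"
  using assms(4)
proof (induction w)
  case (Cons g w)
  have "wprop N q ([] @ [k, g] @ w) ([] @ [g, k] @ w)"
    using assms Cons by (intro wprop_context wprop_K) auto
  also have "wprop N q ([] @ [g, k] @ w) ([g] @ (k # w) @ [])" by simp
  also have "wprop N q ([g] @ (k # w) @ []) ([g] @ (w @ [k]) @ [])"
    using assms Cons by (intro wprop_context) auto
  finally show ?case by simp
qed simp

lemma wprop_K_words:
  assumes "q \<noteq> 0" "\<And>k. k \<in> set ks \<Longrightarrow> K_gen k" "set ks \<subseteq> gens N" "set w \<subseteq> gens N"
  shows "wprop N q (ks @ w) (w @ ks)"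
  using assms(2,3)
proof (induction ks)
  case (Cons k ks)
  have "wprop N q ([k] @ (ks @ w) @ []) ([k] @ (w @ ks) @ [])"
    using assms Cons by (intro wprop_context) auto
  also have "wprop N q ([k] @ (w @ ks) @ []) ([] @ (k # w) @ ks)" by simp
  also have "wprop N q ([] @ (k # w) @ ks) ([] @ (w @ [k]) @ ks)"
    using assms Cons by (intro wprop_context wprop_K_word) auto
  finally show ?case by simp
qed simp

section \<open>Ordered monomials as words\<close>

definition F_gen :: "nat \<times> nat \<Rightarrow> gen" where "F_gen = (\<lambda>(i, j). T j i)"
definition E_gen :: "nat \<times> nat \<Rightarrow> gen" where "E_gen = (\<lambda>(i, j). Tbar i j)"
text \<open>The words of the root vectors up to a scalar. Straightening produces single letters
  \<open>F_gen\<close> and \<open>E_gen\<close> instead; the surplus diagonal letters are moved into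
  the middle block.\<close>

definition F_pair :: "nat \<times> nat \<Rightarrow> gen list" where "F_pair = (\<lambda>(i, j). [T j i, Tbar i i])"
definition E_pair :: "nat \<times> nat \<Rightarrow> gen list" where "E_pair = (\<lambda>(i, j). [T i i, Tbar i j])"
definition K_block :: "nat \<Rightarrow> int \<Rightarrow> gen list" where
  "K_block i m = replicate (nat \<bar>m\<bar>) (if m < 0 then Tbar i i else T i i)"

definition pow_word :: "('a \<Rightarrow> 'b list) \<Rightarrow> 'a list \<Rightarrow> nat list \<Rightarrow> 'b list" where
  "pow_word f xs es = concat (map2 (\<lambda>x e. concat (replicate e (f x))) xs es)"

definition pbw_word :: "nat \<Rightarrow> expo \<Rightarrow> gen list" where
  "pbw_word N = (\<lambda>(r, \<mu>, k). pow_word F_pair (pos_roots N) r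
     @ concat (map2 K_block [1..<Suc N] \<mu>) @ pow_word E_pair (pos_roots N) k)"

lemma set_pos_roots: "set (pos_roots N) = {(i, j). 1 \<le> i \<and> i < j \<and> j \<le> N}"
  by (auto simp: pos_roots_def image_iff simp del: upt_Suc)

text \<open>The prescribed enumeration of the positive roots is the lexicographic order on pairs.
  Positions in exponent vectors can therefore be compared by comparing roots.\<close>

lemma sorted_distinct_pos_roots: "sorted (pos_roots N) \<and> distinct (pos_roots N)"
proof -
  have "sorted (concat (map (\<lambda>i. map (\<lambda>j. (i, j)) [Suc i..<Suc N]) is))
      \<and> distinct (concat (map (\<lambda>i. map (\<lambda>j. (i, j)) [Suc i..<Suc N]) is))"
    if "sorted is" "distinct is" for "is"
    using that
  proof (induction "is")
    case (Cons i "is")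
    have "sorted (map (\<lambda>j. (i, j)) [Suc i..<Suc N])"
      by (simp add: sorted_map sorted_wrt_upt[THEN sorted_wrt_mono_rel[rotated]] del: upt_Suc)
    moreover have "distinct (map (\<lambda>j. (i, j)) [Suc i..<Suc N])"
      by (simp add: distinct_map inj_on_def)
    ultimately show ?case using Cons by (auto simp: sorted_append less_le)
  qed auto
  then show ?thesis unfolding pos_roots_def by simp
qed

lemma length_pos_roots: "length (pos_roots N) = num_roots N"
proof -
  have "length (pos_roots N) = (\<Sum>i=1..N. N - i)"
    by (simp add: pos_roots_def length_concat comp_def sum_list_distinct_conv_sum_set atLeastLessThanSuc_atLeastAtMost del: upt_Suc)
  also have "\<dots> = (\<Sum>i<N. i)"
    by (rule sum.reindex_bij_witness[of _ "\<lambda>i. N - i" "\<lambda>i. N - i"]) auto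
  also have "\<dots> = num_roots N"
    by (simp add: num_roots_def Sum_Ico_nat lessThan_atLeast0)
  finally show ?thesis .
qed

definition represents :: "nat \<Rightarrow> complex \<Rightarrow> falg set \<Rightarrow> gen list \<Rightarrow> bool" where
  "represents N q u w \<longleftrightarrow> set w \<subseteq> gens N \<and> (\<exists>c. c \<noteq> 0 \<and> u = proj N q (monomial w c))"

lemma represents_one: "represents N q \<one>\<^bsub>Uq N q\<^esub> []"
  by (auto simp: represents_def one_eq_word proj_one[symmetric] intro: exI[of _ 1])

lemma represents_mult:
  assumes "represents N q u v" "represents N q u' v'"
  shows "represents N q (u \<otimes>\<^bsub>Uq N q\<^esub> u') (v @ v')"
proof -
  obtain c d where "c \<noteq> 0" "u = proj N q (monomial v c)" "d \<noteq> 0" "u' = proj N q (monomial v' d)"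
    using assms by (auto simp: represents_def)
  with assms show ?thesis
    by (auto simp: represents_def proj_mult[symmetric] single_mult_single intro!: exI[of _ "c * d"])
qed

lemma represents_smul:
  assumes "represents N q u v" "c \<noteq> 0"
  shows "represents N q (smul N q c u) v"
proof -
  obtain d where "d \<noteq> 0" "u = proj N q (monomial v d)"
    using assms by (auto simp: represents_def)
  with assms show ?thesis
    by (auto simp: represents_def smul_proj const_mult_single intro!: exI[of _ "c * d"])
qed

lemma represents_uprod: "list_all2 (represents N q) us ws \<Longrightarrow> represents N q (uprod N q us) (concat ws)"
  by (induction rule: list_all2_induct) (simp_all add: uprod_def represents_one represents_mult)

lemma represents_pow: "represents N q u w \<Longrightarrow> represents N q (u [^]\<^bsub>Uq N q\<^esub> (n::nat)) (concat (replicate n w))"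
proof (induction n)
  case (Suc n)
  have "concat (replicate (Suc n) w) = concat (replicate n w) @ w"
    by (metis append_Nil2 concat.simps concat_append replicate_Suc replicate_append_same)
  with Suc show ?case by (simp add: represents_mult)
qed (simp add: represents_one)

lemma represents_tk: "i \<in> {1..N} \<Longrightarrow> j \<in> {1..N} \<Longrightarrow> represents N q (tk N q k i j) [if k = 0 then T i j else Tbar i j]"
  by (auto simp: represents_def tk_def var_def intro: exI[of _ 1])

lemma represents_Froot:
  assumes "q - inverse q \<noteq> 0" "\<beta> \<in> set (pos_roots N)"
  shows "represents N q (Froot N q \<beta>) (F_pair \<beta>)"
proof -
  obtain i j where \<beta>: "\<beta> = (i, j)" "1 \<le> i" "i < j" "j \<le> N" using assms(2) by (auto simp: set_pos_roots)
  have "represents N q (Froot N q \<beta>) ([if (0::nat) = 0 then T j i else Tbar j i] @ [if (1::nat) = 0 then T i i else Tbar i i])"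
    unfolding Froot_def Kinv_def \<beta> case_prod_conv
    by (intro represents_smul represents_mult represents_tk) (use \<beta> assms(1) in auto)
  then show ?thesis by (simp add: F_pair_def \<beta>)
qed

lemma represents_Eroot:
  assumes "q - inverse q \<noteq> 0" "\<beta> \<in> set (pos_roots N)"
  shows "represents N q (Eroot N q \<beta>) (E_pair \<beta>)"
proof -
  obtain i j where \<beta>: "\<beta> = (i, j)" "1 \<le> i" "i < j" "j \<le> N" using assms(2) by (auto simp: set_pos_roots)
  have "represents N q (Eroot N q \<beta>) ([if (0::nat) = 0 then T i i else Tbar i i] @ [if (1::nat) = 0 then T i j else Tbar i j])"
    unfolding Eroot_def Kgen_def \<beta> case_prod_conv
    by (intro represents_smul represents_mult represents_tk) (use \<beta> assms(1) in auto)
  then show ?thesis by (simp add: E_pair_def \<beta>)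
qed

lemma proj_diag_inverse:
  assumes "i \<in> {1..N}"
  shows "proj N q (word (replicate n (T i i))) \<otimes>\<^bsub>Uq N q\<^esub> proj N q (word (replicate n (Tbar i i))) = \<one>\<^bsub>Uq N q\<^esub>"
    "proj N q (word (replicate n (Tbar i i))) \<otimes>\<^bsub>Uq N q\<^esub> proj N q (word (replicate n (T i i))) = \<one>\<^bsub>Uq N q\<^esub>"
proof -
  have *: "req N q (word (replicate n g @ replicate n g')) (word [])"
    if "req N q (word [g, g']) (word [])" "{g, g'} \<subseteq> gens N" for g g'
  proof (induction n)
    case (Suc n)
    have "req N q (word (replicate n g) * word [g, g'] * word (replicate n g')) (word (replicate n g) * word [] * word (replicate n g'))"
      using that by (intro req_mult_left req_mult_right) auto
    then have "req N q (word (replicate (Suc n) g @ replicate (Suc n) g')) (word (replicate n g @ replicate n g'))"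
      by (simp add: single_mult_single replicate_append_same[symmetric])
    with Suc show ?case by (blast intro: req_trans)
  qed simp
  have "proj N q (word (replicate n g @ replicate n g')) = \<one>\<^bsub>Uq N q\<^esub>"
    if "req N q (word [g, g']) (word [])" "{g, g'} \<subseteq> gens N" for g g'
    using *[OF that] that(2) unfolding proj_one[symmetric] one_eq_word req_def
    by (subst proj_eq_iff) auto
  from this[OF TTbar_cancel(1)[OF assms]] this[OF TTbar_cancel(2)[OF assms]] assms
  show "proj N q (word (replicate n (T i i))) \<otimes>\<^bsub>Uq N q\<^esub> proj N q (word (replicate n (Tbar i i))) = \<one>\<^bsub>Uq N q\<^esub>"
    "proj N q (word (replicate n (Tbar i i))) \<otimes>\<^bsub>Uq N q\<^esub> proj N q (word (replicate n (T i i))) = \<one>\<^bsub>Uq N q\<^esub>"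
    by (subst proj_mult[symmetric]; auto simp: single_mult_single)+
qed

lemma represents_Kgen:
  assumes "i \<in> {1..N}"
  shows "represents N q (Kgen N q i [^]\<^bsub>Uq N q\<^esub> (m::int)) (K_block i m)"
proof -
  interpret ring "Uq N q" by (rule ring_Uq)
  have pow: "Kgen N q i [^]\<^bsub>Uq N q\<^esub> (n::nat) = proj N q (word (replicate n (T i i)))" for n
  proof (induction n)
    case (Suc n)
    have "proj N q (word (replicate n (T i i))) \<otimes>\<^bsub>Uq N q\<^esub> proj N q (word [T i i])
        = proj N q (word (replicate n (T i i) @ [T i i]))"
      using assms by (subst proj_mult[symmetric]) (auto simp: single_mult_single)
    with Suc show ?case
      by (simp add: Kgen_def tk_def var_def replicate_append_same)
  qed (simp add: one_eq_word[symmetric] proj_one)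
  have "inv\<^bsub>Uq N q\<^esub> (Kgen N q i [^]\<^bsub>Uq N q\<^esub> (n::nat)) = proj N q (word (replicate n (Tbar i i)))" for n
    unfolding pow using assms by (intro inv_char proj_diag_inverse proj_closed) auto
  then have "Kgen N q i [^]\<^bsub>Uq N q\<^esub> m = proj N q (word (K_block i m))"
    by (auto simp: int_pow_def2 pow K_block_def)
  with assms show ?thesis
    by (auto simp: represents_def K_block_def intro!: exI[of _ 1])
qed

text \<open>Root vectors are two-letter products divided by a sign times
  \<open>q - inverse q\<close>, so an ordered monomial is a nonzero multiple of its word.\<close>

lemma pbw_monom_represents:
  assumes "q - inverse q \<noteq> 0" "x \<in> expos N"
  shows "represents N q (pbw_monom N q x) (pbw_word N x)"
proof -
  obtain r \<mu> k where x: "x = (r, \<mu>, k)" "length r = num_roots N" "length \<mu> = N" "length k = num_roots N"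
    using assms(2) by (auto simp: expos_def)
  have 1: "list_all2 (represents N q) (map2 (\<lambda>\<beta> e. f \<beta> [^]\<^bsub>Uq N q\<^esub> e) (pos_roots N) e)
      (map2 (\<lambda>\<beta> e. concat (replicate e (g \<beta>))) (pos_roots N) e)"
    if "\<And>\<beta>. \<beta> \<in> set (pos_roots N) \<Longrightarrow> represents N q (f \<beta>) (g \<beta>)" "length e = num_roots N" for f g and e :: "nat list"
    using that(2) by (simp add: list_all2_conv_all_nth length_pos_roots)
      (metis represents_pow that(1) nth_mem length_pos_roots)
  have 2: "list_all2 (represents N q) (map2 (\<lambda>i m. Kgen N q i [^]\<^bsub>Uq N q\<^esub> m) [1..<Suc N] \<mu>)
      (map2 K_block [1..<Suc N] \<mu>)"
    using x by (auto simp: list_all2_conv_all_nth intro!: represents_Kgen simp del: upt_Suc)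
  have "pbw_word N x = concat (map2 (\<lambda>\<beta> e. concat (replicate e (F_pair \<beta>))) (pos_roots N) r
      @ map2 K_block [1..<Suc N] \<mu> @ map2 (\<lambda>\<beta> e. concat (replicate e (E_pair \<beta>))) (pos_roots N) k)"
    by (simp add: pbw_word_def x pow_word_def)
  then show ?thesis unfolding pbw_monom_def x case_prod_conv
    using 1[OF represents_Froot[OF assms(1)] x(2)] 2 1[OF represents_Eroot[OF assms(1)] x(4)]
    by (simp only:) (intro represents_uprod list_all2_appendI)
qed

definition pow_list :: "'a list \<Rightarrow> nat list \<Rightarrow> 'a list" where
  "pow_list xs es = concat (map2 (\<lambda>x e. replicate e x) xs es)"

lemma pow_word_conv_pow_list: "pow_word f xs es = concat (map f (pow_list xs es))"
proof -
  have "concat (map (\<lambda>(x, e). concat (replicate e (f x))) zs) = concat (map f (concat (map (\<lambda>(x, e). replicate e x) zs)))" for zs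
    by (induction zs) (auto simp: map_replicate)
  then show ?thesis by (simp add: pow_word_def pow_list_def)
qed

lemma pow_list_map: "pow_list xs (map c xs) = concat (map (\<lambda>x. replicate (c x) x) xs)"
  by (induction xs) (simp_all add: pow_list_def)

text \<open>Two sorted lists with the same multiset agree. Thus the exponent vector of an ordered
  word is read off by counting its roots along \<open>pos_roots\<close>.\<close>

lemma sorted_eq_pow_list:
  fixes xs ys :: "'a::linorder list"
  assumes "sorted xs" "sorted ys" "distinct ys" "set xs \<subseteq> set ys"
  shows "pow_list ys (map (count_list xs) ys) = xs"
proof -
  have sorted: "sorted (concat (map (\<lambda>y. replicate (c y) y) ys))" for c :: "'a \<Rightarrow> nat"
    using assms(2) by (induction ys) (auto simp: sorted_append)
  have count_replicate: "count_list (replicate n y) z = (if y = z then n else 0)" for n and y z :: 'a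
    by (induction n) auto
  have count: "count_list (concat (map (\<lambda>y. replicate (c y) y) ys)) z = (if z \<in> set ys then c z else 0)"
    for c :: "'a \<Rightarrow> nat" and z
    using assms(3) by (induction ys) (auto simp: count_replicate)
  have "mset xs = mset (concat (map (\<lambda>y. replicate (count_list xs y) y) ys))"
    using assms(4) by (intro multiset_eqI) (auto simp: count_mset count count_list_0_iff)
  then show ?thesis
    unfolding pow_list_map using sorted assms(1) by (metis sorted_sort_id properties_for_sort)
qed

lemma set_F_gen: "set fs \<subseteq> set (pos_roots N) \<Longrightarrow> set (map F_gen fs) \<subseteq> gens N"
  and set_E_gen: "set fs \<subseteq> set (pos_roots N) \<Longrightarrow> set (map E_gen fs) \<subseteq> gens N"
  by (force simp: set_pos_roots F_gen_def E_gen_def)+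

lemma set_F_pair: "set fs \<subseteq> set (pos_roots N) \<Longrightarrow> set (concat (map F_pair fs)) \<subseteq> gens N"
  and set_E_pair: "set fs \<subseteq> set (pos_roots N) \<Longrightarrow> set (concat (map E_pair fs)) \<subseteq> gens N"
  by (force simp: set_pos_roots F_pair_def E_pair_def)+

definition K_word :: "nat \<Rightarrow> gen list \<Rightarrow> bool" where
  "K_word N ks \<longleftrightarrow> set ks \<subseteq> gens N \<and> (\<forall>k\<in>set ks. K_gen k)"

lemma K_word_simps [simp]: "K_word N []" "K_word N (k # ks) \<longleftrightarrow> k \<in> gens N \<and> K_gen k \<and> K_word N ks"
  "K_word N (ks @ ks') \<longleftrightarrow> K_word N ks \<and> K_word N ks'"
  by (auto simp: K_word_def)

lemma K_gen_simps [simp]: "K_gen (T i i)" "K_gen (Tbar i i)"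
  by (auto simp: K_gen_def)

lemma K_word_commute:
  assumes "q \<noteq> 0" "K_word N ks" "set w \<subseteq> gens N"
  shows "wprop N q (ks @ w) (w @ ks)"
  using assms by (intro wprop_K_words) (auto simp: K_word_def)

lemma K_word_gens: "K_word N ks \<Longrightarrow> set ks \<subseteq> gens N"
  by (simp add: K_word_def)

text \<open>Behind each letter \<open>T j i\<close> a cancelling pair \<open>Tbar i i\<close>,
  \<open>T i i\<close> is inserted. The first half completes the root vector and the second half
  travels to the right into the diagonal block.\<close>

lemma F_word_normal:
  assumes "q \<noteq> 0" "set fs \<subseteq> set (pos_roots N)" "K_word N ks"
  shows "\<exists>ks'. K_word N ks' \<and> wprop N q (map F_gen fs @ ks) (concat (map F_pair fs) @ ks')"
  using assms(2)
proof (induction fs)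
  case Nil
  then show ?case using assms(3) by auto
next
  case (Cons f fs)
  obtain i j where f: "f = (i, j)" "i \<in> {1..N}" "j \<in> {1..N}"
    using Cons.prems by (auto simp: set_pos_roots)
  obtain ks' where ks': "K_word N ks'" "wprop N q (map F_gen fs @ ks) (concat (map F_pair fs) @ ks')"
    using Cons by auto
  let ?W = "concat (map F_pair fs)"
  have gens: "set (map F_gen fs) \<subseteq> gens N" "set ?W \<subseteq> gens N" "set ks \<subseteq> gens N" "set ks' \<subseteq> gens N"
    using set_F_gen set_F_pair Cons.prems assms(3) ks' K_word_gens by auto
  have "wprop N q ([T j i] @ (map F_gen fs @ ks) @ []) ([T j i] @ (?W @ ks') @ [])"
    using gens f by (intro wprop_context ks') auto
  also have "wprop N q ([T j i] @ [] @ ?W @ ks') ([T j i] @ [Tbar i i, T i i] @ ?W @ ks')"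
    using gens f by (intro wprop_context wprop_sym[OF wprop_TTbar(2)]) auto
  then have "wprop N q ([T j i] @ (?W @ ks') @ []) ([T j i, Tbar i i] @ ([T i i] @ ?W) @ ks')" by simp
  also have "wprop N q ([T j i, Tbar i i] @ ([T i i] @ ?W) @ ks') ([T j i, Tbar i i] @ (?W @ [T i i]) @ ks')"
    using gens f assms by (intro wprop_context K_word_commute) auto
  finally have "wprop N q (map F_gen (f # fs) @ ks) (concat (map F_pair (f # fs)) @ (T i i # ks'))"
    by (simp add: F_gen_def F_pair_def f)
  then show ?case using ks' f by (intro exI[of _ "T i i # ks'"]) auto
qed

text \<open>The mirror image: the cancelling pair is inserted in front of \<open>Tbar i j\<close>,
  and its left half travels to the left.\<close>

lemma E_word_normal:
  assumes "q \<noteq> 0" "set es \<subseteq> set (pos_roots N)"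
  shows "\<exists>ks. K_word N ks \<and> wprop N q (map E_gen es) (ks @ concat (map E_pair es))"
  using assms(2)
proof (induction es)
  case Nil
  then show ?case by (intro exI[of _ "[]"]) auto
next
  case (Cons e es)
  obtain i j where e: "e = (i, j)" "i \<in> {1..N}" "j \<in> {1..N}"
    using Cons.prems by (auto simp: set_pos_roots)
  obtain ks where ks: "K_word N ks" "wprop N q (map E_gen es) (ks @ concat (map E_pair es))"
    using Cons by auto
  let ?W = "concat (map E_pair es)"
  have gens: "set (map E_gen es) \<subseteq> gens N" "set ?W \<subseteq> gens N" "set ks \<subseteq> gens N"
    using set_E_gen set_E_pair Cons.prems ks K_word_gens by auto
  have "wprop N q ([Tbar i j] @ map E_gen es @ []) ([Tbar i j] @ (ks @ ?W) @ [])"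
    using gens e by (intro wprop_context ks) auto
  also have "wprop N q ([] @ ([Tbar i j] @ ks) @ ?W) ([] @ (ks @ [Tbar i j]) @ ?W)"
    using gens e assms ks by (intro wprop_context wprop_sym[OF K_word_commute]) auto
  then have "wprop N q ([Tbar i j] @ (ks @ ?W) @ []) (ks @ [] @ ([Tbar i j] @ ?W))" by simp
  also have "wprop N q (ks @ [] @ ([Tbar i j] @ ?W)) (ks @ [Tbar i i, T i i] @ ([Tbar i j] @ ?W))"
    using gens e by (intro wprop_context wprop_sym[OF wprop_TTbar(2)]) auto
  finally have "wprop N q (map E_gen (e # es)) ((ks @ [Tbar i i]) @ concat (map E_pair (e # es)))"
    by (simp add: E_gen_def E_pair_def e)
  then show ?case using ks e by (intro exI[of _ "ks @ [Tbar i i]"]) auto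
qed

lemma K_word_concat_K_block: "set is \<subseteq> {1..N} \<Longrightarrow> K_word N (concat (map2 K_block is \<mu>))"
proof (induction "is" arbitrary: \<mu>)
  case (Cons i "is")
  have "K_word N (K_block i m)" for m
    using Cons.prems by (auto simp: K_word_def K_block_def)
  with Cons show ?case by (cases \<mu>) auto
qed simp

lemma K_block_mult:
  assumes "q \<noteq> 0" "i \<in> {1..N}" "k = T i i \<or> k = Tbar i i"
  shows "\<exists>m'. wprop N q (k # K_block i m) (K_block i m')"
proof -
  have cancel: "wprop N q ([] @ [g, g'] @ replicate n g') ([] @ [] @ replicate n g')"
    if "wprop N q [g, g'] []" "{g, g'} \<subseteq> gens N" for g g' n
    using that by (intro wprop_context) auto
  consider "k = T i i" "m \<ge> 0" | "k = T i i" "m < 0" | "k = Tbar i i" "m > 0" | "k = Tbar i i" "m \<le> 0"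
    using assms(3) by linarith
  then show ?thesis
  proof cases
    case 1
    then have "k # K_block i m = K_block i (m + 1)"
      by (simp add: K_block_def nat_add_distrib)
    then show ?thesis by (metis wprop_refl)
  next
    case 2
    then obtain n where m: "m = - int (Suc n)" using negD by blast
    then have n: "nat \<bar>m\<bar> = Suc n" "m + 1 = - int n" by auto
    then have "K_block i (m + 1) = replicate n (Tbar i i)" by (auto simp: K_block_def)
    with 2 n cancel[OF wprop_TTbar(1)[OF assms(2)], where n = n] assms(2) show ?thesis
      by (intro exI[of _ "m + 1"]) (simp add: K_block_def wprop_TTbar)
  next
    case 3
    then obtain n where m: "m = int (Suc n)" by (metis zero_less_imp_eq_int gr0_implies_Suc)
    then have n: "nat \<bar>m\<bar> = Suc n" "m - 1 = int n" by auto
    then have "K_block i (m - 1) = replicate n (T i i)" by (auto simp: K_block_def)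
    with 3 n cancel[OF wprop_TTbar(2)[OF assms(2)], where n = n] assms(2) show ?thesis
      by (intro exI[of _ "m - 1"]) (simp add: K_block_def)
  next
    case 4
    have "nat \<bar>m - 1\<bar> = Suc (nat \<bar>m\<bar>)" using 4 by simp
    then have "k # K_block i m = K_block i (m - 1)"
      using 4 by (auto simp: K_block_def)
    then show ?thesis by (metis wprop_refl)
  qed
qed

lemma K_blocks_mult:
  assumes "q \<noteq> 0" "k \<in> gens N" "k = T i i \<or> k = Tbar i i" "i \<in> set is" "set is \<subseteq> {1..N}" "length \<mu> = length is"
  shows "\<exists>\<mu>'. length \<mu>' = length is \<and> wprop N q (k # concat (map2 K_block is \<mu>)) (concat (map2 K_block is \<mu>'))"
  using assms(4-6)
proof (induction "is" arbitrary: \<mu>)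
  case (Cons j "is")
  obtain m \<mu>1 where \<mu>: "\<mu> = m # \<mu>1" "length \<mu>1 = length is" using Cons.prems by (cases \<mu>) auto
  let ?R = "\<lambda>\<mu>. concat (map2 K_block is \<mu>)"
  have K: "K_word N (?R \<mu>)" "K_word N (K_block j m)" for \<mu> m
    using K_word_concat_K_block[of "is" N \<mu>] K_word_concat_K_block[of "[j]" N "[m]"] Cons.prems by auto
  note gens = K_word_gens[OF K(1)] K_word_gens[OF K(2)]
  show ?case
  proof (cases "i = j")
    case True
    then obtain m' where m': "wprop N q (k # K_block j m) (K_block j m')"
      using K_block_mult[OF assms(1) _ assms(3), of N m] Cons.prems by auto
    have "wprop N q ([] @ (k # K_block j m) @ ?R \<mu>1) ([] @ K_block j m' @ ?R \<mu>1)"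
      using gens assms(2) by (intro wprop_context m') (auto simp del: set_concat)
    then show ?thesis using \<mu> by (intro exI[of _ "m' # \<mu>1"]) auto
  next
    case False
    then obtain \<mu>' where \<mu>': "length \<mu>' = length is" "wprop N q (k # ?R \<mu>1) (?R \<mu>')"
      using Cons.IH[of \<mu>1] Cons.prems \<mu> by auto
    have "wprop N q ([] @ ([k] @ K_block j m) @ ?R \<mu>1) ([] @ (K_block j m @ [k]) @ ?R \<mu>1)"
      using K gens assms by (intro wprop_context K_word_commute) (auto simp del: set_concat)
    also have "wprop N q ([] @ (K_block j m @ [k]) @ ?R \<mu>1) (K_block j m @ (k # ?R \<mu>1) @ [])" by simp
    also have "wprop N q (K_block j m @ (k # ?R \<mu>1) @ []) (K_block j m @ ?R \<mu>' @ [])"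
      using gens assms by (intro wprop_context \<mu>') (auto simp del: set_concat)
    finally show ?thesis using \<mu> \<mu>' by (intro exI[of _ "m # \<mu>'"]) auto
  qed
qed simp

text \<open>Mere existence of \<open>\<mu>\<close> is enough, because the total degree does not
  depend on it.\<close>

lemma K_word_normal:
  assumes "q \<noteq> 0" "K_word N ks"
  shows "\<exists>\<mu>. length \<mu> = N \<and> wprop N q ks (concat (map2 K_block [1..<Suc N] \<mu>))"
  using assms(2)
proof (induction ks)
  case Nil
  have "concat (map (\<lambda>(i, m). K_block i m) zs) = []" if "snd ` set zs \<subseteq> {0}" for zs
    using that by (induction zs) (auto simp: K_block_def)
  from this[of "zip [1..<Suc N] (replicate N 0)"]
  have "concat (map2 K_block [1..<Suc N] (replicate N 0)) = []"
    by (force dest: set_zip_rightD)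
  then show ?case by (intro exI[of _ "replicate N 0"]) (simp only: length_replicate wprop_refl simp_thms)
next
  case (Cons k ks)
  obtain \<mu> where \<mu>: "length \<mu> = N" "wprop N q ks (concat (map2 K_block [1..<Suc N] \<mu>))"
    using Cons by auto
  obtain i where i: "k = T i i \<or> k = Tbar i i" "i \<in> {1..N}"
    using Cons.prems by (auto simp: K_gen_def)
  have len: "length [1..<Suc N] = N" and set: "set [1..<Suc N] = {1..N}" by auto
  have "K_word N (concat (map2 K_block [1..<Suc N] \<mu>))"
    by (rule K_word_concat_K_block) auto
  then have "wprop N q ([k] @ ks @ []) ([k] @ concat (map2 K_block [1..<Suc N] \<mu>) @ [])"
    using Cons.prems K_word_gens by (intro wprop_context \<mu>) (auto simp del: set_concat upt_Suc)
  moreover obtain \<mu>' where "length \<mu>' = N"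
    "wprop N q (k # concat (map2 K_block [1..<Suc N] \<mu>)) (concat (map2 K_block [1..<Suc N] \<mu>'))"
    using K_blocks_mult[OF assms(1) _ i(1), of N "[1..<Suc N]" \<mu>] Cons.prems i(2) \<mu>(1) unfolding len set by auto
  ultimately have "wprop N q (k # ks) (concat (map2 K_block [1..<Suc N] \<mu>'))"
    by (simp only: append_Nil2 append_Cons append_Nil) (rule wprop_trans)
  with \<open>length \<mu>' = N\<close> show ?case by blast
qed

lemma sorted_word_normal:
  assumes "q \<noteq> 0" "set fs \<subseteq> set (pos_roots N)" "sorted fs" "K_word N ks" "set es \<subseteq> set (pos_roots N)" "sorted es"
  shows "\<exists>\<mu>. length \<mu> = N \<and> wprop N q (map F_gen fs @ ks @ map E_gen es)
    (pbw_word N (map (count_list fs) (pos_roots N), \<mu>, map (count_list es) (pos_roots N)))"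
proof -
  obtain ks1 where ks1: "K_word N ks1" "wprop N q (map E_gen es) (ks1 @ concat (map E_pair es))"
    using E_word_normal assms by blast
  have "K_word N (ks @ ks1)" using assms ks1 by simp
  then obtain ks2 where ks2: "K_word N ks2" "wprop N q (map F_gen fs @ (ks @ ks1)) (concat (map F_pair fs) @ ks2)"
    using F_word_normal assms by blast
  obtain \<mu> where \<mu>: "length \<mu> = N" "wprop N q ks2 (concat (map2 K_block [1..<Suc N] \<mu>))"
    using K_word_normal assms ks2 by blast
  have gens: "set (map F_gen fs) \<subseteq> gens N" "set (map E_gen es) \<subseteq> gens N" "set (concat (map F_pair fs)) \<subseteq> gens N" 
     "set (concat (map E_pair es)) \<subseteq> gens N" 
    by (rule set_F_gen set_E_gen set_F_pair set_E_pair; rule assms)+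
  have gensK: "set ks \<subseteq> gens N" "set ks1 \<subseteq> gens N" "set ks2 \<subseteq> gens N"
    "set (concat (map2 K_block [1..<Suc N] \<mu>)) \<subseteq> gens N"
    using assms ks1 ks2 by (simp_all only: K_word_gens) (rule K_word_gens, rule K_word_concat_K_block, auto)
  have "wprop N q ((map F_gen fs @ ks) @ map E_gen es @ []) ((map F_gen fs @ ks) @ (ks1 @ concat (map E_pair es)) @ [])"
    using gens gensK by (intro wprop_context ks1) (auto simp del: set_concat)
  also have "wprop N q ([] @ (map F_gen fs @ (ks @ ks1)) @ concat (map E_pair es)) ([] @ (concat (map F_pair fs) @ ks2) @ concat (map E_pair es))"
    using gens gensK by (intro wprop_context ks2) (auto simp del: set_concat)
  then have "wprop N q ((map F_gen fs @ ks) @ (ks1 @ concat (map E_pair es)) @ []) (concat (map F_pair fs) @ ks2 @ concat (map E_pair es))"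
    by simp
  also have "wprop N q (concat (map F_pair fs) @ ks2 @ concat (map E_pair es))
     (concat (map F_pair fs) @ concat (map2 K_block [1..<Suc N] \<mu>) @ concat (map E_pair es))"
    using gens gensK by (intro wprop_context \<mu>) (auto simp del: set_concat upt_Suc)
  also have "concat (map F_pair fs) @ concat (map2 K_block [1..<Suc N] \<mu>) @ concat (map E_pair es)
     = pbw_word N (map (count_list fs) (pos_roots N), \<mu>, map (count_list es) (pos_roots N))"
    using assms sorted_distinct_pos_roots[of N]
    by (simp add: pbw_word_def pow_word_conv_pow_list sorted_eq_pow_list)
  finally show ?thesis using \<mu>(1) by auto
qed

section \<open>Straightening\<close>

text \<open>The preimage in the free algebra of the span of the ordered monomials with exponents in
  \<open>P\<close>. Since the base case contains the whole relation ideal, membership depends only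
  on the class in \<open>Uq\<close>.\<close>

inductive_set pbw_span :: "nat \<Rightarrow> complex \<Rightarrow> (expo \<Rightarrow> bool) \<Rightarrow> falg set" for N q P where
  rel: "p \<in> rel_ideal N q \<Longrightarrow> p \<in> pbw_span N q P"
| add_monom: "p \<in> pbw_span N q P \<Longrightarrow> x \<in> expos N \<Longrightarrow> P x \<Longrightarrow>
    p + monomial (pbw_word N x) c \<in> pbw_span N q P"

lemma pbw_span_add: "p' \<in> pbw_span N q P \<Longrightarrow> p \<in> pbw_span N q P \<Longrightarrow> p + p' \<in> pbw_span N q P"
proof (induction rule: pbw_span.induct)
  case (rel p')
  from rel(2) show ?case
  proof (induction rule: pbw_span.induct)
    case (rel p)
    then show ?case using \<open>p' \<in> rel_ideal N q\<close> by (intro pbw_span.rel rel_ideal_add)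
  next
    case (add_monom p x c)
    then have "(p + p') + monomial (pbw_word N x) c \<in> pbw_span N q P"
      by (intro pbw_span.add_monom)
    then show ?case by (simp add: add_ac)
  qed
next
  case (add_monom p' x c)
  then have "(p + p') + monomial (pbw_word N x) c \<in> pbw_span N q P"
    by (intro pbw_span.add_monom) auto
  then show ?case by (simp add: add_ac)
qed

lemma pbw_span_0 [simp]: "0 \<in> pbw_span N q P"
  by (simp add: pbw_span.rel)

lemma pbw_span_scale: "p \<in> pbw_span N q P \<Longrightarrow> const c * p \<in> pbw_span N q P"
proof (induction rule: pbw_span.induct)
  case (rel p)
  then show ?case by (intro pbw_span.rel rel_ideal_mult_left) auto
next
  case (add_monom p x d)
  then have "const c * p + monomial (pbw_word N x) (c * d) \<in> pbw_span N q P"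
    by (intro pbw_span.add_monom)
  then show ?case by (simp add: distrib_left const_mult_single)
qed

lemma pbw_span_sum: "(\<And>x. x \<in> A \<Longrightarrow> f x \<in> pbw_span N q P) \<Longrightarrow> sum f A \<in> pbw_span N q P"
  by (induction A rule: infinite_finite_induct) (auto intro: pbw_span_add)

lemma pbw_span_mono: "p \<in> pbw_span N q P \<Longrightarrow> (\<And>x. x \<in> expos N \<Longrightarrow> P x \<Longrightarrow> Q x) \<Longrightarrow> p \<in> pbw_span N q Q"
  by (induction rule: pbw_span.induct) (auto intro: pbw_span.intros)

lemma pbw_span_req: "req N q p p' \<Longrightarrow> p' \<in> pbw_span N q P \<Longrightarrow> p \<in> pbw_span N q P"
  using pbw_span_add[of p' N q P "p - p'"] pbw_span.rel[of "p - p'" N q P] by (simp add: req_def)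

lemma pbw_span_wprop:
  assumes "wprop N q w (pbw_word N x)" "x \<in> expos N" "P x"
  shows "monomial w c \<in> pbw_span N q P"
proof -
  obtain d where "req N q (word w) (monomial (pbw_word N x) d)"
    using assms(1) by (auto simp: wprop_def)
  then have "req N q (monomial w (c * 1)) (monomial (pbw_word N x) (c * d))"
    by (rule req_single_scale)
  moreover have "0 + monomial (pbw_word N x) (c * d) \<in> pbw_span N q P"
    using assms by (intro pbw_span.add_monom) auto
  ultimately show ?thesis using pbw_span_req by simp
qed

section \<open>Heights, ranks and the rewriting of adjacent letters\<close>

fun gen_height :: "gen \<Rightarrow> nat" where
  "gen_height (T i j) = i - j"
| "gen_height (Tbar i j) = j - i"

definition word_height :: "gen list \<Rightarrow> nat" where
  "word_height w = sum_list (map gen_height w)"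

lemma word_height_simps [simp]: "word_height [] = 0" "word_height (g # w) = gen_height g + word_height w"
  "word_height (u @ v) = word_height u + word_height v"
  by (simp_all add: word_height_def)

definition expo_height :: "nat \<Rightarrow> expo \<Rightarrow> nat" where
  "expo_height N = (\<lambda>(r, \<mu>, k). \<Sum>j<num_roots N. (k ! j + r ! j) * height (pos_roots N ! j))"

text \<open>Sorting a word by rank brings it into the order \<open>F K E\<close> of the ordered monomials.\<close>

fun gen_rank :: "gen \<Rightarrow> nat \<times> nat \<times> nat" where
  "gen_rank (T j i) = (if i < j then (0, i, j) else (1, i, 0))"
| "gen_rank (Tbar i j) = (if i < j then (2, i, j) else (1, i, 0))"

text \<open>The admissible replacements \<open>a b\<close> of a descent \<open>x y\<close>. At equal
  height only the rank of \<open>a\<close> is restricted: it stands at the first changed position,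
  so the sequence of ranks drops lexicographically whatever \<open>b\<close> is.\<close>

definition lower_pair :: "gen \<Rightarrow> gen \<Rightarrow> gen \<Rightarrow> gen \<Rightarrow> bool" where
  "lower_pair x y a b \<longleftrightarrow> zero_gen a \<or> zero_gen b \<or> gen_height a + gen_height b < gen_height x + gen_height y
     \<or> gen_height a + gen_height b = gen_height x + gen_height y \<and> gen_rank a < gen_rank x"

definition straightens :: "nat \<Rightarrow> complex \<Rightarrow> gen \<Rightarrow> gen \<Rightarrow> bool" where
  "straightens N q x y \<longleftrightarrow> (\<exists>L. (\<forall>(c, a, b)\<in>set L. a \<in> gens N \<and> b \<in> gens N \<and> lower_pair x y a b) \<and>
     req N q (word [x, y]) (\<Sum>(c, a, b)\<leftarrow>L. monomial [a, b] c))"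

lemma straightensI1:
  assumes "req N q (word [x, y]) (monomial [a, b] c)" "{a, b} \<subseteq> gens N" "lower_pair x y a b"
  shows "straightens N q x y"
  unfolding straightens_def using assms by (intro exI[of _ "[(c, a, b)]"]) auto

lemma straightensI2:
  assumes "req N q (word [x, y]) (monomial [a, b] c + monomial [a', b'] c')"
    "{a, b, a', b'} \<subseteq> gens N" "lower_pair x y a b" "lower_pair x y a' b'"
  shows "straightens N q x y"
  unfolding straightens_def using assms by (intro exI[of _ "[(c, a, b), (c', a', b')]"]) auto

lemma lower_pair_swap: "gen_rank y < gen_rank x \<Longrightarrow> lower_pair x y y x"
  by (simp add: lower_pair_def)

lemma straightens_wprop:
  assumes "wprop N q [x, y] [y, x]" "{x, y} \<subseteq> gens N" "gen_rank y < gen_rank x"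
  shows "straightens N q x y"
proof -
  obtain c where "req N q (word [x, y]) (monomial [y, x] c)" using assms by (auto simp: wprop_def)
  then show ?thesis using assms(2,3) by (intro straightensI1[OF _ _ lower_pair_swap]) auto
qed

lemma straightens_qcommute:
  assumes "q \<noteq> 0" "req N q (monomial [x, y] q)
      (monomial [y, x] 1 + monomial [x, y] (q - inverse q))"
    "{x, y} \<subseteq> gens N" "gen_rank y < gen_rank x"
  shows "straightens N q x y"
proof -
  have "req N q (monomial [x, y] (q + (- (q - inverse q))))
      (monomial [y, x] 1 + monomial [x, y] (q - inverse q) + monomial [x, y] (- (q - inverse q)))"
    unfolding single_add by (intro req_add assms(2)) auto
  then have "req N q (monomial [x, y] (inverse q)) (monomial [y, x] 1)"
    by (simp add: single_add[symmetric] add.assoc)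
  then have "wprop N q [x, y] [y, x]" using assms(1) by (intro wprop_singleI) auto
  then show ?thesis using assms by (intro straightens_wprop)
qed

lemma straightens_FF:
  assumes "q \<noteq> 0" "a < i" "b < j" "T i a \<in> gens N" "T j b \<in> gens N" "gen_rank (T j b) < gen_rank (T i a)"
  shows "straightens N q (T i a) (T j b)"
proof -
  have rank: "b < a \<or> b = a \<and> j < i" using assms by auto
  have rel: "req N q (monomial [T i a, T j b] (q ^ of_bool (i = j)))
    (monomial [T j b, T i a] (q ^ of_bool (a = b))
     + monomial [T j a, T i b] ((q - inverse q) * (of_bool (b < a) - of_bool (i < j))))"
    using assms by (intro rtt_T) auto
  consider "i = j" "b < a" | "i \<noteq> j" "b = a \<or> i < j" | "j < i" "b < a" "j \<noteq> a" | "j < i" "b < a" "j = a"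
    using rank by linarith
  then show ?thesis
  proof cases
    case 1
    then show ?thesis using rel assms by (intro straightens_qcommute) auto
  next
    case 2
    then have "(of_bool (b < a) - of_bool (i < j) :: complex) = 0" using rank by auto
    then have "req N q (word [T i a, T j b]) (monomial [T j b, T i a] (q ^ of_bool (a = b)))"
      using rel 2 rank by auto
    then show ?thesis using assms by (intro straightensI1[OF _ _ lower_pair_swap]) auto
  next
    case 3
    have "lower_pair (T i a) (T j b) (T j a) (T i b)"
      using 3 assms by (auto simp: lower_pair_def)
    moreover have "req N q (word [T i a, T j b]) (monomial [T j b, T i a] 1 + monomial [T j a, T i b] (q - inverse q))"
      using rel 3 by simp
    ultimately show ?thesis using assms by (intro straightensI2[OF _ _ lower_pair_swap]) auto
  next
    \<comment> \<open>Here \<open>T j a\<close> is diagonal and has larger rank than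
      \<open>T i a\<close>. It is moved behind \<open>T i b\<close>, whose rank is smaller because
      \<open>b < a\<close>.\<close>
    case 4
    obtain c where "req N q (word [T j a, T i b]) (monomial [T i b, T j a] c)"
      using wprop_K[of q "T j a" N "T i b"] assms 4 by (auto simp: wprop_def K_gen_def)
    then have "req N q (monomial [T j a, T i b] ((q - inverse q) * 1)) (monomial [T i b, T j a] ((q - inverse q) * c))"
      by (rule req_single_scale)
    then have "req N q (monomial [T j b, T i a] 1 + monomial [T j a, T i b] (q - inverse q))
       (monomial [T j b, T i a] 1 + monomial [T i b, T j a] ((q - inverse q) * c))"
      by (intro req_add) auto
    moreover have "req N q (word [T i a, T j b]) (monomial [T j b, T i a] 1 + monomial [T j a, T i b] (q - inverse q))"
      using rel 4 by simp
    ultimately have "req N q (word [T i a, T j b]) (monomial [T j b, T i a] 1 + monomial [T i b, T j a] ((q - inverse q) * c))"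
      by (blast intro: req_trans)
    moreover have "lower_pair (T i a) (T j b) (T i b) (T j a)"
      using 4 assms by (auto simp: lower_pair_def)
    ultimately show ?thesis using assms by (intro straightensI2[OF _ _ lower_pair_swap]) auto
  qed
qed

text \<open>For equal rows the extra word repeats the left-hand word, and the two letters commute up
  to a scalar. Otherwise \<open>j < i < a\<close>, so the extra word starts with a proper E letter
  \<open>Tbar j a\<close> of smaller rank.\<close>

lemma straightens_EE:
  assumes "q \<noteq> 0" "i < a" "j < b" "Tbar i a \<in> gens N" "Tbar j b \<in> gens N" "gen_rank (Tbar j b) < gen_rank (Tbar i a)"
  shows "straightens N q (Tbar i a) (Tbar j b)"
proof -
  have rank: "j < i \<or> j = i \<and> b < a" using assms by auto
  have rel: "req N q (monomial [Tbar i a, Tbar j b] (q ^ of_bool (i = j)))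
    (monomial [Tbar j b, Tbar i a] (q ^ of_bool (a = b))
     + monomial [Tbar j a, Tbar i b] ((q - inverse q) * (of_bool (b < a) - of_bool (i < j))))"
    using assms by (intro rtt_Tbar) auto
  show ?thesis
  proof (cases "i = j")
    case True
    then show ?thesis using rel assms rank by (intro straightens_qcommute) auto
  next
    case False
    have "lower_pair (Tbar i a) (Tbar j b) (Tbar j a) (Tbar i b)"
      using False rank assms by (auto simp: lower_pair_def)
    moreover have "req N q (word [Tbar i a, Tbar j b])
      (monomial [Tbar j b, Tbar i a] (q ^ of_bool (a = b))
       + monomial [Tbar j a, Tbar i b] ((q - inverse q) * (of_bool (b < a) - of_bool (i < j))))"
      using rel False by simp
    ultimately show ?thesis by (rule straightensI2[OF _ _ lower_pair_swap[OF assms(6)], rotated 2]) (use assms in auto)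
  qed
qed

text \<open>Unless they vanish, the extra words lose height \<open>2 * (a - b)\<close> and
  \<open>2 * (j - i)\<close>. Hence exchanging E and F never produces extra terms of the same
  height.\<close>

lemma straightens_EF:
  assumes "q \<noteq> 0" "i < a" "b < j" "Tbar i a \<in> gens N" "T j b \<in> gens N"
  shows "straightens N q (Tbar i a) (T j b)"
proof -
  define e where "e = inverse (q ^ of_bool (i = j))"
  have e: "e * q ^ of_bool (i = j) = 1" using assms(1) by (simp add: e_def)
  have "req N q (const e * monomial [Tbar i a, T j b] (q ^ of_bool (i = j)))
    (const e * (monomial [T j b, Tbar i a] (q ^ of_bool (a = b))
     + monomial [T j a, Tbar i b] ((q - inverse q) * of_bool (b < a))
     + monomial [Tbar j a, T i b] (- ((q - inverse q) * of_bool (i < j)))))"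
    using assms by (intro req_scale rtt_mixed) auto
  then have rel: "req N q (word [Tbar i a, T j b])
    (monomial [T j b, Tbar i a] (e * q ^ of_bool (a = b))
     + monomial [T j a, Tbar i b] (e * ((q - inverse q) * of_bool (b < a)))
     + monomial [Tbar j a, T i b] (e * (- ((q - inverse q) * of_bool (i < j)))))"
    unfolding distrib_left const_mult_single e .
  \<comment> \<open>An extra word with coefficient zero must be left out of the list, because it
    need not be lower.\<close>
  define L where "L = [(e * q ^ of_bool (a = b), T j b, Tbar i a)]
    @ (if b < a then [(e * ((q - inverse q) * of_bool (b < a)), T j a, Tbar i b)] else [])
    @ (if i < j then [(e * (- ((q - inverse q) * of_bool (i < j))), Tbar j a, T i b)] else [])"
  have "(\<Sum>(c, a, b)\<leftarrow>L. monomial [a, b] c) = monomial [T j b, Tbar i a] (e * q ^ of_bool (a = b))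
     + monomial [T j a, Tbar i b] (e * ((q - inverse q) * of_bool (b < a)))
     + monomial [Tbar j a, T i b] (e * (- ((q - inverse q) * of_bool (i < j))))"
    by (simp add: L_def algebra_simps)
  moreover have "\<forall>(c, x, y)\<in>set L. x \<in> gens N \<and> y \<in> gens N \<and> lower_pair (Tbar i a) (T j b) x y"
    using assms by (auto simp: L_def lower_pair_def)
  ultimately show ?thesis unfolding straightens_def using rel by (intro exI[of _ L]) simp
qed

lemma nonzero_gen_cases:
  assumes "\<not> zero_gen g"
  obtains "K_gen g" | i a where "g = T i a" "a < i" | i a where "g = Tbar i a" "i < a"
proof (cases g)
  case (T i a)
  with assms that show ?thesis by (cases "i = a") auto
next
  case (Tbar i a)
  with assms that show ?thesis by (cases "i = a") auto
qed

lemma straightens: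
  assumes "q \<noteq> 0" "x \<in> gens N" "y \<in> gens N" "\<not> zero_gen x" "\<not> zero_gen y" "gen_rank y < gen_rank x"
  shows "straightens N q x y"
proof -
  consider (K) "K_gen x \<or> K_gen y"
    | (FF) i a j b where "x = T i a" "a < i" "y = T j b" "b < j"
    | (EE) i a j b where "x = Tbar i a" "i < a" "y = Tbar j b" "j < b"
    | (EF) i a j b where "x = Tbar i a" "i < a" "y = T j b" "b < j"
    | (FE) i a j b where "x = T i a" "a < i" "y = Tbar j b" "j < b"
    using nonzero_gen_cases[OF assms(4)] nonzero_gen_cases[OF assms(5)] by metis
  then show ?thesis
  proof cases
    case K
    then have "wprop N q [x, y] [y, x]"
      using wprop_K[OF assms(1), of x N y] wprop_sym[OF wprop_K[OF assms(1), of y N x]] assms by blast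
    then show ?thesis using assms by (intro straightens_wprop) auto
  qed (use assms in \<open>auto intro: straightens_FF straightens_EE straightens_EF\<close>)
qed

text \<open>The first component of \<open>gen_rank\<close> is 0, 1, 2 for F, diagonal and E letters,
  and the remaining components are the root in the F and E cases. Order by rank is therefore the
  order of the blocks, with roots increasing inside the outer two.\<close>

lemma sorted_word_decomp:
  assumes "set w \<subseteq> gens N" "\<forall>g\<in>set w. \<not> zero_gen g" "sorted (map gen_rank w)"
  shows "\<exists>fs ks es. w = map F_gen fs @ ks @ map E_gen es \<and> sorted fs \<and> sorted es \<and> K_word N ks
    \<and> set fs \<subseteq> set (pos_roots N) \<and> set es \<subseteq> set (pos_roots N)"
  using assms
proof (induction w)
  case Nil
  then show ?case by (intro exI[of _ "[]"]) auto
next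
  case (Cons g w)
  then obtain fs ks es where w: "w = map F_gen fs @ ks @ map E_gen es" "sorted fs" "sorted es" "K_word N ks"
    "set fs \<subseteq> set (pos_roots N)" "set es \<subseteq> set (pos_roots N)" by auto
  have le: "gen_rank g \<le> gen_rank h" if "h \<in> set w" for h using Cons.prems that by auto
  have F: "fst (gen_rank (F_gen f)) = 0 \<and> snd (gen_rank (F_gen f)) = f" if "f \<in> set fs" for f
    using that w by (auto simp: set_pos_roots F_gen_def)
  have E: "fst (gen_rank (E_gen f)) = 2 \<and> snd (gen_rank (E_gen f)) = f" if "f \<in> set es" for f
    using that w by (auto simp: set_pos_roots E_gen_def)
  have K: "fst (gen_rank k) = 1" if "k \<in> set ks" for k
    using that w by (auto simp: K_word_def K_gen_def)
  consider (F) i a where "g = T i a" "a < i" | (K) "K_gen g" | (E) i a where "g = Tbar i a" "i < a"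
    using nonzero_gen_cases[of g] Cons.prems(2) by (metis list.set_intros(1))
  then show ?case
  proof cases
    case (F i a)
    have "(a, i) \<le> f" if "f \<in> set fs" for f
    proof -
      have "gen_rank g \<le> gen_rank (F_gen f)" using that w by (intro le) auto
      then show ?thesis using F \<open>f \<in> set fs \<Longrightarrow> _\<close>[OF that] by (cases "gen_rank (F_gen f)") auto
    qed
    then show ?thesis using F w Cons.prems
      by (intro exI[of _ "(a, i) # fs"] exI[of _ ks] exI[of _ es]) (auto simp: F_gen_def set_pos_roots)
  next
    case K
    then have rank: "fst (gen_rank g) = 1" by (auto simp: K_gen_def)
    have "fs = []"
    proof (rule ccontr)
      assume "fs \<noteq> []"
      then have "hd fs \<in> set fs" by simp
      moreover from this have "gen_rank g \<le> gen_rank (F_gen (hd fs))" using w by (intro le) auto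
      ultimately show False using rank F[of "hd fs"] by (cases "gen_rank g"; cases "gen_rank (F_gen (hd fs))") auto
    qed
    then show ?thesis using K w Cons.prems
      by (intro exI[of _ "[]"] exI[of _ "g # ks"] exI[of _ es]) auto
  next
    case (E i a)
    then have rank: "gen_rank g = (2, i, a)" by auto
    have "fs = []"
    proof (rule ccontr)
      assume "fs \<noteq> []"
      then have "hd fs \<in> set fs" by simp
      moreover from this have "gen_rank g \<le> gen_rank (F_gen (hd fs))" using w by (intro le) auto
      ultimately show False using rank F[of "hd fs"] by (cases "gen_rank (F_gen (hd fs))") auto
    qed
    moreover have "ks = []"
    proof (rule ccontr)
      assume "ks \<noteq> []"
      then have "hd ks \<in> set ks" by simp
      moreover from this have "gen_rank g \<le> gen_rank (hd ks)" using w by (intro le) auto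
      ultimately show False using rank K[of "hd ks"] by (cases "gen_rank (hd ks)") auto
    qed
    moreover have "(i, a) \<le> f" if "f \<in> set es" for f
    proof -
      have "gen_rank g \<le> gen_rank (E_gen f)" using that w by (intro le) auto
      then show ?thesis using rank \<open>f \<in> set es \<Longrightarrow> _\<close>[OF that] by (cases "gen_rank (E_gen f)") auto
    qed
    ultimately show ?thesis using E w Cons.prems
      by (intro exI[of _ "[]"] exI[of _ "(i, a) # es"]) (auto simp: E_gen_def set_pos_roots)
  qed
qed

lemma sum_nth_pos_roots: "(\<Sum>j<num_roots N. f (pos_roots N ! j)) = (\<Sum>\<beta>\<in>set (pos_roots N). f \<beta>)"
proof -
  have "(\<Sum>\<beta>\<in>set (pos_roots N). f \<beta>) = sum_list (map f (pos_roots N))"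
    using sorted_distinct_pos_roots by (metis sum_list_distinct_conv_sum_set)
  then show ?thesis by (simp add: sum_list_sum_nth length_pos_roots lessThan_atLeast0)
qed

lemma expo_height_count:
  assumes "set fs \<subseteq> set (pos_roots N)" "set es \<subseteq> set (pos_roots N)"
  shows "expo_height N (map (count_list fs) (pos_roots N), \<mu>, map (count_list es) (pos_roots N))
    = sum_list (map height fs) + sum_list (map height es)"
proof -
  have *: "(\<Sum>\<beta>\<in>set (pos_roots N). count_list xs \<beta> * height \<beta>) = sum_list (map height xs)"
    if "set xs \<subseteq> set (pos_roots N)" for xs
    unfolding sum_list_map_eq_sum_count using that
    by (intro sum.mono_neutral_right) (auto simp: count_list_0_iff)
  have "expo_height N (map (count_list fs) (pos_roots N), \<mu>, map (count_list es) (pos_roots N))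
      = (\<Sum>j<num_roots N. count_list es (pos_roots N ! j) * height (pos_roots N ! j) + count_list fs (pos_roots N ! j) * height (pos_roots N ! j))"
    by (simp add: expo_height_def length_pos_roots distrib_right)
  also have "\<dots> = sum_list (map height es) + sum_list (map height fs)"
    by (simp only: sum.distrib sum_nth_pos_roots[of "\<lambda>\<beta>. count_list es \<beta> * height \<beta>"]
        sum_nth_pos_roots[of "\<lambda>\<beta>. count_list fs \<beta> * height \<beta>"] *[OF assms(1)] *[OF assms(2)])
  finally show ?thesis by simp
qed

lemma word_height_normal:
  assumes "K_word N ks"
  shows "word_height (map F_gen fs @ ks @ map E_gen es) = sum_list (map height fs) + sum_list (map height es)"
proof -
  have "gen_height (F_gen f) = height f" "gen_height (E_gen f) = height f" for f
    by (auto simp: F_gen_def E_gen_def height_def split: prod.split)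
  then have "word_height (map F_gen fs) = sum_list (map height fs)" "word_height (map E_gen es) = sum_list (map height es)"
    by (simp_all add: word_height_def comp_def)
  moreover have "word_height ks = 0" using assms by (induction ks) (auto simp: K_gen_def)
  ultimately show ?thesis by simp
qed

text \<open>Rewriting an adjacent descent yields words that vanish, have smaller height, or have the
  same height and a lexicographically smaller sequence of ranks. All words have the same length, and
  \<open>lex\<close> on lists of equal length over a well-founded order is well-founded, so the
  process stops at rank-sorted words.\<close>

lemma straightening:
  assumes "q \<noteq> 0" "set w \<subseteq> gens N" "word_height w \<le> h"
  shows "word w \<in> pbw_span N q (\<lambda>x. expo_height N x \<le> h)"
proof -
  define R where "R = inv_image (less_than <*lex*> lex {(x, y). x < (y :: nat \<times> nat \<times> nat)}) (\<lambda>w. (word_height w, map gen_rank w))"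
  have "wf {(x, y). x < (y :: nat \<times> nat \<times> nat)}" by (rule wf)
  then have "wf R" unfolding R_def by (intro wf_inv_image wf_lex_prod wf_less_than wf_lex)
  then show ?thesis using assms(2,3)
  proof (induction w rule: wf_induct_rule)
    case (less w)
    show ?case
    proof (cases "\<exists>g\<in>set w. zero_gen g")
      case True
      then show ?thesis using less.prems by (intro pbw_span.rel zero_word_rel_ideal) auto
    next
      case nz: False
      show ?thesis
      proof (cases "sorted (map gen_rank w)")
        case True
        obtain fs ks es where w: "w = map F_gen fs @ ks @ map E_gen es" "sorted fs" "sorted es" "K_word N ks"
          "set fs \<subseteq> set (pos_roots N)" "set es \<subseteq> set (pos_roots N)"
          using sorted_word_decomp[OF less.prems(1) _ True] nz by blast
        obtain \<mu> where \<mu>: "length \<mu> = N"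
          "wprop N q w (pbw_word N (map (count_list fs) (pos_roots N), \<mu>, map (count_list es) (pos_roots N)))"
          unfolding w(1) using sorted_word_normal[OF assms(1) w(5,2,4,6,3)] by blast
        show ?thesis
        proof (rule pbw_span_wprop[OF \<mu>(2)])
          show "expo_height N (map (count_list fs) (pos_roots N), \<mu>, map (count_list es) (pos_roots N)) \<le> h"
            using less.prems(2) unfolding expo_height_count[OF w(5,6)] w(1) word_height_normal[OF w(4)] .
        qed (simp add: expos_def \<mu> length_pos_roots)
      next
        case False
        then obtain i where i: "Suc i < length w" "gen_rank (w ! Suc i) < gen_rank (w ! i)"
          by (auto simp: sorted_iff_nth_Suc not_le)
        define u v x y where "u = take i w" and "v = drop (Suc (Suc i)) w" and "x = w ! i" and "y = w ! Suc i"
        have w: "w = u @ [x, y] @ v"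
          using i(1) by (simp add: u_def v_def x_def y_def Cons_nth_drop_Suc)
        have "straightens N q x y"
          using less.prems nz i nth_mem[of i w] nth_mem[of "Suc i" w] unfolding x_def y_def
          by (intro straightens assms(1)) auto
        then obtain L where L': "\<forall>(c, a, b)\<in>set L. a \<in> gens N \<and> b \<in> gens N \<and> lower_pair x y a b"
          and L: "req N q (word [x, y]) (\<Sum>(c, a, b)\<leftarrow>L. monomial [a, b] c)"
          unfolding straightens_def by (elim exE conjE)
        have gens: "set u \<subseteq> gens N" "set v \<subseteq> gens N" using less.prems w by auto
        have "req N q (word u * word [x, y] * word v) (word u * (\<Sum>(c, a, b)\<leftarrow>L. monomial [a, b] c) * word v)"
          using gens by (intro req_mult_left req_mult_right L) auto
        moreover have "word u * (\<Sum>(c, a, b)\<leftarrow>L. monomial [a, b] c) * word v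
            \<in> pbw_span N q (\<lambda>x. expo_height N x \<le> h)"
          using L'
        proof (induction L)
          case (Cons l L)
          obtain c a b where l: "l = (c, a, b)" by (cases l) auto
          have ab: "a \<in> gens N" "b \<in> gens N" "lower_pair x y a b" using Cons.prems l by auto
          have "monomial (u @ [a, b] @ v) c \<in> pbw_span N q (\<lambda>x. expo_height N x \<le> h)"
          proof (cases "zero_gen a \<or> zero_gen b")
            case True
            then show ?thesis using ab gens by (intro pbw_span.rel zero_word_rel_ideal) auto
          next
            case False
            then have "gen_height a + gen_height b < gen_height x + gen_height y
                \<or> gen_height a + gen_height b = gen_height x + gen_height y \<and> gen_rank a < gen_rank x"
              using ab by (auto simp: lower_pair_def)
            then have "(u @ [a, b] @ v, w) \<in> R" "word_height (u @ [a, b] @ v) \<le> h"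
              using less.prems(2) w by (auto simp: R_def intro!: lex_append_leftI)
            then have "word (u @ [a, b] @ v) \<in> pbw_span N q (\<lambda>x. expo_height N x \<le> h)"
              using ab gens by (intro less.IH) auto
            from pbw_span_scale[OF this, of c] show ?thesis by (simp add: const_mult_single)
          qed
          then show ?case using Cons
            by (simp add: l distrib_left distrib_right single_mult_single pbw_span_add)
        qed simp
        ultimately show ?thesis unfolding w by (auto simp: single_mult_single intro: pbw_span_req)
      qed
    qed
  qed
qed

section \<open>Leading terms\<close>

lemma deg_less_irrefl: "\<not> deg_less m m"
  by (simp add: deg_less_def lexl_not_refl irrefl_def)

lemma deg_less_trans: "deg_less m m' \<Longrightarrow> deg_less m' m'' \<Longrightarrow> deg_less m m''"
  unfolding deg_less_def lexord_lex by (auto intro: lexord_trans simp: trans_less_than)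

lemma deg_le_less_trans: "deg_le m m' \<Longrightarrow> deg_less m' m'' \<Longrightarrow> deg_less m m''"
  unfolding deg_le_def by (auto intro: deg_less_trans)

lemma deg_less_linear:
  assumes "m \<in> degs N" "m' \<in> degs N"
  shows "deg_less m m' \<or> m = m' \<or> deg_less m' m"
proof -
  have "(rev m, rev m') \<in> lexord less_than \<or> rev m = rev m' \<or> (rev m', rev m) \<in> lexord less_than"
    using total_lexord[OF total_less_than] unfolding total_on_def by blast
  then show ?thesis using assms by (auto simp: deg_less_def lexord_lex degs_def)
qed

lemma deg_le_iff_not_less: "m \<in> degs N \<Longrightarrow> m' \<in> degs N \<Longrightarrow> deg_le m m' \<longleftrightarrow> \<not> deg_less m' m"
  using deg_less_linear deg_less_trans deg_less_irrefl unfolding deg_le_def by blast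

lemma ex_min_deg:
  assumes "A \<subseteq> degs N" "m \<in> A"
  shows "\<exists>m0\<in>A. \<forall>m'\<in>A. deg_le m0 m'"
proof -
  have "wf (inv_image (lex less_than) (rev :: nat list \<Rightarrow> nat list))"
    by (intro wf_inv_image wf_lex wf_less_than)
  from wfE_min[OF this assms(2)] obtain m0 where "m0 \<in> A" "\<And>m'. deg_less m' m0 \<Longrightarrow> m' \<notin> A"
    unfolding deg_less_def in_inv_image by blast
  then show ?thesis using assms(1) deg_le_iff_not_less by (intro bexI[of _ m0] ballI) blast+
qed

lemma total_degree_degs: "x \<in> expos N \<Longrightarrow> total_degree N x \<in> degs N"
  by (auto simp: expos_def total_degree_def degs_def)

lemma pbw_word_gens:
  fixes q :: complex
  assumes "q - inverse q \<noteq> 0" "x \<in> expos N" shows "set (pbw_word N x) \<subseteq> gens N"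
  using pbw_monom_represents[OF assms] by (simp add: represents_def)

lemma pbw_span_falg_on:
  assumes "q - inverse q \<noteq> 0" shows "p \<in> pbw_span N q P \<Longrightarrow> p \<in> falg_on N"
  by (induction rule: pbw_span.induct) (auto intro!: falg_on_add simp: pbw_word_gens[OF assms])

text \<open>Ordered monomials and their words differ by the nonzero factors \<open>\<kappa>\<close>,
  so both have the same spans. From here on the filtration is handled through
  \<open>pbw_span\<close>.\<close>

lemma DCK_filtration_eq:
  assumes h: "q - inverse q \<noteq> 0"
  shows "DCK_filtration N q m = proj N q ` pbw_span N q (\<lambda>x. deg_le (total_degree N x) m)"
    (is "_ = proj N q ` ?S")
proof -
  have "\<forall>x\<in>expos N. \<exists>c. c \<noteq> 0 \<and> pbw_monom N q x = proj N q (monomial (pbw_word N x) c)"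
    using pbw_monom_represents[OF h] by (auto simp: represents_def)
  then obtain \<kappa> where \<kappa>: "\<And>x. x \<in> expos N \<Longrightarrow> \<kappa> x \<noteq> 0 \<and> pbw_monom N q x = proj N q (monomial (pbw_word N x) (\<kappa> x))"
    by metis
  have finsum: "finsum (Uq N q) (\<lambda>x. smul N q (c x) (pbw_monom N q x)) A
      = proj N q (\<Sum>x\<in>A. monomial (pbw_word N x) (c x * \<kappa> x))"
    if "finite A" "A \<subseteq> expos N" for c A
  proof -
    interpret ring "Uq N q" by (rule ring_Uq)
    have "finsum (Uq N q) (\<lambda>x. smul N q (c x) (pbw_monom N q x)) A
      = finsum (Uq N q) (\<lambda>x. proj N q (monomial (pbw_word N x) (c x * \<kappa> x))) A"
      using that \<kappa> pbw_word_gens[OF h]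
      by (intro finsum_cong') (auto simp: smul_proj const_mult_single subset_eq intro!: proj_closed)
    also have "\<dots> = proj N q (\<Sum>x\<in>A. monomial (pbw_word N x) (c x * \<kappa> x))"
      using that(1) pbw_word_gens[OF h subsetD[OF that(2)]] by (intro finsum_proj) simp_all
    finally show ?thesis .
  qed
  show ?thesis
  proof (intro Set.equalityI subsetI)
    fix u assume "u \<in> DCK_filtration N q m"
    then obtain c A where A: "finite A" "A \<subseteq> {x \<in> expos N. deg_le (total_degree N x) m}"
      and u: "u = finsum (Uq N q) (\<lambda>x. smul N q (c x) (pbw_monom N q x)) A"
      unfolding DCK_filtration_def by blast
    have "monomial (pbw_word N x) (c x * \<kappa> x) \<in> ?S" if "x \<in> A" for x
      using A that by (intro pbw_span_wprop) auto
    then have "(\<Sum>x\<in>A. monomial (pbw_word N x) (c x * \<kappa> x)) \<in> ?S"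
      by (rule pbw_span_sum)
    moreover have "u = proj N q (\<Sum>x\<in>A. monomial (pbw_word N x) (c x * \<kappa> x))"
      unfolding u using A by (intro finsum) auto
    ultimately show "u \<in> proj N q ` ?S" by blast
  next
    fix u assume "u \<in> proj N q ` ?S"
    then obtain p where p: "p \<in> ?S" "u = proj N q p" by blast
    from p(1) have "\<exists>c A. finite A \<and> A \<subseteq> {x \<in> expos N. deg_le (total_degree N x) m}
        \<and> req N q p (\<Sum>x\<in>A. monomial (pbw_word N x) (c x * \<kappa> x))"
    proof (induction rule: pbw_span.induct)
      case (rel p)
      then show ?case by (intro exI[of _ "\<lambda>_. 0"] exI[of _ "{}"]) (simp add: req_0_iff)
    next
      case (add_monom p x d)
      then obtain c A where A: "finite A" "A \<subseteq> {x \<in> expos N. deg_le (total_degree N x) m}"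
        and p: "req N q p (\<Sum>x\<in>A. monomial (pbw_word N x) (c x * \<kappa> x))" by blast
      \<comment> \<open>The new exponent \<open>x\<close> may or may not lie in \<open>A\<close>
        already. Extending \<open>c\<close> by zero treats both cases alike, and dividing by
        \<open>\<kappa> x\<close> turns a coefficient of the word into one of the monomial.\<close>
      define c' where "c' = (\<lambda>y. if y \<in> A then c y else 0)"
      define c'' where "c'' = c'(x := c' x + d / \<kappa> x)"
      have "(\<Sum>y\<in>insert x A. monomial (pbw_word N y) (c'' y * \<kappa> y))
          = (\<Sum>y\<in>insert x A. monomial (pbw_word N y) (c' y * \<kappa> y)
              + (if y = x then monomial (pbw_word N x) d else 0))"
        using \<kappa>[OF add_monom(2)]
        by (intro sum.cong refl) (auto simp: c''_def single_add[symmetric] distrib_right)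
      also have "\<dots> = (\<Sum>y\<in>insert x A. monomial (pbw_word N y) (c' y * \<kappa> y)) + monomial (pbw_word N x) d"
        using A by (simp add: sum.distrib)
      also have "(\<Sum>y\<in>insert x A. monomial (pbw_word N y) (c' y * \<kappa> y)) = (\<Sum>y\<in>A. monomial (pbw_word N y) (c y * \<kappa> y))"
        using A by (intro sum.mono_neutral_cong_right) (auto simp: c'_def)
      finally have "req N q (p + monomial (pbw_word N x) d) (\<Sum>y\<in>insert x A. monomial (pbw_word N y) (c'' y * \<kappa> y))"
        using req_add[OF p req_refl] by simp
      then show ?case using A add_monom by (intro exI[of _ c''] exI[of _ "insert x A"]) auto
    qed
    then obtain c A where A: "finite A" "A \<subseteq> {x \<in> expos N. deg_le (total_degree N x) m}"
        and pA: "req N q p (\<Sum>x\<in>A. monomial (pbw_word N x) (c x * \<kappa> x))" by blast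
    have "u = proj N q (\<Sum>x\<in>A. monomial (pbw_word N x) (c x * \<kappa> x))"
      unfolding p(2) using pA A pbw_span_falg_on[OF h p(1)] pbw_word_gens[OF h] unfolding req_def
      by (subst proj_eq_iff) (auto intro!: falg_on_sum)
    also have "\<dots> = finsum (Uq N q) (\<lambda>x. smul N q (c x) (pbw_monom N q x)) A"
      using A by (intro finsum[symmetric]) auto
    finally show "u \<in> DCK_filtration N q m"
      unfolding DCK_filtration_def using A by blast
  qed
qed

lemma proj_in_DCK_filtration_iff:
  assumes "q - inverse q \<noteq> 0" "p \<in> falg_on N"
  shows "proj N q p \<in> DCK_filtration N q m \<longleftrightarrow> p \<in> pbw_span N q (\<lambda>x. deg_le (total_degree N x) m)"
proof
  assume "proj N q p \<in> DCK_filtration N q m"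
  then obtain p' where p': "p' \<in> pbw_span N q (\<lambda>x. deg_le (total_degree N x) m)" "proj N q p = proj N q p'"
    unfolding DCK_filtration_eq[OF assms(1)] by blast
  then have "req N q p p'"
    using proj_eq_iff[OF assms(2) pbw_span_falg_on[OF assms(1) p'(1)]] by (simp add: req_def)
  with p' show "p \<in> pbw_span N q (\<lambda>x. deg_le (total_degree N x) m)" by (blast intro: pbw_span_req)
qed (auto simp: DCK_filtration_eq[OF assms(1)])

lemma deg_eqI:
  assumes "m \<in> degs N" "u \<in> DCK_filtration N q m"
    "\<And>m'. m' \<in> degs N \<Longrightarrow> u \<in> DCK_filtration N q m' \<Longrightarrow> deg_le m m'"
  shows "deg N q u = m"
  unfolding deg_def
proof (rule the_equality)
  fix m1 assume m1: "m1 \<in> degs N \<and> u \<in> DCK_filtration N q m1 \<and>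
     (\<forall>m'\<in>degs N. u \<in> DCK_filtration N q m' \<longrightarrow> deg_le m1 m')"
  then have "deg_le m1 m" "deg_le m m1" using assms by blast+
  then show "m1 = m" unfolding deg_le_def using deg_less_trans deg_less_irrefl by blast
qed (use assms in blast)

lemma deg_less_if_DCK_filtration:
  assumes "m \<in> degs N" "u \<in> DCK_filtration N q m" "deg_less m m'"
  shows "deg_less (deg N q u) m'"
proof -
  obtain m0 where m0: "m0 \<in> degs N" "u \<in> DCK_filtration N q m0"
    "\<And>m'. m' \<in> degs N \<Longrightarrow> u \<in> DCK_filtration N q m' \<Longrightarrow> deg_le m0 m'"
    using ex_min_deg[of "{m \<in> degs N. u \<in> DCK_filtration N q m}" N m] assms by auto
  then have "deg N q u = m0" by (intro deg_eqI)
  with m0 assms show ?thesis by (blast intro: deg_le_less_trans)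
qed

text \<open>In the lexicographic order \<open>m\<close> need not have an immediate predecessor, so
  the span of everything below \<open>m\<close> need not be a single step of the filtration. A given
  element involves finitely many monomials, however, and the largest of their degrees serves as
  \<open>m'\<close>. Elements of the ideal are listed apart, since there may be no degree below
  \<open>m\<close> at all.\<close>

lemma pbw_span_deg_less_cases:
  assumes "p \<in> pbw_span N q (\<lambda>x. deg_less (total_degree N x) m)"
  shows "p \<in> rel_ideal N q \<or> (\<exists>m'\<in>degs N. deg_less m' m \<and> p \<in> pbw_span N q (\<lambda>x. deg_le (total_degree N x) m'))"
  using assms
proof (induction rule: pbw_span.induct)
  case (add_monom p x c)
  let ?d = "total_degree N x"
  have d: "?d \<in> degs N" using add_monom by (intro total_degree_degs)
  have "\<exists>m'\<in>degs N. deg_less m' m \<and> deg_le ?d m' \<and> p \<in> pbw_span N q (\<lambda>x. deg_le (total_degree N x) m')"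
    using add_monom(4)
  proof
    assume "p \<in> rel_ideal N q"
    then show ?thesis using d add_monom(3) by (intro bexI[of _ ?d]) (auto simp: deg_le_def intro: pbw_span.rel)
  next
    assume "\<exists>m'\<in>degs N. deg_less m' m \<and> p \<in> pbw_span N q (\<lambda>x. deg_le (total_degree N x) m')"
    then obtain m' where m': "m' \<in> degs N" "deg_less m' m" "p \<in> pbw_span N q (\<lambda>x. deg_le (total_degree N x) m')" by blast
    show ?thesis
    proof (cases "deg_le ?d m'")
      case True
      with m' show ?thesis by blast
    next
      case False
      then have "deg_less m' ?d" using deg_le_iff_not_less[OF d m'(1)] by blast
      then have "p \<in> pbw_span N q (\<lambda>x. deg_le (total_degree N x) ?d)"
        by (intro pbw_span_mono[OF m'(3)]) (auto simp: deg_le_def intro: deg_less_trans)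
      then show ?thesis using d add_monom(3) by (intro bexI[of _ ?d]) (auto simp: deg_le_def)
    qed
  qed
  then show ?case using add_monom(2) by (auto intro: pbw_span.add_monom)
qed simp

text \<open>The elements with lower terms only form a subspace. The assumption \<open>indep\<close>
  keeps \<open>p'\<close> out of it, hence also \<open>p\<close>, which differs from
  \<open>p'\<close> by an element of it. Any filtration step below the degree of \<open>x\<close> is
  contained in this subspace, so both elements have exactly that degree.\<close>

lemma has_lt_proj:
  assumes h: "q - inverse q \<noteq> 0" and p: "p \<in> falg_on N" "p' \<in> falg_on N"
    and x: "x \<in> expos N" and p': "req N q p' (monomial (pbw_word N x) c)" "c \<noteq> 0"
    and diff: "p - p' \<in> pbw_span N q (\<lambda>y. deg_less (total_degree N y) (total_degree N x))"
    and indep: "word (pbw_word N x) \<notin> pbw_span N q (\<lambda>y. deg_less (total_degree N y) (total_degree N x))"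
  shows "has_lt N q (proj N q p) (proj N q p')"
proof -
  let ?m = "total_degree N x"
  let ?D = "pbw_span N q (\<lambda>y. deg_less (total_degree N y) ?m)"
  have m: "?m \<in> degs N" using x by (rule total_degree_degs)
  have p'D: "p' \<notin> ?D"
  proof
    assume "p' \<in> ?D"
    then have "const (inverse c) * monomial (pbw_word N x) c \<in> ?D"
      using req_sym[OF p'(1)] by (intro pbw_span_scale) (rule pbw_span_req)
    with indep show False using p'(2) by (simp add: const_mult_single)
  qed
  have pD: "p \<notin> ?D"
  proof
    assume "p \<in> ?D"
    moreover have "const (- 1) * (p - p') \<in> ?D" by (rule pbw_span_scale[OF diff])
    ultimately have "p + const (- 1) * (p - p') \<in> ?D" by (intro pbw_span_add)
    moreover have "const (- 1) = -1"
      by (metis const_def one_eq_word single_uminus)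
    ultimately show False using p'D by simp
  qed
  have p'S: "p' \<in> pbw_span N q (\<lambda>y. deg_le (total_degree N y) ?m)"
    using pbw_span_wprop[of N q "pbw_word N x" x "\<lambda>y. deg_le (total_degree N y) ?m" c] x
    by (intro pbw_span_req[OF p'(1)]) (auto simp: deg_le_def)
  moreover have "p - p' \<in> pbw_span N q (\<lambda>y. deg_le (total_degree N y) ?m)"
    by (rule pbw_span_mono[OF diff]) (simp add: deg_le_def)
  ultimately have pS: "p \<in> pbw_span N q (\<lambda>y. deg_le (total_degree N y) ?m)"
    using pbw_span_add[of "p - p'" N q _ p'] by simp
  have deg: "deg N q (proj N q r) = ?m"
    if "r \<in> falg_on N" "r \<notin> ?D" "r \<in> pbw_span N q (\<lambda>y. deg_le (total_degree N y) ?m)" for r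
  proof (rule deg_eqI[OF m])
    show "proj N q r \<in> DCK_filtration N q ?m"
      using that proj_in_DCK_filtration_iff[OF h] by blast
    fix m' assume m': "m' \<in> degs N" "proj N q r \<in> DCK_filtration N q m'"
    then have "r \<in> pbw_span N q (\<lambda>y. deg_le (total_degree N y) m')"
      using that proj_in_DCK_filtration_iff[OF h] by blast
    then have "\<not> deg_less m' ?m"
      using that(2) pbw_span_mono[of r N q _ "\<lambda>y. deg_less (total_degree N y) ?m"] deg_le_less_trans[of _ m' ?m] by metis
    then show "deg_le ?m m'" using m m' deg_le_iff_not_less by blast
  qed
  have nz: "proj N q r \<noteq> \<zero>\<^bsub>Uq N q\<^esub>" if r: "r \<in> falg_on N" "r \<notin> ?D" for r
  proof
    assume "proj N q r = \<zero>\<^bsub>Uq N q\<^esub>"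
    then have "r - 0 \<in> rel_ideal N q" unfolding proj_0[symmetric] using proj_eq_iff[OF r(1) falg_on_0] by blast
    then show False using r(2) pbw_span.rel[of r N q] by simp
  qed
  have "proj N q p = proj N q p' \<or> deg_less (deg N q (proj N q p \<ominus>\<^bsub>Uq N q\<^esub> proj N q p')) ?m"
    using pbw_span_deg_less_cases[OF diff]
  proof
    assume "p - p' \<in> rel_ideal N q"
    then show ?thesis using proj_eq_iff[OF p] by blast
  next
    assume "\<exists>m'\<in>degs N. deg_less m' ?m \<and> p - p' \<in> pbw_span N q (\<lambda>y. deg_le (total_degree N y) m')"
    then obtain m' where m': "m' \<in> degs N" "deg_less m' ?m" "p - p' \<in> pbw_span N q (\<lambda>y. deg_le (total_degree N y) m')" by blast
    then have "proj N q (p - p') \<in> DCK_filtration N q m'"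
      using proj_in_DCK_filtration_iff[OF h falg_on_diff[OF p]] by blast
    then show ?thesis using deg_less_if_DCK_filtration m' by (simp add: proj_diff[OF p])
  qed
  then show ?thesis
    unfolding has_lt_def using deg[OF p(1) pD pS] deg[OF p(2) p'D p'S] nz p pD p'D by simp
qed

section \<open>Nonzero matrix entries on tensor powers\<close>

text \<open>The possible nonzero matrix entries of \<open>t\<^sub>j\<^sub>i\<close> and \<open>tbar\<^sub>i\<^sub>j\<close> on a tensor power: the indices
  \<open>j = k\<^sub>0, k\<^sub>1, \<dots>, k\<^sub>m = i\<close> of the iterated coproduct change at a slot exactly when that
  slot is moved from \<open>k\<^sub>l\<close> to \<open>k\<^sub>l\<^sub>-\<^sub>1\<close>. The row index comes first.\<close>

fun F_step :: "nat \<Rightarrow> nat list \<Rightarrow> nat list \<Rightarrow> nat \<Rightarrow> bool" where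
  "F_step j [] [] i \<longleftrightarrow> j = i"
| "F_step j (x # xs) (y # ys) i \<longleftrightarrow> x = y \<and> F_step j xs ys i \<or> x = j \<and> y < j \<and> F_step y xs ys i"
| "F_step j _ _ i \<longleftrightarrow> False"

fun E_step :: "nat \<Rightarrow> nat list \<Rightarrow> nat list \<Rightarrow> nat \<Rightarrow> bool" where
  "E_step i [] [] j \<longleftrightarrow> i = j"
| "E_step i (x # xs) (y # ys) j \<longleftrightarrow> x = y \<and> E_step i xs ys j \<or> x = i \<and> i < y \<and> E_step y xs ys j"
| "E_step i _ _ j \<longleftrightarrow> False"

fun step :: "gen \<Rightarrow> nat list \<Rightarrow> nat list \<Rightarrow> bool" where
  "step (T j i) xs ys \<longleftrightarrow> F_step j xs ys i"
| "step (Tbar i j) xs ys \<longleftrightarrow> E_step i xs ys j"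

text \<open>The support of the matrix entries of a word with all coefficients forgotten: a nonzero
  entry requires such a path. Vanishing statements become combinatorial in this way.\<close>

fun reach :: "gen list \<Rightarrow> nat list \<Rightarrow> nat list \<Rightarrow> bool" where
  "reach [] xs ys \<longleftrightarrow> xs = ys"
| "reach (g # w) xs ys \<longleftrightarrow> (\<exists>zs. step g xs zs \<and> reach w zs ys)"

lemma F_step_if_trep: "trep N q T j i xs ys \<noteq> 0 \<Longrightarrow> F_step j xs ys i"
proof (induction j xs ys i rule: F_step.induct)
  case (2 j x xs y ys i)
  then obtain k where "vrep q (T j k) x y * trep N q T k i xs ys \<noteq> 0"
    by (auto elim: sum.not_neutral_contains_not_neutral)
  then show ?case using 2 by (auto split: if_splits)
qed auto

lemma E_step_if_trep: "trep N q Tbar i j xs ys \<noteq> 0 \<Longrightarrow> E_step i xs ys j"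
proof (induction i xs ys j rule: E_step.induct)
  case (2 i x xs y ys j)
  then obtain k where "vrep q (Tbar i k) x y * trep N q Tbar k j xs ys \<noteq> 0"
    by (auto elim: sum.not_neutral_contains_not_neutral)
  then show ?case using 2 by (auto split: if_splits)
qed auto

lemma step_if_gen_rep: "gen_rep N q g xs ys \<noteq> 0 \<Longrightarrow> step g xs ys"
  by (cases g) (auto intro: F_step_if_trep E_step_if_trep)

lemma reach_if_word_rep: "word_rep N q m w xs ys \<noteq> 0 \<Longrightarrow> reach w xs ys"
proof (induction w arbitrary: xs)
  case (Cons g w)
  then obtain zs where "gen_rep N q g xs zs * word_rep N q m w zs ys \<noteq> 0"
    by (auto simp: matmul_def elim: sum.not_neutral_contains_not_neutral)
  then show ?case using Cons.IH[of zs] step_if_gen_rep[of N q g xs zs] by auto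
qed (auto split: if_splits)

lemma reach_append: "reach (u @ v) xs ys \<longleftrightarrow> (\<exists>zs. reach u xs zs \<and> reach v zs ys)"
  by (induction u arbitrary: xs) auto

text \<open>The changes of the slots telescope along the chain of coproduct indices from
  \<open>j\<close> down to \<open>i\<close>.\<close>

lemma F_step_sum:
  "F_step j xs ys i \<Longrightarrow> length xs = length ys \<and> i \<le> j \<and> sum_list xs + i = sum_list ys + j \<and> (i = j \<longrightarrow> xs = ys)"
  by (induction j xs ys i rule: F_step.induct) fastforce+

lemma E_step_sum:
  "E_step i xs ys j \<Longrightarrow> length xs = length ys \<and> i \<le> j \<and> sum_list xs + j = sum_list ys + i \<and> (i = j \<longrightarrow> xs = ys)"
  by (induction i xs ys j rule: E_step.induct) fastforce+

lemma F_step_append: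
  "length x1 = length y1 \<Longrightarrow> F_step j (x1 @ x2) (y1 @ y2) i \<longleftrightarrow> (\<exists>k. F_step j x1 y1 k \<and> F_step k x2 y2 i)"
  by (induction x1 y1 arbitrary: j rule: list_induct2) auto

lemma E_step_append:
  "length x1 = length y1 \<Longrightarrow> E_step i (x1 @ x2) (y1 @ y2) j \<longleftrightarrow> (\<exists>k. E_step i x1 y1 k \<and> E_step k x2 y2 j)"
  by (induction x1 y1 arbitrary: i rule: list_induct2) auto

lemma step_length: "step g xs ys \<Longrightarrow> length xs = length ys"
  by (cases g) (auto dest: F_step_sum E_step_sum)

fun is_F :: "gen \<Rightarrow> bool" where "is_F (T j i) \<longleftrightarrow> i < j" | "is_F (Tbar i j) \<longleftrightarrow> False"
fun is_E :: "gen \<Rightarrow> bool" where "is_E (T j i) \<longleftrightarrow> False" | "is_E (Tbar i j) \<longleftrightarrow> i < j"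

section \<open>Splitting a path over two blocks of slots\<close>

definition potential :: "nat list \<Rightarrow> nat list \<Rightarrow> int" where
  "potential x1 x2 = int (sum_list x1) - int (sum_list x2)"

text \<open>Between the two basis vectors used below the potential differs by the largest possible height,
  so every letter has to attain this bound: \<open>F\<close> only moves the left block, \<open>E\<close> only the right one.\<close>

lemma step_potential:
  assumes "step g (x1 @ x2) (z1 @ z2)" "length x1 = length z1"
  shows "potential x1 x2 - potential z1 z2 \<le> int (gen_height g)"
    and "potential x1 x2 - potential z1 z2 = int (gen_height g) \<Longrightarrow>
      (if is_F g then step g x1 z1 else x1 = z1) \<and> (if is_E g then step g x2 z2 else x2 = z2)"
proof -
  have "potential x1 x2 - potential z1 z2 \<le> int (gen_height g) \<and>
    (potential x1 x2 - potential z1 z2 = int (gen_height g) \<longrightarrow>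
      (if is_F g then step g x1 z1 else x1 = z1) \<and> (if is_E g then step g x2 z2 else x2 = z2))"
  proof (cases g)
    case (T j i)
    then obtain k where k: "F_step j x1 z1 k" "F_step k x2 z2 i"
      using assms by (auto simp: F_step_append)
    note * = F_step_sum[OF k(1)] F_step_sum[OF k(2)]
    \<comment> \<open>The chain passes from the left block to the right one at index
      \<open>k\<close>. Its part from \<open>k\<close> to \<open>i\<close> lowers the right block
      and so counts with the wrong sign, which costs \<open>2 * (k - i)\<close>.\<close>
    have eq: "potential x1 x2 - potential z1 z2 = int (j - i) - 2 * int (k - i)"
      using * by (simp add: potential_def of_nat_diff)
    show ?thesis
    proof (cases "k = i")
      case True
      then show ?thesis using eq T k * by (auto simp: not_less)
    next
      case False
      then have "k > i" using * by auto
      then show ?thesis using eq T by simp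
    qed
  next
    case (Tbar i j)
    then obtain k where k: "E_step i x1 z1 k" "E_step k x2 z2 j"
      using assms by (auto simp: E_step_append)
    note * = E_step_sum[OF k(1)] E_step_sum[OF k(2)]
    have eq: "potential x1 x2 - potential z1 z2 = int (j - i) - 2 * int (k - i)"
      using * by (simp add: potential_def of_nat_diff)
    show ?thesis
    proof (cases "k = i")
      case True
      then show ?thesis using eq Tbar k * by (auto simp: not_less)
    next
      case False
      then have "k > i" using * by auto
      then show ?thesis using eq Tbar by simp
    qed
  qed
  then show "potential x1 x2 - potential z1 z2 \<le> int (gen_height g)"
    and "potential x1 x2 - potential z1 z2 = int (gen_height g) \<Longrightarrow>
      (if is_F g then step g x1 z1 else x1 = z1) \<and> (if is_E g then step g x2 z2 else x2 = z2)"
    by blast+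
qed

text \<open>The bounds of the single steps add up. Equality in total forces equality in every step,
  and the path then falls apart into an F path on the left block and an E path on the right
  block.\<close>

lemma reach_potential:
  assumes "reach w (x1 @ x2) (y1 @ y2)" "length x1 = length y1"
  shows "potential x1 x2 - potential y1 y2 \<le> int (word_height w)"
    and "potential x1 x2 - potential y1 y2 = int (word_height w) \<Longrightarrow>
      reach (filter is_F w) x1 y1 \<and> reach (filter is_E w) x2 y2"
proof -
  have "potential x1 x2 - potential y1 y2 \<le> int (word_height w) \<and>
    (potential x1 x2 - potential y1 y2 = int (word_height w) \<longrightarrow>
      reach (filter is_F w) x1 y1 \<and> reach (filter is_E w) x2 y2)"
    using assms
  proof (induction w arbitrary: x1 x2)
    case (Cons g w)
    then obtain zs where zs: "step g (x1 @ x2) zs" "reach w zs (y1 @ y2)" by auto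
    obtain z1 z2 where z: "zs = z1 @ z2" "length z1 = length x1"
      using step_length[OF zs(1)] by (metis append_take_drop_id length_append length_take min.absorb2 le_add1)
    have IH: "potential z1 z2 - potential y1 y2 \<le> int (word_height w)"
      "potential z1 z2 - potential y1 y2 = int (word_height w) \<Longrightarrow>
      reach (filter is_F w) z1 y1 \<and> reach (filter is_E w) z2 y2"
      using Cons.IH[of z1 z2] zs z Cons.prems by auto
    note st = step_potential[OF zs(1)[unfolded z(1)] z(2)[symmetric]]
    show ?case
    proof (intro conjI impI)
      show "potential x1 x2 - potential y1 y2 \<le> int (word_height (g # w))" using IH(1) st(1) by simp
      assume "potential x1 x2 - potential y1 y2 = int (word_height (g # w))"
      then have "potential x1 x2 - potential z1 z2 = int (gen_height g)"
        "potential z1 z2 - potential y1 y2 = int (word_height w)" using IH(1) st(1) by auto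
      then have *: "(if is_F g then step g x1 z1 else x1 = z1) \<and> (if is_E g then step g x2 z2 else x2 = z2)"
        and **: "reach (filter is_F w) z1 y1 \<and> reach (filter is_E w) z2 y2"
        using IH(2) st(2) by blast+
      show "reach (filter is_F (g # w)) x1 y1"
        using * ** by (cases "is_F g") auto
      show "reach (filter is_E (g # w)) x2 y2"
        using * ** by (cases "is_E g") auto
    qed
  qed (auto simp: potential_def)
  then show "potential x1 x2 - potential y1 y2 \<le> int (word_height w)"
    and "potential x1 x2 - potential y1 y2 = int (word_height w) \<Longrightarrow>
      reach (filter is_F w) x1 y1 \<and> reach (filter is_E w) x2 y2" by blast+
qed

section \<open>Following the last slot of a path\<close>

lemma F_step_snoc:
  assumes "F_step j (xs @ [x]) zs i"
  shows "\<exists>ys y. zs = ys @ [y] \<and> (x = y \<and> F_step j xs ys i \<or> y = i \<and> i < x \<and> x \<le> j \<and> F_step j xs ys x)"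
proof -
  have len: "length zs = Suc (length xs)" using F_step_sum[OF assms] by simp
  then obtain ys y where zs: "zs = ys @ [y]" by (metis length_Suc_conv_rev)
  then obtain k where k: "F_step j xs ys k" "F_step k [x] [y] i"
    using assms len by (auto simp: F_step_append)
  then show ?thesis using zs F_step_sum[OF k(1)] by auto
qed

lemma E_step_snoc:
  assumes "E_step i (xs @ [x]) zs j"
  shows "\<exists>ys y. zs = ys @ [y] \<and> (x = y \<and> E_step i xs ys j \<or> y = j \<and> i \<le> x \<and> x < j \<and> E_step i xs ys x)"
proof -
  have len: "length zs = Suc (length xs)" using E_step_sum[OF assms] by simp
  then obtain ys y where zs: "zs = ys @ [y]" by (metis length_Suc_conv_rev)
  then obtain k where k: "E_step i xs ys k" "E_step k [x] [y] j"
    using assms len by (auto simp: E_step_append)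
  then show ?thesis using zs E_step_sum[OF k(1)] by auto
qed

lemma step_F_gen: "step (F_gen (i, j)) xs ys \<longleftrightarrow> F_step j xs ys i"
  and step_E_gen: "step (E_gen (i, j)) xs ys \<longleftrightarrow> E_step i xs ys j"
  by (simp_all add: F_gen_def E_gen_def)

lemma reach_F_last_mono: "reach (map F_gen fs) (xs @ [x]) (ys @ [y]) \<Longrightarrow> y \<le> x"
proof (induction fs arbitrary: xs x)
  case (Cons f fs)
  obtain i j where f: "f = (i, j)" by fastforce
  obtain zs where zs: "F_step j (xs @ [x]) zs i" "reach (map F_gen fs) zs (ys @ [y])"
    using Cons.prems by (auto simp: f step_F_gen)
  from F_step_snoc[OF zs(1)] obtain ys' z where z: "zs = ys' @ [z]" "z \<le> x" by fastforce
  from Cons.IH[OF zs(2)[unfolded z(1)]] z(2) show ?case by simp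
qed auto

lemma reach_E_last_mono: "reach (map E_gen es) (xs @ [x]) (ys @ [y]) \<Longrightarrow> x \<le> y"
proof (induction es arbitrary: xs x)
  case (Cons e es)
  obtain i j where e: "e = (i, j)" by fastforce
  obtain zs where zs: "E_step i (xs @ [x]) zs j" "reach (map E_gen es) zs (ys @ [y])"
    using Cons.prems by (auto simp: e step_E_gen)
  from E_step_snoc[OF zs(1)] obtain ys' z where z: "zs = ys' @ [z]" "x \<le> z" by fastforce
  from Cons.IH[OF zs(2)[unfolded z(1)]] z(2) show ?case by simp
qed auto

lemma reach_F_last_fixed: "reach (map F_gen fs) (xs @ [c]) (ys @ [c]) \<Longrightarrow> reach (map F_gen fs) xs ys"
proof (induction fs arbitrary: xs)
  case (Cons f fs)
  obtain i j where f: "f = (i, j)" by fastforce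
  obtain zs where zs: "F_step j (xs @ [c]) zs i" "reach (map F_gen fs) zs (ys @ [c])"
    using Cons.prems by (auto simp: f step_F_gen)
  from F_step_snoc[OF zs(1)] obtain ys' z where z: "zs = ys' @ [z]"
    "c = z \<and> F_step j xs ys' i \<or> z < c" by blast
  have "c \<le> z" using reach_F_last_mono zs(2) z(1) by blast
  with z zs(2) Cons.IH show ?case by (auto simp: f step_F_gen)
qed auto

lemma reach_E_last_fixed: "reach (map E_gen es) (xs @ [c]) (ys @ [c]) \<Longrightarrow> reach (map E_gen es) xs ys"
proof (induction es arbitrary: xs)
  case (Cons e es)
  obtain i j where e: "e = (i, j)" by fastforce
  obtain zs where zs: "E_step i (xs @ [c]) zs j" "reach (map E_gen es) zs (ys @ [c])"
    using Cons.prems by (auto simp: e step_E_gen)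
  from E_step_snoc[OF zs(1)] obtain ys' z where z: "zs = ys' @ [z]"
    "c = z \<and> E_step i xs ys' j \<or> c < z" by blast
  have "z \<le> c" using reach_E_last_mono zs(2) z(1) by blast
  with z zs(2) Cons.IH show ?case by (auto simp: e step_E_gen)
qed auto

text \<open>A root \<open>(i, j)\<close> can move the last slot only if \<open>i\<close> is the content of that slot.\<close>

lemma reach_F_last_less:
  assumes "reach (map F_gen fs) (xs @ [x]) (ys @ [y])" "\<forall>f\<in>set fs. f < (p, p + s)" "p \<le> y" "y < p + s"
  shows "p \<le> x \<and> x < p + s"
  using assms(1,2)
proof (induction fs arbitrary: xs x)
  case (Cons f fs)
  obtain i j where f: "f = (i, j)" by fastforce
  obtain zs where zs: "F_step j (xs @ [x]) zs i" "reach (map F_gen fs) zs (ys @ [y])"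
    using Cons.prems by (auto simp: f step_F_gen)
  from F_step_snoc[OF zs(1)] obtain ys' z where z: "zs = ys' @ [z]"
    "x = z \<or> z = i \<and> i < x \<and> x \<le> j" by blast
  then have "p \<le> z \<and> z < p + s" using Cons.IH[of ys' z] zs(2) Cons.prems by auto
  \<comment> \<open>If the slot is moved, then \<open>z = i\<close> is at least \<open>p\<close>, so
    \<open>(i, j) < (p, p + s)\<close> forces \<open>i = p\<close> and
    \<open>x \<le> j < p + s\<close>.\<close>
  then show ?case using z Cons.prems(2) f by auto
qed (use assms in auto)

text \<open>A root \<open>(i, j)\<close> moving the content \<open>a\<close> has
  \<open>i \<le> a\<close>. Being larger than \<open>(a, b)\<close> it must have
  \<open>i = a\<close> and \<open>b < j\<close>, so the content jumps over \<open>b\<close>, and it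
  never decreases afterwards.\<close>

lemma not_reach_E_last:
  assumes "reach (map E_gen es) (xs @ [a]) (ys @ [y])" "\<forall>e\<in>set es. (a, b) < e"
  shows "y = a \<or> b < y"
  using assms
proof (induction es arbitrary: xs)
  case (Cons e es)
  obtain i j where e: "e = (i, j)" by fastforce
  obtain zs where zs: "E_step i (xs @ [a]) zs j" "reach (map E_gen es) zs (ys @ [y])"
    using Cons.prems by (auto simp: e step_E_gen)
  from E_step_snoc[OF zs(1)] obtain ys' z where z: "zs = ys' @ [z]"
    "a = z \<or> z = j \<and> i \<le> a" by blast
  from z(2) show ?case
  proof
    assume "a = z"
    then show ?thesis using Cons.IH[of ys'] zs(2) z(1) Cons.prems by auto
  next
    assume *: "z = j \<and> i \<le> a"
    then have "b < z" using Cons.prems(2) e by auto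
    moreover have "z \<le> y" using reach_E_last_mono zs(2) z(1) by blast
    ultimately show ?thesis by simp
  qed
qed auto

text \<open>A slot that is moved ends at an index of the chain, and these indices never fall below
  the final index \<open>i\<close>.\<close>

lemma F_step_fixed_left: "F_step j zs xs i \<Longrightarrow> \<forall>x\<in>set xs. x < i \<Longrightarrow> zs = xs"
proof (induction j zs xs i rule: F_step.induct)
  case (2 j x xs y ys i)
  then show ?case using F_step_sum[of y xs ys i] by auto
qed auto

lemma not_reach_F:
  assumes "1 \<le> p" "1 \<le> s" "p \<le> m" "\<forall>f\<in>set fs. f < (p, p + s)"
  shows "\<not> reach (map F_gen (fs @ map (\<lambda>i. (i, i + s)) [Suc p..<Suc m])) (map (\<lambda>i. i + s) [1..<Suc m]) [1..<Suc m]"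
  using assms(3)
proof (induction m rule: dec_induct)
  case base
  show ?case
  proof
    assume "reach (map F_gen (fs @ map (\<lambda>i. (i, i + s)) [Suc p..<Suc p])) (map (\<lambda>i. i + s) [1..<Suc p]) [1..<Suc p]"
    then have "reach (map F_gen fs) (map (\<lambda>i. i + s) [1..<p] @ [p + s]) ([1..<p] @ [p])"
      using assms(1) by simp
    from reach_F_last_less[OF this assms(4)] assms(2) show False by simp
  qed
next
  case (step m)
  show ?case
  proof
    let ?W = "map F_gen (fs @ map (\<lambda>i. (i, i + s)) [Suc p..<Suc m])"
    assume "reach (map F_gen (fs @ map (\<lambda>i. (i, i + s)) [Suc p..<Suc (Suc m)])) (map (\<lambda>i. i + s) [1..<Suc (Suc m)]) [1..<Suc (Suc m)]"
    then have "reach (?W @ [F_gen (Suc m, Suc m + s)]) (map (\<lambda>i. i + s) [1..<Suc m] @ [Suc m + s]) ([1..<Suc m] @ [Suc m])"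
      using step.hyps by (simp add: upt_Suc_append)
    then obtain zs where zs: "reach ?W (map (\<lambda>i. i + s) [1..<Suc m] @ [Suc m + s]) zs"
      "F_step (Suc m + s) zs ([1..<Suc m] @ [Suc m]) (Suc m)"
      unfolding reach_append by (auto simp: step_F_gen simp del: upt_Suc)
    have "length zs = Suc m" using F_step_sum[OF zs(2)] by simp
    then obtain zs' z where z: "zs = zs' @ [z]" "length zs' = m" by (metis length_Suc_conv_rev)
    then obtain k where k: "F_step (Suc m + s) zs' [1..<Suc m] k" "F_step k [z] [Suc m] (Suc m)"
      using zs(2) by (auto simp: F_step_append)
    have "Suc m \<le> k" using F_step_sum[OF k(2)] by simp
    then have "zs' = [1..<Suc m]" by (intro F_step_fixed_left[OF k(1)]) auto
    then have "k = Suc m + s" using F_step_sum[OF k(1)] by simp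
    then have "z = Suc m + s" using k(2) assms(2) by auto
    then have "reach ?W (map (\<lambda>i. i + s) [1..<Suc m] @ [Suc m + s]) ([1..<Suc m] @ [Suc m + s])"
      using zs(1) z \<open>zs' = _\<close> by simp
    then show False using step.IH reach_F_last_fixed by blast
  qed
qed

lemma E_step_fixed_left: "E_step i xs zs k \<Longrightarrow> i \<notin> set xs \<Longrightarrow> zs = xs \<and> k = i"
  by (induction i xs zs k rule: E_step.induct) auto

lemma not_reach_E:
  assumes "1 \<le> n" "a \<le> p" "p \<le> s" "\<forall>e\<in>set es. (p, n + p) < e"
  shows "\<not> reach (map E_gen (map (\<lambda>a. (a, n + a)) [a..<p] @ es)) (rev [a..<Suc s]) (rev [n + a..<Suc (n + s)])"
  using assms(2)
proof (induction a rule: inc_induct)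
  case base
  show ?case
  proof
    assume "reach (map E_gen (map (\<lambda>a. (a, n + a)) [p..<p] @ es)) (rev [p..<Suc s]) (rev [n + p..<Suc (n + s)])"
    then have "reach (map E_gen es) (rev [Suc p..<Suc s] @ [p]) (rev [Suc (n + p)..<Suc (n + s)] @ [n + p])"
      using assms(3) upt_conv_Cons[of p "Suc s"] upt_conv_Cons[of "n + p" "Suc (n + s)"] by (simp del: upt_Suc)
    from not_reach_E_last[OF this assms(4)] assms(1) show False by simp
  qed
next
  case (step a)
  show ?case
  proof
    let ?W = "map E_gen (map (\<lambda>a. (a, n + a)) [Suc a..<p] @ es)"
    let ?x = "rev [Suc a..<Suc s]"
    assume "reach (map E_gen (map (\<lambda>a. (a, n + a)) [a..<p] @ es)) (rev [a..<Suc s]) (rev [n + a..<Suc (n + s)])"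
    then have "reach (E_gen (a, n + a) # ?W) (?x @ [a]) (rev [Suc (n + a)..<Suc (n + s)] @ [n + a])"
      using step.hyps assms(3) upt_conv_Cons[of a "Suc s"] upt_conv_Cons[of "n + a" "Suc (n + s)"] upt_conv_Cons[of a p]
      by (simp del: upt_Suc)
    then obtain zs where zs: "E_step a (?x @ [a]) zs (n + a)" "reach ?W zs (rev [Suc (n + a)..<Suc (n + s)] @ [n + a])"
      by (auto simp: step_E_gen simp del: upt_Suc)
    have "length zs = Suc (length ?x)" using E_step_sum[OF zs(1)] by simp
    then obtain zs' z where z: "zs = zs' @ [z]" "length zs' = length ?x" by (metis length_Suc_conv_rev)
    then obtain k where k: "E_step a ?x zs' k" "E_step k [a] [z] (n + a)"
      using zs(1) by (auto simp: E_step_append)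
    have "zs' = ?x \<and> k = a" by (intro E_step_fixed_left[OF k(1)]) auto
    then have "reach ?W (?x @ [n + a]) (rev [Suc (n + a)..<Suc (n + s)] @ [n + a])"
      using zs(2) z k(2) assms(1) by auto
    then show False using step.IH reach_E_last_fixed by fastforce
  qed
qed

section \<open>The entry of the leading word is nonzero\<close>

lemma trep_T_move:
  assumes "q \<noteq> 0" "q - inverse q \<noteq> 0" "i < j" "{i, j} \<subseteq> {1..N}"
  shows "trep N q T j i (l @ j # r) (l @ i # r) \<noteq> 0"
proof (induction l)
  case Nil
  \<comment> \<open>The coproduct index has to jump from \<open>j\<close> to \<open>i\<close> at
    this slot and is constant on both sides of it; no other chain fits these two indices.\<close>
  have "trep N q T j i (j # r) (i # r) = (\<Sum>k\<in>{i}. vrep q (T j k) j i * trep N q T k i r r)"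
    unfolding trep.simps using assms by (intro sum.mono_neutral_right) auto
  also have "\<dots> = (q - inverse q) * (\<Prod>x\<leftarrow>r. if x = i then q else 1)"
    using assms by (simp add: trep_T_diag)
  also have "\<dots> \<noteq> 0" using assms by (auto simp: prod_list_zero_iff)
  finally show ?case by simp
next
  case (Cons x l)
  have "trep N q T j i (x # l @ j # r) (x # l @ i # r) = (\<Sum>k\<in>{j}. vrep q (T j k) x x * trep N q T k i (l @ j # r) (l @ i # r))"
    unfolding trep.simps using assms by (intro sum.mono_neutral_right) auto
  then show ?case using Cons assms(1) by simp
qed

lemma trep_Tbar_move:
  assumes "q \<noteq> 0" "q - inverse q \<noteq> 0" "i < j" "{i, j} \<subseteq> {1..N}"
  shows "trep N q Tbar i j (l @ i # r) (l @ j # r) \<noteq> 0"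
proof (induction l)
  case Nil
  have "trep N q Tbar i j (i # r) (j # r) = (\<Sum>k\<in>{j}. vrep q (Tbar i k) i j * trep N q Tbar k j r r)"
    unfolding trep.simps using assms by (intro sum.mono_neutral_right) auto
  also have "\<dots> = - (q - inverse q) * (\<Prod>x\<leftarrow>r. if x = j then inverse q else 1)"
    using assms by (simp add: trep_Tbar_diag)
  also have "\<dots> \<noteq> 0" using assms by (auto simp: prod_list_zero_iff)
  finally show ?case by simp
next
  case (Cons x l)
  have "trep N q Tbar i j (x # l @ i # r) (x # l @ j # r) = (\<Sum>k\<in>{i}. vrep q (Tbar i k) x x * trep N q Tbar k j (l @ i # r) (l @ j # r))"
    unfolding trep.simps using assms by (intro sum.mono_neutral_right) auto
  then show ?case using Cons assms(1) by simp
qed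

text \<open>With only one possible intermediate index the sum is a single product of nonzero
  factors, so cancellation is excluded.\<close>

lemma word_rep_Cons_nonzero:
  assumes "zs \<in> tensor_index N m" "gen_rep N q g xs zs \<noteq> 0" "word_rep N q m w zs ys \<noteq> 0"
    and "\<And>z. step g xs z \<Longrightarrow> reach w z ys \<Longrightarrow> z = zs"
  shows "word_rep N q m (g # w) xs ys \<noteq> 0"
proof -
  have "word_rep N q m (g # w) xs ys = (\<Sum>z\<in>{zs}. gen_rep N q g xs z * word_rep N q m w z ys)"
    unfolding word_rep.simps matmul_def using assms(1,4) step_if_gen_rep reach_if_word_rep
    by (intro sum.mono_neutral_right) (auto, blast)
  with assms show ?thesis by simp
qed

lemma reach_Cons_tight:
  assumes "reach w (z1 @ z2) (y1 @ y2)" "step g (x1 @ x2) (z1 @ z2)"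
    "length x1 = length z1" "length z1 = length y1"
    "potential x1 x2 - potential y1 y2 = int (word_height (g # w))"
  shows "(if is_F g then step g x1 z1 else x1 = z1) \<and> (if is_E g then step g x2 z2 else x2 = z2)"
    "reach (filter is_F w) z1 y1" "reach (filter is_E w) z2 y2"
proof -
  have "potential x1 x2 - potential z1 z2 = int (gen_height g)"
    "potential z1 z2 - potential y1 y2 = int (word_height w)"
    using reach_potential(1)[OF assms(1,4)] step_potential(1)[OF assms(2,3)] assms(5) by auto
  then show "(if is_F g then step g x1 z1 else x1 = z1) \<and> (if is_E g then step g x2 z2 else x2 = z2)"
    "reach (filter is_F w) z1 y1" "reach (filter is_E w) z2 y2"
    using reach_potential(2)[OF assms(1,4)] step_potential(2)[OF assms(2,3)] by auto
qed

lemma F_step_fixed_right: "F_step k xs zs i \<Longrightarrow> \<forall>x\<in>set xs. k < x \<Longrightarrow> zs = xs \<and> i = k"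
proof (induction k xs zs i rule: F_step.induct)
  case (2 j x xs y ys i)
  then show ?case by auto
qed auto

lemma F_step_fixed_notin: "F_step j xs zs k \<Longrightarrow> j \<notin> set xs \<Longrightarrow> zs = xs \<and> k = j"
  by (induction j xs zs k rule: F_step.induct) auto

text \<open>The slots of \<open>l\<close> do not contain \<open>j\<close>, and those of
  \<open>r\<close> have contents too large for any index of the chain, so the slot in between must
  make the whole move.\<close>

lemma F_step_unique:
  assumes "F_step j (l @ j # r) zs i" "j \<notin> set l" "\<forall>x\<in>set r. j < x" "i < j"
  shows "zs = l @ i # r"
proof -
  have len: "length zs = length l + Suc (length r)" using F_step_sum[OF assms(1)] by simp
  define l' where "l' = take (length l) zs"
  obtain z r' where r': "drop (length l) zs = z # r'" using len by (cases "drop (length l) zs") auto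
  have zs: "zs = l' @ z # r'" "length l' = length l"
    using append_take_drop_id[of "length l" zs] len unfolding r' l'_def[symmetric] by (simp_all add: l'_def)
  obtain k where k: "F_step j l l' k" "F_step k (j # r) (z # r') i"
    using assms(1) zs by (auto simp: F_step_append simp del: F_step.simps)
  have *: "l' = l" "k = j" using F_step_fixed_notin[OF k(1) assms(2)] by auto
  with k(2) have "j = z \<and> F_step j r r' i \<or> z < j \<and> F_step z r r' i" by auto
  then show ?thesis
  proof
    assume "j = z \<and> F_step j r r' i"
    then show ?thesis using F_step_fixed_right[of j r r' i] assms by auto
  next
    assume "z < j \<and> F_step z r r' i"
    then show ?thesis using F_step_fixed_right[of z r r' i] assms(3) zs * by fastforce
  qed
qed

lemma E_step_mono: "E_step i xs zs j \<Longrightarrow> list_all2 (\<le>) xs zs"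
  by (induction i xs zs j rule: E_step.induct) (auto simp: list_all2_same)

lemma reach_E_mono: "reach (map E_gen es) xs ys \<Longrightarrow> list_all2 (\<le>) xs ys"
proof (induction es arbitrary: xs)
  case (Cons e es)
  then obtain zs where "step (E_gen e) xs zs" "reach (map E_gen es) zs ys" by auto
  moreover from this have "list_all2 (\<le>) xs zs" using E_step_mono by (cases e) (auto simp: step_E_gen)
  ultimately show ?case using Cons.IH[of zs] by (auto simp: list_all2_conv_all_nth) (metis le_trans)
qed (auto simp: list_all2_same)

text \<open>A chain from \<open>i\<close> to \<open>j\<close> could also use slots of
  \<open>r\<close> as intermediate stations. This would raise their contents, but they already have
  the values that the bound on \<open>zs\<close> allows at most.\<close>

lemma E_step_unique:
  assumes "E_step i (l @ i # r) zs j" "i \<notin> set l" "i < j" "list_all2 (\<le>) zs (ys @ y # r)" "length ys = length l"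
  shows "zs = l @ j # r"
proof -
  have len: "length zs = length l + Suc (length r)" using E_step_sum[OF assms(1)] by simp
  define l' where "l' = take (length l) zs"
  obtain z r' where r': "drop (length l) zs = z # r'" using len by (cases "drop (length l) zs") auto
  have zs: "zs = l' @ z # r'" "length l' = length l"
    using append_take_drop_id[of "length l" zs] len unfolding r' l'_def[symmetric] by (simp_all add: l'_def)
  obtain k where k: "E_step i l l' k" "E_step k (i # r) (z # r') j"
    using assms(1) zs by (auto simp: E_step_append simp del: E_step.simps)
  have *: "l' = l" "k = i" using E_step_fixed_left[OF k(1) assms(2)] by auto
  have le: "list_all2 (\<le>) r' r" using assms(4,5) zs by (auto simp: list_all2_append)
  from k(2) * have "i = z \<and> E_step i r r' j \<or> i < z \<and> E_step z r r' j" by auto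
  moreover have "r' = r" if "E_step z' r r' j" for z'
    using E_step_mono[OF that] le by (auto simp: list_all2_conv_all_nth intro!: nth_equalityI order_antisym)
  ultimately have "r' = r" by blast
  with k(2) * have "z = j" using assms(3) by (auto dest: E_step_sum)
  with * zs \<open>r' = r\<close> show ?thesis by simp
qed

lemma map_add_upt_shift: "map ((+) n) [a..<b] = [n + a..<n + b]"
  by (induction b) auto

lemma sum_list_add_const: "sum_list (map ((+) n) xs) = n * length xs + (sum_list xs :: nat)"
  by (induction xs) auto

text \<open>The roots of the leading word from position \<open>a\<close> on. The whole list is the
  case \<open>a = 1\<close>; the other values serve the inductions over suffixes of the
  word.\<close>

definition F_lead :: "nat \<Rightarrow> nat \<Rightarrow> nat \<Rightarrow> (nat \<times> nat) list" where
  "F_lead n s a = map (\<lambda>i. (i, i + s)) [a..<Suc n]"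

definition E_lead :: "nat \<Rightarrow> nat \<Rightarrow> nat \<Rightarrow> (nat \<times> nat) list" where
  "E_lead n s a = map (\<lambda>i. (i, n + i)) [a..<Suc s]"

lemma word_height_gens:
  "word_height (map F_gen fs) = sum_list (map height fs)" "word_height (map E_gen fs) = sum_list (map height fs)"
proof -
  have "gen_height (F_gen f) = height f" "gen_height (E_gen f) = height f" for f
    by (auto simp: F_gen_def E_gen_def height_def split: prod.split)
  then show "word_height (map F_gen fs) = sum_list (map height fs)" "word_height (map E_gen fs) = sum_list (map height fs)"
    by (simp_all add: word_height_def comp_def)
qed

lemma sum_height_lead:
  "sum_list (map height (F_lead n s a)) = s * (Suc n - a)" "sum_list (map height (E_lead n s a)) = n * (Suc s - a)"
  by (simp_all add: F_lead_def E_lead_def height_def comp_def sum_list_triv del: upt_Suc)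

lemma filter_gens:
  "filter is_E (map E_gen es) = map E_gen (filter (\<lambda>(i, j). i < j) es)" "filter is_F (map E_gen es) = []"
  "filter is_F (map F_gen es) = map F_gen (filter (\<lambda>(i, j). i < j) es)" "filter is_E (map F_gen es) = []"
  by (induction es) (auto simp: E_gen_def F_gen_def)

text \<open>The row index is what the letters before position \<open>a\<close> leave behind: the
  slots with contents below \<open>a\<close> have been raised by \<open>n\<close>. The next letter
  has a single possible effect, because the potential confines it to the right block and
  \<open>E_step_unique\<close> determines it there.\<close>

lemma word_rep_E_lead:
  assumes q: "q \<noteq> 0" "q - inverse q \<noteq> 0" and n: "1 \<le> n" "n + s \<le> N" and a: "1 \<le> a" "a \<le> Suc s"
  shows "word_rep N q (n + s) (map E_gen (E_lead n s a))
    ([1..<Suc n] @ rev [a..<Suc s] @ map ((+) n) (rev [1..<a])) ([1..<Suc n] @ map ((+) n) (rev [1..<Suc s])) \<noteq> 0"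
  using a(2,1)
proof (induction a rule: inc_induct)
  case base
  show ?case by (simp add: E_lead_def)
next
  case (step a)
  let ?l = "rev [Suc a..<Suc s]" and ?r = "map ((+) n) (rev [1..<a])"
  let ?y2 = "map ((+) n) (rev [1..<Suc s])" and ?w = "map E_gen (E_lead n s (Suc a))"
  let ?g = "E_gen (a, n + a)"
  have x: "rev [a..<Suc s] @ ?r = ?l @ a # ?r" using step.hyps upt_conv_Cons[of a "Suc s"] by (simp del: upt_Suc)
  have z: "rev [Suc a..<Suc s] @ map ((+) n) (rev [1..<Suc a]) = ?l @ (n + a) # ?r" using step.prems by simp
  have w: "map E_gen (E_lead n s a) = ?g # ?w" using step.hyps upt_conv_Cons[of a "Suc s"] by (simp add: E_lead_def del: upt_Suc)
  have "word_rep N q (n + s) (?g # ?w) ([1..<Suc n] @ ?l @ a # ?r) ([1..<Suc n] @ ?y2) \<noteq> 0"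
  proof (rule word_rep_Cons_nonzero)
    show "[1..<Suc n] @ ?l @ (n + a) # ?r \<in> tensor_index N (n + s)"
      using step.hyps step.prems n by (auto simp: tensor_index_def simp del: upt_Suc)
    show "gen_rep N q ?g ([1..<Suc n] @ ?l @ a # ?r) ([1..<Suc n] @ ?l @ (n + a) # ?r) \<noteq> 0"
      using trep_Tbar_move[OF q, of a "n + a" N "[1..<Suc n] @ ?l" ?r] step.hyps step.prems n
      by (simp add: E_gen_def del: upt_Suc)
    show "word_rep N q (n + s) ?w ([1..<Suc n] @ ?l @ (n + a) # ?r) ([1..<Suc n] @ ?y2) \<noteq> 0"
      using step.IH step.prems unfolding z by simp
    fix zs assume zs: "step ?g ([1..<Suc n] @ ?l @ a # ?r) zs" "reach ?w zs ([1..<Suc n] @ ?y2)"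
    obtain z1 z2 where z12: "zs = z1 @ z2" "length z1 = n"
      using step_length[OF zs(1)] by (metis append_take_drop_id diff_Suc_1 length_append length_take length_upt min.absorb2 le_add1)
    have "[1..<Suc s] = [1..<a] @ a # [Suc a..<Suc s]"
      using step.hyps step.prems upt_add_eq_append[of 1 a "Suc s - a"] upt_conv_Cons[of a "Suc s"] by (simp del: upt_Suc)
    then have s: "sum_list [1..<Suc s] = sum_list [1..<a] + a + sum_list [Suc a..<Suc s]" by (simp del: upt_Suc)
    have x: "sum_list (?l @ a # ?r) = sum_list [Suc a..<Suc s] + (a + (n * (a - 1) + sum_list [1..<a]))"
      by (simp add: sum_list_add_const sum_list_rev del: upt_Suc)
    have h: "word_height (?g # ?w) = n * (Suc s - a)"
      unfolding w[symmetric] word_height_gens sum_height_lead ..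
    have y2: "sum_list ?y2 = n * (a - 1) + n * (Suc s - a) + (sum_list [1..<a] + a + sum_list [Suc a..<Suc s])"
      unfolding sum_list_add_const sum_list_rev s using step.hyps step.prems
      by (simp add: distrib_left[symmetric] del: upt_Suc)
    \<comment> \<open>The height of the remaining letters is exactly the potential that remains to
      be lost, so this step is tight.\<close>
    have P: "potential [1..<Suc n] (?l @ a # ?r) - potential [1..<Suc n] ?y2 = int (word_height (?g # ?w))"
      unfolding potential_def x h y2 by (simp del: upt_Suc)
    have len: "length [1..<Suc n] = length z1" "length z1 = length [1..<Suc n]" using z12 by auto
    note tight = reach_Cons_tight[OF zs(2)[unfolded z12(1)] zs(1)[unfolded z12(1)] len P]
    have "is_E ?g" "\<not> is_F ?g" using n by (auto simp: E_gen_def)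
    then have z1: "z1 = [1..<Suc n]" and st: "E_step a (?l @ a # ?r) z2 (n + a)"
      using tight(1) by (auto simp: step_E_gen simp del: upt_Suc)
    have "list_all2 (\<le>) z2 ?y2" using tight(3) reach_E_mono unfolding filter_gens by blast
    moreover have "?y2 = map ((+) n) (rev [Suc a..<Suc s]) @ (n + a) # ?r"
      unfolding \<open>[1..<Suc s] = _\<close> by simp
    ultimately have "z2 = ?l @ (n + a) # ?r"
      using n by (intro E_step_unique[OF st, where ys = "map ((+) n) (rev [Suc a..<Suc s])" and y = "n + a"]) (simp_all del: upt_Suc)
    then show "zs = [1..<Suc n] @ ?l @ (n + a) # ?r" using z12 z1 by simp
  qed
  then show ?case unfolding w x .
qed

text \<open>The same induction through the F letters, with the complete E word as base; meanwhile
  the right block stays at its initial contents.\<close>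

lemma word_rep_lead:
  assumes q: "q \<noteq> 0" "q - inverse q \<noteq> 0" and n: "1 \<le> n" "1 \<le> s" "n + s \<le> N" and a: "1 \<le> a" "a \<le> Suc n"
  shows "word_rep N q (n + s) (map F_gen (F_lead n s a) @ map E_gen (E_lead n s 1))
    ([1..<a] @ map ((+) s) [a..<Suc n] @ rev [1..<Suc s]) ([1..<Suc n] @ map ((+) n) (rev [1..<Suc s])) \<noteq> 0"
  using a(2,1)
proof (induction a rule: inc_induct)
  case base
  show ?case using word_rep_E_lead[OF q n(1,3), of 1] by (simp add: F_lead_def)
next
  case (step a)
  let ?l = "[1..<a]" and ?r = "map ((+) s) [Suc a..<Suc n]"
  let ?x2 = "rev [1..<Suc s]"
  let ?y2 = "map ((+) n) ?x2" and ?w = "map F_gen (F_lead n s (Suc a)) @ map E_gen (E_lead n s 1)"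
  let ?g = "F_gen (a, a + s)"
  have x: "[1..<a] @ map ((+) s) [a..<Suc n] = ?l @ (a + s) # ?r" using step.hyps upt_conv_Cons[of a "Suc n"] by (simp del: upt_Suc)
  have z: "[1..<Suc a] @ map ((+) s) [Suc a..<Suc n] = ?l @ a # ?r" using step.prems by simp
  have w: "map F_gen (F_lead n s a) @ map E_gen (E_lead n s 1) = ?g # ?w"
    using step.hyps upt_conv_Cons[of a "Suc n"] by (simp add: F_lead_def del: upt_Suc)
  have "word_rep N q (n + s) (?g # ?w) ((?l @ (a + s) # ?r) @ ?x2) ([1..<Suc n] @ ?y2) \<noteq> 0"
  proof (rule word_rep_Cons_nonzero)
    show "(?l @ a # ?r) @ ?x2 \<in> tensor_index N (n + s)"
      using step.hyps step.prems n by (auto simp: tensor_index_def simp del: upt_Suc)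
    show "gen_rep N q ?g ((?l @ (a + s) # ?r) @ ?x2) ((?l @ a # ?r) @ ?x2) \<noteq> 0"
      using trep_T_move[OF q, of a "a + s" N ?l "?r @ ?x2"] step.hyps step.prems n
      by (simp add: F_gen_def del: upt_Suc)
    show "word_rep N q (n + s) ?w ((?l @ a # ?r) @ ?x2) ([1..<Suc n] @ ?y2) \<noteq> 0"
      using step.IH step.prems unfolding z[symmetric] by simp
    fix zs assume zs: "step ?g ((?l @ (a + s) # ?r) @ ?x2) zs" "reach ?w zs ([1..<Suc n] @ ?y2)"
    have lenx: "length (?l @ (a + s) # ?r) = n" using step.hyps step.prems by simp
    obtain z1 z2 where z12: "zs = z1 @ z2" "length z1 = n"
      using step_length[OF zs(1)] lenx by (metis append_take_drop_id length_append length_take min.absorb2 le_add1)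
    have "[1..<Suc n] = [1..<a] @ a # [Suc a..<Suc n]"
      using step.hyps step.prems upt_add_eq_append[of 1 a "Suc n - a"] upt_conv_Cons[of a "Suc n"] by (simp del: upt_Suc)
    then have s: "sum_list [1..<Suc n] = sum_list [1..<a] + a + sum_list [Suc a..<Suc n]" by (simp del: upt_Suc)
    have x: "sum_list (?l @ (a + s) # ?r) = sum_list [1..<a] + (a + s + (s * (n - a) + sum_list [Suc a..<Suc n]))"
      by (simp add: sum_list_add_const del: upt_Suc)
    have h: "word_height (?g # ?w) = s * Suc (n - a) + n * s"
      unfolding w[symmetric] word_height_simps(3) word_height_gens sum_height_lead
      using step.hyps by (simp add: Suc_diff_le)
    have y2: "sum_list ?y2 = n * s + sum_list ?x2"
      unfolding sum_list_add_const by simp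
    have P: "potential (?l @ (a + s) # ?r) ?x2 - potential [1..<Suc n] ?y2 = int (word_height (?g # ?w))"
      unfolding potential_def x h y2 s by (simp del: upt_Suc)
    have len: "length (?l @ (a + s) # ?r) = length z1" "length z1 = length [1..<Suc n]" using z12 lenx by auto
    note tight = reach_Cons_tight[OF zs(2)[unfolded z12(1)] zs(1)[unfolded z12(1)] len P]
    have "is_F ?g" "\<not> is_E ?g" using n by (auto simp: F_gen_def)
    then have z2: "z2 = ?x2" and st: "F_step (a + s) (?l @ (a + s) # ?r) z1 a"
      using tight(1) by (auto simp: step_F_gen simp del: upt_Suc)
    have "z1 = ?l @ a # ?r"
      using n by (intro F_step_unique[OF st]) auto
    then show "zs = (?l @ a # ?r) @ ?x2" using z12 z2 by simp
  qed
  then show ?case unfolding w append_assoc[symmetric] x .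
qed

section \<open>Independence of the leading monomial\<close>

lemma count_list_distinct: "distinct xs \<Longrightarrow> x \<in> set xs \<Longrightarrow> count_list xs x = 1"
  by (induction xs) (auto simp: count_list_0_iff)

lemma pow_list_append: "length xs = length es \<Longrightarrow> pow_list (xs @ ys) (es @ fs) = pow_list xs es @ pow_list ys fs"
  by (simp add: pow_list_def)

lemma pow_list_split:
  assumes "i < length xs" "length es = length xs"
  shows "pow_list xs es = pow_list (take i xs) (take i es) @ replicate (es ! i) (xs ! i) @ pow_list (drop (Suc i) xs) (drop (Suc i) es)"
proof -
  have "pow_list xs es = pow_list (take i xs @ [xs ! i] @ drop (Suc i) xs) (take i es @ [es ! i] @ drop (Suc i) es)"
    using id_take_nth_drop[of i xs] id_take_nth_drop[of i es] assms by simp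
  also have "\<dots> = pow_list (take i xs) (take i es) @ pow_list [xs ! i] [es ! i] @ pow_list (drop (Suc i) xs) (drop (Suc i) es)"
    using assms by (subst pow_list_append, simp, subst pow_list_append) simp_all
  finally show ?thesis by (simp add: pow_list_def)
qed

lemma set_pow_list: "set (pow_list xs es) \<subseteq> set xs"
  by (auto simp: pow_list_def dest: set_zip_leftD)

lemma sum_list_pow_list:
  assumes "length es = length xs"
  shows "sum_list (map f (pow_list xs es)) = (\<Sum>j<length xs. es ! j * (f (xs ! j) :: nat))"
  using assms
proof (induction xs es rule: list_induct2')
  case (4 x xs e es)
  have "(\<Sum>j<length (x # xs). (e # es) ! j * f ((x # xs) ! j)) = e * f x + (\<Sum>j<length xs. es ! j * f (xs ! j))"
    by (simp only: length_Cons sum.lessThan_Suc_shift nth_Cons_0 nth_Cons_Suc)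
  then show ?case using 4 by (simp add: pow_list_def sum_list_replicate map_replicate)
qed (auto simp: pow_list_def)

lemma pos_roots_less:
  assumes "i < num_roots N"
  shows "\<beta> \<in> set (take i (pos_roots N)) \<Longrightarrow> \<beta> < pos_roots N ! i"
    "\<beta> \<in> set (drop (Suc i) (pos_roots N)) \<Longrightarrow> pos_roots N ! i < \<beta>"
proof -
  have "sorted_wrt (<) (pos_roots N)" using sorted_distinct_pos_roots by (simp add: strict_sorted_iff)
  then show "\<beta> \<in> set (take i (pos_roots N)) \<Longrightarrow> \<beta> < pos_roots N ! i"
    "\<beta> \<in> set (drop (Suc i) (pos_roots N)) \<Longrightarrow> pos_roots N ! i < \<beta>"
    using assms by (auto simp: in_set_conv_nth length_pos_roots sorted_wrt_iff_nth_less)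
qed

text \<open>The root at position \<open>i\<close> occurs only once in \<open>L\<close>, so the cut
  there is unique. This translates agreement of exponents on one side of \<open>i\<close> into
  agreement of the corresponding parts of the words.\<close>

lemma pow_list_count_split:
  assumes "sorted L" "distinct L" "set L \<subseteq> set (pos_roots N)" "i < num_roots N" "L = L1 @ pos_roots N ! i # L2"
    and "es = map (count_list L) (pos_roots N)"
  shows "pow_list (take i (pos_roots N)) (take i es) = L1"
    "pow_list (drop (Suc i) (pos_roots N)) (drop (Suc i) es) = L2"
proof -
  let ?R = "pos_roots N"
  have i: "i < length ?R" "length es = length ?R" using assms by (simp_all add: length_pos_roots)
  have "count_list L (?R ! i) = 1"
    using assms(2,5) by (intro count_list_distinct) auto
  then have es: "es ! i = 1" using i assms(6) by simp
  have "L = pow_list ?R es"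
    using sorted_eq_pow_list[OF assms(1) _ _ assms(3)] sorted_distinct_pos_roots assms(6) by simp
  also have "\<dots> = pow_list (take i ?R) (take i es) @ ?R ! i # pow_list (drop (Suc i) ?R) (drop (Suc i) es)"
    using pow_list_split[OF i] es by simp
  finally have "L1 @ ?R ! i # L2 = pow_list (take i ?R) (take i es) @ ?R ! i # pow_list (drop (Suc i) ?R) (drop (Suc i) es)"
    using assms(5) by simp
  moreover have "?R ! i \<notin> set L1" using assms(2,5) by auto
  moreover have "?R ! i \<notin> set L2" using assms(2,5) by auto
  ultimately have "L1 = pow_list (take i ?R) (take i es) \<and> L2 = pow_list (drop (Suc i) ?R) (drop (Suc i) es)"
    by (metis append_Cons_eq_iff)
  then show "pow_list (take i ?R) (take i es) = L1" "pow_list (drop (Suc i) ?R) (drop (Suc i) es) = L2"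
    by auto
qed

lemma F_lead_props:
  assumes "1 \<le> s" "n + s \<le> N"
  shows "sorted (F_lead n s 1)" "distinct (F_lead n s 1)" "set (F_lead n s 1) \<subseteq> set (pos_roots N)"
proof -
  show "sorted (F_lead n s 1)" unfolding F_lead_def
    by (simp add: sorted_map sorted_wrt_upt[THEN sorted_wrt_mono_rel[rotated]] del: upt_Suc)
  show "distinct (F_lead n s 1)" by (simp add: F_lead_def distinct_map inj_on_def del: upt_Suc)
  show "set (F_lead n s 1) \<subseteq> set (pos_roots N)"
    using assms by (auto simp: F_lead_def set_pos_roots simp del: upt_Suc)
qed

lemma E_lead_props:
  assumes "1 \<le> n" "n + s \<le> N"
  shows "sorted (E_lead n s 1)" "distinct (E_lead n s 1)" "set (E_lead n s 1) \<subseteq> set (pos_roots N)"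
proof -
  show "sorted (E_lead n s 1)" unfolding E_lead_def
    by (simp add: sorted_map sorted_wrt_upt[THEN sorted_wrt_mono_rel[rotated]] del: upt_Suc)
  show "distinct (E_lead n s 1)" by (simp add: E_lead_def distinct_map inj_on_def del: upt_Suc)
  show "set (E_lead n s 1) \<subseteq> set (pos_roots N)"
    using assms by (auto simp: E_lead_def set_pos_roots simp del: upt_Suc)
qed

lemma F_lead_split: "1 \<le> p \<Longrightarrow> p \<le> n \<Longrightarrow> F_lead n s 1 = map (\<lambda>i. (i, i + s)) [1..<p] @ (p, p + s) # map (\<lambda>i. (i, i + s)) [Suc p..<Suc n]"
  unfolding F_lead_def using upt_add_eq_append[of 1 p "Suc n - p"] upt_conv_Cons[of p "Suc n"] by (simp del: upt_Suc)

lemma E_lead_split: "1 \<le> p \<Longrightarrow> p \<le> s \<Longrightarrow> E_lead n s 1 = map (\<lambda>i. (i, n + i)) [1..<p] @ (p, n + p) # map (\<lambda>i. (i, n + i)) [Suc p..<Suc s]"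
  unfolding E_lead_def using upt_add_eq_append[of 1 p "Suc s - p"] upt_conv_Cons[of p "Suc s"] by (simp del: upt_Suc)

definition lead_expo :: "nat \<Rightarrow> nat \<Rightarrow> nat \<Rightarrow> int list \<Rightarrow> expo" where
  "lead_expo N n s \<mu> = (map (count_list (F_lead n s 1)) (pos_roots N), \<mu>, map (count_list (E_lead n s 1)) (pos_roots N))"

lemma total_degree_eq: "total_degree N (r, \<mu>, k) = rev k @ r @ [expo_height N (r, \<mu>, k)]"
  by (simp add: total_degree_def expo_height_def)

text \<open>Read from its most significant end, the total degree is the height, then
  \<open>r\<close> from its last entry backwards, then \<open>k\<close> from its first entry
  onwards.\<close>

lemma deg_less_total_degree_cases:
  assumes "deg_less (total_degree N (r, \<mu>, k)) (total_degree N (r', \<mu>', k'))"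
    and "length r = num_roots N" "length k = num_roots N" "length r' = num_roots N" "length k' = num_roots N"
  obtains "expo_height N (r, \<mu>, k) < expo_height N (r', \<mu>', k')"
  | i where "expo_height N (r, \<mu>, k) = expo_height N (r', \<mu>', k')" "i < num_roots N"
      "drop (Suc i) r = drop (Suc i) r'" "r ! i < r' ! i"
  | i where "expo_height N (r, \<mu>, k) = expo_height N (r', \<mu>', k')" "i < num_roots N"
      "take i k = take i k'" "k ! i < k' ! i"
proof -
  have "(expo_height N (r, \<mu>, k) # rev r @ k, expo_height N (r', \<mu>', k') # rev r' @ k') \<in> lex less_than"
    using assms(1) by (simp add: deg_less_def total_degree_eq)
  then consider "expo_height N (r, \<mu>, k) < expo_height N (r', \<mu>', k')"
    | "expo_height N (r, \<mu>, k) = expo_height N (r', \<mu>', k')" "(rev r @ k, rev r' @ k') \<in> lex less_than"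
    by auto
  then show ?thesis
  proof cases
    case 2
    obtain i where i: "i < length (rev r @ k)" "take i (rev r @ k) = take i (rev r' @ k')"
      "((rev r @ k) ! i, (rev r' @ k') ! i) \<in> less_than"
      using lex_take_index[OF 2(2)] by metis
    show ?thesis
    proof (cases "i < num_roots N")
      case True
      then have "rev r ! i < rev r' ! i" "take i (rev r) = take i (rev r')"
        using i assms by (simp_all add: nth_append)
      moreover have "rev r ! i = r ! (num_roots N - Suc i)" "rev r' ! i = r' ! (num_roots N - Suc i)"
        using True assms by (simp_all add: rev_nth)
      moreover have "drop (Suc (num_roots N - Suc i)) r = drop (Suc (num_roots N - Suc i)) r'"
        using calculation(2) True assms by (simp add: take_rev Suc_diff_Suc)
      ultimately show ?thesis using True 2(1) by (intro that(2)[of "num_roots N - Suc i"]) auto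
    next
      case False
      then have "k ! (i - num_roots N) < k' ! (i - num_roots N)" "take (i - num_roots N) k = take (i - num_roots N) k'"
        using i assms by (simp_all add: nth_append)
      moreover have "i - num_roots N < num_roots N" using False i(1) assms by simp
      ultimately show ?thesis using 2(1) by (intro that(3)) auto
    qed
  qed (rule that(1))
qed

text \<open>The filters discard the diagonal letters, both those of the middle block and those
  inside the root vectors.\<close>

lemma filter_pbw_word:
  "filter is_F (pbw_word N (r, \<mu>, k)) = map F_gen (pow_list (pos_roots N) r)"
  "filter is_E (pbw_word N (r, \<mu>, k)) = map E_gen (pow_list (pos_roots N) k)"
proof -
  have F: "filter is_F (concat (map F_pair fs)) = map F_gen fs" "filter is_E (concat (map F_pair fs)) = []"
    "filter is_E (concat (map E_pair fs)) = map E_gen fs" "filter is_F (concat (map E_pair fs)) = []"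
    if "set fs \<subseteq> set (pos_roots N)" for fs
    using that by (induction fs) (auto simp: F_pair_def E_pair_def F_gen_def E_gen_def set_pos_roots)
  have K: "filter is_F (concat (map2 K_block is \<mu>)) = []" "filter is_E (concat (map2 K_block is \<mu>)) = []" for "is"
    by (auto simp: filter_empty_conv K_block_def split: if_splits)
  show "filter is_F (pbw_word N (r, \<mu>, k)) = map F_gen (pow_list (pos_roots N) r)"
    "filter is_E (pbw_word N (r, \<mu>, k)) = map E_gen (pow_list (pos_roots N) k)"
    by (simp_all only: pbw_word_def pow_word_conv_pow_list case_prod_conv filter_append K F[OF set_pow_list] append_Nil append_Nil2)
qed

lemma word_height_pbw_word:
  assumes "length r = num_roots N" "length k = num_roots N"
  shows "word_height (pbw_word N (r, \<mu>, k)) = expo_height N (r, \<mu>, k)"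
proof -
  have "word_height (concat (map F_pair fs)) = sum_list (map height fs)" "word_height (concat (map E_pair fs)) = sum_list (map height fs)" for fs
    by (induction fs) (auto simp: F_pair_def E_pair_def height_def)
  moreover have "word_height (concat (map2 K_block [1..<Suc N] \<mu>)) = 0"
  proof -
    have "K_word N (concat (map2 K_block [1..<Suc N] \<mu>))" by (rule K_word_concat_K_block) auto
    moreover have "word_height ks = 0" if "K_word N ks" for ks
      using that by (induction ks) (auto simp: K_gen_def)
    ultimately show ?thesis by blast
  qed
  ultimately have "word_height (pbw_word N (r, \<mu>, k)) = sum_list (map height (pow_list (pos_roots N) r)) + sum_list (map height (pow_list (pos_roots N) k))"
    by (simp only: pbw_word_def pow_word_conv_pow_list case_prod_conv word_height_simps)
  then show ?thesis using assms
    by (simp add: sum_list_pow_list length_pos_roots expo_height_def distrib_right sum.distrib)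
qed

lemma expo_height_lead:
  assumes "1 \<le> n" "1 \<le> s" "n + s \<le> N"
  shows "expo_height N (lead_expo N n s \<mu>) = 2 * n * s"
  using expo_height_count[OF F_lead_props(3)[OF assms(2,3)] E_lead_props(3)[OF assms(1,3)]]
  by (simp add: lead_expo_def sum_height_lead[unfolded One_nat_def])

text \<open>A smaller height cannot bridge the potential difference \<open>2 * n * s\<close>. At
  equal height the path splits into an F path and an E path, and one of them lacks a root of the
  leading word while its vector agrees with the leading one at all more significant entries.\<close>

lemma not_reach_lower:
  assumes n: "1 \<le> n" "1 \<le> s" "n + s \<le> N" and x: "(r, \<mu>, k) \<in> expos N"
    and less: "deg_less (total_degree N (r, \<mu>, k)) (total_degree N (lead_expo N n s \<mu>'))"
  shows "\<not> reach (pbw_word N (r, \<mu>, k)) (map ((+) s) [1..<Suc n] @ rev [1..<Suc s]) ([1..<Suc n] @ map ((+) n) (rev [1..<Suc s]))"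
    (is "\<not> reach ?w (?x1 @ ?x2) (?y1 @ ?y2)")
proof
  assume reach: "reach ?w (?x1 @ ?x2) (?y1 @ ?y2)"
  let ?R = "pos_roots N"
  have len: "length r = num_roots N" "length k = num_roots N" using x by (auto simp: expos_def)
  have "sum_list ?x1 = s * n + sum_list ?y1" "sum_list ?y2 = n * s + sum_list ?x2"
    unfolding sum_list_add_const by simp_all
  then have P: "potential ?x1 ?x2 - potential ?y1 ?y2 = int (2 * n * s)" unfolding potential_def by simp
  have len1: "length ?x1 = length ?y1" by simp
  have "2 * n * s \<le> word_height ?w" using reach_potential(1)[OF reach len1] unfolding P by linarith
  then have height: "2 * n * s \<le> expo_height N (r, \<mu>, k)" using word_height_pbw_word[OF len] by simp
  note lead = expo_height_lead[OF n]
  have paths: "reach (map F_gen (pow_list ?R r)) ?x1 ?y1" "reach (map E_gen (pow_list ?R k)) ?x2 ?y2"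
    if "expo_height N (r, \<mu>, k) = 2 * n * s"
    using reach_potential(2)[OF reach len1] P that word_height_pbw_word[OF len] by (auto simp: filter_pbw_word simp del: upt_Suc)
  from less show False
    unfolding lead_expo_def
  proof (rule deg_less_total_degree_cases)
    assume "expo_height N (r, \<mu>, k) < expo_height N (map (count_list (F_lead n s 1)) ?R, \<mu>', map (count_list (E_lead n s 1)) ?R)"
    then show False using lead height unfolding lead_expo_def by simp
  next
    fix i
    assume eq: "expo_height N (r, \<mu>, k) = expo_height N (map (count_list (F_lead n s 1)) ?R, \<mu>', map (count_list (E_lead n s 1)) ?R)"
      and i: "i < num_roots N"
      and dr: "drop (Suc i) r = drop (Suc i) (map (count_list (F_lead n s 1)) ?R)"
      and ri: "r ! i < map (count_list (F_lead n s 1)) ?R ! i"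
    have ri: "r ! i < count_list (F_lead n s 1) (?R ! i)" using ri i by (simp add: length_pos_roots)
    \<comment> \<open>An entry below the leading one forces the latter to be positive, hence 1, and
      itself to be 0: the root \<open>(p, p + s)\<close> is missing.\<close>
    then have mem: "?R ! i \<in> set (F_lead n s 1)" by (metis count_list_0_iff not_less_zero)
    from mem obtain p where p: "1 \<le> p" "p \<le> n" "?R ! i = (p, p + s)" by (auto simp: F_lead_def simp del: upt_Suc)
    note split = F_lead_split[OF p(1,2), of s, folded p(3)]
    have "count_list (F_lead n s 1) (?R ! i) = 1"
      by (rule count_list_distinct[OF F_lead_props(2)[OF n(2,3)] mem])
    then have "r ! i = 0" using ri by simp
    moreover have "pow_list (drop (Suc i) ?R) (drop (Suc i) r) = map (\<lambda>i. (i, i + s)) [Suc p..<Suc n]"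
      unfolding dr by (rule pow_list_count_split(2)[OF F_lead_props[OF n(2,3)] i split refl])
    ultimately have pl: "pow_list ?R r = pow_list (take i ?R) (take i r) @ map (\<lambda>i. (i, i + s)) [Suc p..<Suc n]"
      using pow_list_split[of i ?R r] i len by (simp add: length_pos_roots del: upt_Suc)
    have lt: "\<forall>f\<in>set (pow_list (take i ?R) (take i r)). f < (p, p + s)"
      using set_pow_list[of "take i ?R" "take i r"] pos_roots_less(1)[OF i] unfolding p(3) by (meson subsetD)
    have shift: "map ((+) s) [1..<Suc n] = map (\<lambda>i. i + s) [1..<Suc n]" by (simp add: add.commute del: upt_Suc)
    have "expo_height N (r, \<mu>, k) = 2 * n * s" using eq lead unfolding lead_expo_def by simp
    from paths(1)[OF this] show False
      unfolding pl shift using not_reach_F[OF p(1) n(2) p(2) lt] by blast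
  next
    fix i
    assume eq: "expo_height N (r, \<mu>, k) = expo_height N (map (count_list (F_lead n s 1)) ?R, \<mu>', map (count_list (E_lead n s 1)) ?R)"
      and i: "i < num_roots N"
      and tk: "take i k = take i (map (count_list (E_lead n s 1)) ?R)"
      and ki: "k ! i < map (count_list (E_lead n s 1)) ?R ! i"
    have ki: "k ! i < count_list (E_lead n s 1) (?R ! i)" using ki i by (simp add: length_pos_roots)
    then have mem: "?R ! i \<in> set (E_lead n s 1)" by (metis count_list_0_iff not_less_zero)
    from mem obtain p where p: "1 \<le> p" "p \<le> s" "?R ! i = (p, n + p)" by (auto simp: E_lead_def simp del: upt_Suc)
    note split = E_lead_split[OF p(1,2), of n, folded p(3)]
    have "count_list (E_lead n s 1) (?R ! i) = 1"
      by (rule count_list_distinct[OF E_lead_props(2)[OF n(1,3)] mem])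
    then have "k ! i = 0" using ki by simp
    moreover have "pow_list (take i ?R) (take i k) = map (\<lambda>i. (i, n + i)) [1..<p]"
      unfolding tk by (rule pow_list_count_split(1)[OF E_lead_props[OF n(1,3)] i split refl])
    ultimately have pl: "pow_list ?R k = map (\<lambda>i. (i, n + i)) [1..<p] @ pow_list (drop (Suc i) ?R) (drop (Suc i) k)"
      using pow_list_split[of i ?R k] i len by (simp add: length_pos_roots del: upt_Suc)
    have lt: "\<forall>e\<in>set (pow_list (drop (Suc i) ?R) (drop (Suc i) k)). (p, n + p) < e"
      using set_pow_list[of "drop (Suc i) ?R" "drop (Suc i) k"] pos_roots_less(2)[OF i] unfolding p(3) by (meson subsetD)
    have shift: "map ((+) n) (rev [1..<Suc s]) = rev [n + 1..<Suc (n + s)]"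
      unfolding rev_map[symmetric] map_add_upt_shift by simp
    have "expo_height N (r, \<mu>, k) = 2 * n * s" using eq lead unfolding lead_expo_def by simp
    from paths(2)[OF this] show False
      unfolding pl shift using not_reach_E[OF n(1) p(1,2) lt] by blast
  qed (use len in \<open>simp_all add: length_pos_roots\<close>)
qed

text \<open>The entry is a linear functional that vanishes on the relations and on all ordered
  monomials of lower degree, but not on the leading word, which is proportional to the ordered
  monomial in question.\<close>

lemma lead_word_independent:
  assumes q: "q \<noteq> 0" "q - inverse q \<noteq> 0" and n: "1 \<le> n" "1 \<le> s" "n + s \<le> N"
    and w: "wprop N q (map F_gen (F_lead n s 1) @ map E_gen (E_lead n s 1)) (pbw_word N (lead_expo N n s \<mu>))"
  shows "word (pbw_word N (lead_expo N n s \<mu>)) \<notin>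
    pbw_span N q (\<lambda>y. deg_less (total_degree N y) (total_degree N (lead_expo N n s \<mu>)))"
    (is "_ \<notin> ?D")
proof
  let ?x = "map ((+) s) [1..<Suc n] @ rev [1..<Suc s]" and ?y = "[1..<Suc n] @ map ((+) n) (rev [1..<Suc s])"
  let ?\<phi> = "\<lambda>p. falg_rep N q (n + s) p ?x ?y"
  have idx: "?x \<in> tensor_index N (n + s)" "?y \<in> tensor_index N (n + s)"
    using n by (auto simp: tensor_index_def simp del: upt_Suc)
  have zero: "?\<phi> p = 0" if "p \<in> ?D" for p
    using that
  proof (induction rule: pbw_span.induct)
    case (rel p)
    then show ?case using falg_rep_rel_ideal[OF q(1) _ idx] by blast
  next
    case (add_monom p x c)
    obtain r \<mu>' k where x: "x = (r, \<mu>', k)" by (cases x) auto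
    have "word_rep N q (n + s) (pbw_word N x) ?x ?y = 0"
      using not_reach_lower[OF n] add_monom(2,3) reach_if_word_rep unfolding x by blast
    then show ?case using add_monom by (simp add: falg_rep_add del: upt_Suc)
  qed
  assume D: "word (pbw_word N (lead_expo N n s \<mu>)) \<in> ?D"
  obtain c where "req N q (word (map F_gen (F_lead n s 1) @ map E_gen (E_lead n s 1))) (monomial (pbw_word N (lead_expo N n s \<mu>)) c)"
    using w by (auto simp: wprop_def)
  moreover have "monomial (pbw_word N (lead_expo N n s \<mu>)) c \<in> ?D"
    using pbw_span_scale[OF D, of c] by (simp add: const_mult_single)
  ultimately have "word (map F_gen (F_lead n s 1) @ map E_gen (E_lead n s 1)) \<in> ?D"
    by (rule pbw_span_req)
  then have "word_rep N q (n + s) (map F_gen (F_lead n s 1) @ map E_gen (E_lead n s 1)) ?x ?y = 0"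
    using zero[of "word (map F_gen (F_lead n s 1) @ map E_gen (E_lead n s 1))"] by (simp del: upt_Suc)
  then show False using word_rep_lead[OF q n, of 1] by (simp del: upt_Suc)
qed

section \<open>The terms of \<open>d\<^sub>r\<^sub>s\<close>\<close>

lemma wprop_filter_K:
  assumes "q \<noteq> 0" "set w \<subseteq> gens N"
  shows "wprop N q w (filter (\<lambda>g. \<not> K_gen g) w @ filter K_gen w)"
  using assms(2)
proof (induction w)
  case (Cons g w)
  let ?A = "filter (\<lambda>g. \<not> K_gen g) w" and ?B = "filter K_gen w"
  have gens: "set ?A \<subseteq> gens N" "set ?B \<subseteq> gens N" using Cons.prems by auto
  have "wprop N q ([g] @ w @ []) ([g] @ (?A @ ?B) @ [])"
    using Cons gens by (intro wprop_context) auto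
  then have 1: "wprop N q (g # w) (g # ?A @ ?B)" by simp
  show ?case
  proof (cases "K_gen g")
    case True
    have "wprop N q ([] @ ([g] @ ?A) @ ?B) ([] @ (?A @ [g]) @ ?B)"
      using True Cons.prems gens by (intro wprop_context K_word_commute assms(1)) auto
    then have "wprop N q (g # ?A @ ?B) (?A @ g # ?B)" by simp
    from wprop_trans[OF 1 this] show ?thesis using True by simp
  qed (use 1 in simp)
qed simp

text \<open>If \<open>x = (i, a)\<close> and \<open>y = (j, b)\<close> are out of order, the roots
  are nested: \<open>j < i < a < b\<close>. The coefficient of the third word in the relation is
  then zero and the letters commute.\<close>

lemma wprop_E_insort:
  assumes "set (x # ys) \<subseteq> set (pos_roots N)" "\<forall>y\<in>set ys. snd x < snd y \<and> fst x \<noteq> fst y"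
  shows "wprop N q (map E_gen (x # ys)) (map E_gen (insort x ys))"
  using assms
proof (induction ys)
  case (Cons y ys)
  show ?case
  proof (cases "x \<le> y")
    case False
    obtain i a j b where xy: "x = (i, a)" "y = (j, b)" by fastforce
    with False Cons.prems have lt: "j < i" "a < b" "{i, a, j, b} \<subseteq> {1..N}" by (auto simp: set_pos_roots)
    have gens: "set (map E_gen ys) \<subseteq> gens N" "E_gen x \<in> gens N" "E_gen y \<in> gens N"
      "set (map E_gen (insort x ys)) \<subseteq> gens N"
      using set_E_gen[of ys N] set_E_gen[of "[x, y]" N] Cons.prems by (auto simp: set_insort_key)
    have "req N q (word [Tbar i a, Tbar j b]) (word [Tbar j b, Tbar i a])"
      using rtt_Tbar[of i a j b N q] lt by simp
    then have "wprop N q [E_gen x, E_gen y] [E_gen y, E_gen x]"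
      by (intro wpropI[of 1]) (simp_all add: E_gen_def xy)
    then have "wprop N q ([] @ [E_gen x, E_gen y] @ map E_gen ys) ([] @ [E_gen y, E_gen x] @ map E_gen ys)"
      using gens by (intro wprop_context) auto
    also have "wprop N q ([E_gen y] @ map E_gen (x # ys) @ []) ([E_gen y] @ map E_gen (insort x ys) @ [])"
      using gens Cons by (intro wprop_context) auto
    then have "wprop N q ([] @ [E_gen y, E_gen x] @ map E_gen ys) (map E_gen (insort x (y # ys)))"
      using False by simp
    finally show ?thesis by simp
  qed simp
qed simp

lemma wprop_E_sort:
  assumes "set es \<subseteq> set (pos_roots N)" "sorted_wrt (\<lambda>x y. snd x < snd y \<and> fst x \<noteq> fst y) es"
  shows "wprop N q (map E_gen es) (map E_gen (sort es))"
  using assms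
proof (induction es)
  case (Cons x es)
  have gens: "E_gen x \<in> gens N" "set (map E_gen es) \<subseteq> gens N" "set (map E_gen (sort es)) \<subseteq> gens N"
    using set_E_gen[of "x # es" N] set_E_gen[of es N] set_E_gen[of "sort es" N] Cons.prems(1) by auto
  have "wprop N q ([E_gen x] @ map E_gen es @ []) ([E_gen x] @ map E_gen (sort es) @ [])"
    using gens Cons by (intro wprop_context) auto
  also have "wprop N q ([E_gen x] @ map E_gen (sort es) @ []) (map E_gen (insort x (sort es)))"
    using wprop_E_insort[of x "sort es" N q] Cons.prems by simp
  finally show ?case by simp
qed simp

section \<open>Comparison of total degrees\<close>

lemma deg_less_F_I:
  assumes "i < num_roots N" "f (pos_roots N ! i) < g (pos_roots N ! i)"
    "\<And>\<gamma>. \<gamma> \<in> set (pos_roots N) \<Longrightarrow> pos_roots N ! i < \<gamma> \<Longrightarrow> f \<gamma> = g \<gamma>"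
    "length k = length k'"
    "expo_height N (map f (pos_roots N), \<mu>, k) = expo_height N (map g (pos_roots N), \<mu>', k')"
  shows "deg_less (total_degree N (map f (pos_roots N), \<mu>, k)) (total_degree N (map g (pos_roots N), \<mu>', k'))"
proof -
  let ?R = "pos_roots N"
  have R: "?R = take i ?R @ ?R ! i # drop (Suc i) ?R"
    using assms(1) by (intro id_take_nth_drop) (simp add: length_pos_roots)
  have split: "rev (map h ?R) = rev (map h (drop (Suc i) ?R)) @ h (?R ! i) # rev (map h (take i ?R))" for h :: "nat \<times> nat \<Rightarrow> nat"
    by (subst R) simp
  have eq: "map f (drop (Suc i) ?R) = map g (drop (Suc i) ?R)"
    by (intro map_cong refl assms(3) pos_roots_less(2)[OF assms(1)]) (rule in_set_dropD)
  have "(rev (map f ?R) @ k, rev (map g ?R) @ k') \<in> lex less_than"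
    unfolding split append_assoc eq using assms(1,2,4) by (intro lex_append_leftI) simp
  then show ?thesis using assms(5) by (simp add: deg_less_def total_degree_eq)
qed

lemma deg_less_E_I:
  assumes "i < num_roots N" "f (pos_roots N ! i) < g (pos_roots N ! i)"
    "\<And>\<gamma>. \<gamma> \<in> set (pos_roots N) \<Longrightarrow> \<gamma> < pos_roots N ! i \<Longrightarrow> f \<gamma> = g \<gamma>"
    "expo_height N (r, \<mu>, map f (pos_roots N)) = expo_height N (r, \<mu>', map g (pos_roots N))"
  shows "deg_less (total_degree N (r, \<mu>, map f (pos_roots N))) (total_degree N (r, \<mu>', map g (pos_roots N)))"
proof -
  let ?R = "pos_roots N"
  have R: "?R = take i ?R @ ?R ! i # drop (Suc i) ?R"
    using assms(1) by (intro id_take_nth_drop) (simp add: length_pos_roots)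
  have split: "map h ?R = map h (take i ?R) @ h (?R ! i) # map h (drop (Suc i) ?R)" for h :: "nat \<times> nat \<Rightarrow> nat"
    by (subst R) simp
  have eq: "map f (take i ?R) = map g (take i ?R)"
    by (intro map_cong refl assms(3) pos_roots_less(1)[OF assms(1)]) (rule in_set_takeD)
  have "(rev r @ map f ?R, rev r @ map g ?R) \<in> lex less_than"
    unfolding split eq using assms(1,2) by (intro lex_append_leftI) simp
  then show ?thesis using assms(4) by (simp add: deg_less_def total_degree_eq)
qed

lemma deg_less_height:
  assumes "expo_height N (r, \<mu>, k) < expo_height N (r', \<mu>', k')" "length r = length r'" "length k = length k'"
  shows "deg_less (total_degree N (r, \<mu>, k)) (total_degree N (r', \<mu>', k'))"
  using assms by (simp add: deg_less_def total_degree_eq)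

text \<open>Exchanging \<open>A - B\<close> for \<open>B - A\<close> replaces equally many elements
  at most \<open>t\<close> by elements above \<open>t\<close>, and gains at least one for each.
  Initial and final segments are the extremal cases, and the gain detects equality.\<close>

lemma sum_separated:
  fixes A B :: "nat set"
  assumes "finite A" "finite B" "card A = card B" "\<forall>a\<in>A - B. a \<le> t" "\<forall>b\<in>B - A. t < b"
  shows "\<Sum>A + card (B - A) \<le> \<Sum>B"
proof -
  have card: "card (A - B) = card (B - A)"
    using assms(1-3) by (simp add: card_Diff_subset_Int Int_commute)
  have "\<Sum>(A - B) + card (B - A) \<le> t * card (A - B) + card (B - A)"
    using sum_bounded_above[of "A - B" "\<lambda>x. x" t] assms(4) by (simp add: mult.commute)
  also have "\<dots> = card (B - A) * Suc t" by (simp add: card mult.commute)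
  also have "\<dots> \<le> \<Sum>(B - A)"
    using sum_bounded_below[of "B - A" "Suc t" "\<lambda>x. x"] assms(5) by (simp add: Suc_le_eq)
  finally have "\<Sum>(A - B) + card (B - A) \<le> \<Sum>(B - A)" .
  moreover have "\<Sum>A = \<Sum>(A - B) + \<Sum>(A \<inter> B)" "\<Sum>B = \<Sum>(B - A) + \<Sum>(A \<inter> B)"
    using assms(1,2) sum.Int_Diff[of A "\<lambda>x. x" B] sum.Int_Diff[of B "\<lambda>x. x" A] by (simp_all add: Int_commute)
  ultimately show ?thesis by linarith
qed

section \<open>The words of the summands and their heights\<close>

definition minor_word :: "nat \<Rightarrow> (nat \<Rightarrow> nat) \<Rightarrow> (nat \<Rightarrow> nat) \<Rightarrow> gen list" where
  "minor_word r \<sigma> k = map (\<lambda>i. if k i = 0 then T (\<sigma> i) i else Tbar (\<sigma> i) i) [1..<Suc r]"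

definition lead_perm :: "nat \<Rightarrow> nat \<Rightarrow> nat \<Rightarrow> nat" where
  "lead_perm n s i = (if i \<in> {1..n + s} then if i \<le> n then i + s else i - n else i)"

definition lead_sup :: "nat \<Rightarrow> nat \<Rightarrow> nat \<Rightarrow> nat" where
  "lead_sup n s = (\<lambda>i\<in>{1..n + s}. if i \<le> n then 0 else 1)"

lemma lead_perm_permutes: "lead_perm n s permutes {1..n + s}"
proof (rule bij_imp_permutes)
  show "bij_betw (lead_perm n s) {1..n + s} {1..n + s}"
    by (rule bij_betwI[where g = "\<lambda>i. if i \<le> s then i + n else i - s"]) (auto simp: lead_perm_def)
qed (auto simp: lead_perm_def)

lemma minor_word_lead:
  "minor_word (n + s) (lead_perm n s) (lead_sup n s) = map F_gen (F_lead n s 1) @ map E_gen (E_lead n s 1)"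
proof -
  have "[1..<Suc (n + s)] = [1..<Suc n] @ map (\<lambda>i. n + i) [1..<Suc s]"
    unfolding map_add_upt_shift using upt_add_eq_append[of 1 "Suc n" s] by (simp del: upt_Suc)
  then show ?thesis
    unfolding minor_word_def F_lead_def E_lead_def
    by (auto simp: F_gen_def E_gen_def lead_perm_def lead_sup_def simp del: upt_Suc)
qed

lemma minor_word_gens:
  assumes "\<sigma> permutes {1..r}" "r \<le> N"
  shows "set (minor_word r \<sigma> k) \<subseteq> gens N"
proof -
  have "\<sigma> i \<in> {1..N}" if "i \<in> {1..r}" for i
    using permutes_in_image[OF assms(1), of i] that assms(2) by auto
  then show ?thesis using assms(2) by (fastforce simp: minor_word_def)
qed

definition sup_choices :: "nat \<Rightarrow> nat \<Rightarrow> (nat \<Rightarrow> nat) set" where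
  "sup_choices r s = {k \<in> {1..r} \<rightarrow>\<^sub>E {0, 1::nat}. (\<Sum>i=1..r. k i) = s}"

lemma card_zero_choices:
  assumes "k \<in> sup_choices (n + s) s"
  shows "card {i \<in> {1..n + s}. k i = 0} = n"
proof -
  have "k \<in> {1..n + s} \<rightarrow>\<^sub>E {0, 1}" using assms by (simp add: sup_choices_def)
  then have "k i = 1" if "i \<in> {1..n + s}" "k i \<noteq> 0" for i
    using PiE_mem that by fastforce
  then have "(\<Sum>i=1..n + s. k i) = (\<Sum>i\<in>{i \<in> {1..n + s}. k i \<noteq> 0}. 1)"
    by (intro sum.mono_neutral_cong_right) auto
  then have "card {i \<in> {1..n + s}. k i \<noteq> 0} = s" using assms by (simp add: sup_choices_def)
  moreover have "card {i \<in> {1..n + s}. k i = 0} + card {i \<in> {1..n + s}. k i \<noteq> 0} = card {1..n + s}"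
  proof -
    have "card ({i \<in> {1..n + s}. k i = 0} \<union> {i \<in> {1..n + s}. k i \<noteq> 0})
        = card {i \<in> {1..n + s}. k i = 0} + card {i \<in> {1..n + s}. k i \<noteq> 0}"
      by (rule card_Un_disjoint) auto
    moreover have "{i \<in> {1..n + s}. k i = 0} \<union> {i \<in> {1..n + s}. k i \<noteq> 0} = {1..n + s}" by blast
    ultimately show ?thesis by simp
  qed
  ultimately show ?thesis by simp
qed

lemma lead_sup_eqI:
  assumes "k \<in> sup_choices (n + s) s" "{i \<in> {1..n + s}. k i = 0} = {1..n}"
  shows "k = lead_sup n s"
proof
  fix i
  have ext: "k i = undefined" if "i \<notin> {1..n + s}"
    using assms(1) that by (auto simp: sup_choices_def PiE_iff extensional_def)
  have "k i = 0 \<longleftrightarrow> i \<le> n" if "i \<in> {1..n + s}"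
    using assms(2) that by (auto simp: set_eq_iff)
  moreover have "k i = 0 \<or> k i = 1" if "i \<in> {1..n + s}"
    using assms(1) that by (auto simp: sup_choices_def PiE_iff)
  ultimately show "k i = lead_sup n s i" using ext by (auto simp: lead_sup_def restrict_def)
qed

text \<open>The differences \<open>\<sigma> i - i\<close> add up to zero over all indices, so
  letters \<open>T\<close> and \<open>Tbar\<close> contribute equally to the height. What remains to
  bound is the sum over the image of \<open>Z\<close> minus the sum over \<open>Z\<close>, where
  \<open>Z\<close> is the set of indices with superscript 0.\<close>

lemma minor_word_height:
  assumes \<sigma>: "\<sigma> permutes {1..n + s}" and k: "k \<in> sup_choices (n + s) s"
    and nz: "\<forall>g\<in>set (minor_word (n + s) \<sigma> k). \<not> zero_gen g"
  shows "word_height (minor_word (n + s) \<sigma> k) \<le> 2 * n * s"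
    and "word_height (minor_word (n + s) \<sigma> k) = 2 * n * s \<Longrightarrow> k = lead_sup n s \<and> \<sigma> ` {1..n} = {s + 1..n + s}"
proof -
  let ?r = "n + s"
  define Z where "Z = {i \<in> {1..?r}. k i = 0}"
  have Z: "finite Z" "card Z = n" "Z \<subseteq> {1..?r}" using card_zero_choices[OF k] by (auto simp: Z_def)
  have inj: "inj_on \<sigma> Z" using permutes_inj_on[OF \<sigma>] .
  have \<sigma>Z: "finite (\<sigma> ` Z)" "card (\<sigma> ` Z) = n" "\<sigma> ` Z \<subseteq> {1..?r}"
    using Z inj permutes_image[OF \<sigma>] by (auto simp: card_image)
  have mono: "if k i = 0 then i \<le> \<sigma> i else \<sigma> i \<le> i" if "i \<in> {1..?r}" for i
  proof -
    have "(if k i = 0 then T (\<sigma> i) i else Tbar (\<sigma> i) i) \<in> set (minor_word ?r \<sigma> k)"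
      using that by (auto simp: minor_word_def simp del: upt_Suc)
    then show ?thesis using nz by fastforce
  qed
  have "int (word_height (minor_word ?r \<sigma> k)) = (\<Sum>i=1..?r. if k i = 0 then int (\<sigma> i) - int i else int i - int (\<sigma> i))"
  proof -
    have "word_height (minor_word ?r \<sigma> k) = (\<Sum>i=1..?r. gen_height (if k i = 0 then T (\<sigma> i) i else Tbar (\<sigma> i) i))"
      by (simp add: word_height_def minor_word_def comp_def sum_list_distinct_conv_sum_set atLeastLessThanSuc_atLeastAtMost del: upt_Suc)
    also have "int \<dots> = (\<Sum>i=1..?r. if k i = 0 then int (\<sigma> i) - int i else int i - int (\<sigma> i))"
      unfolding of_nat_sum by (intro sum.cong refl) (use mono in \<open>auto simp: of_nat_diff split: if_splits\<close>)
    finally show ?thesis .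
  qed
  also have "\<dots> = (\<Sum>i=1..?r. 2 * (if k i = 0 then int (\<sigma> i) - int i else 0)) - (\<Sum>i=1..?r. int (\<sigma> i) - int i)"
    unfolding sum_subtractf[symmetric] by (intro sum.cong) auto
  also have "(\<Sum>i=1..?r. int (\<sigma> i) - int i) = 0"
    using sum.permute[OF \<sigma>, of int] by (simp add: sum_subtractf comp_def)
  also have "(\<Sum>i=1..?r. 2 * (if k i = 0 then int (\<sigma> i) - int i else 0)) = 2 * (\<Sum>i\<in>Z. int (\<sigma> i) - int i)"
    unfolding sum_distrib_left Z_def by (subst sum.inter_filter) (auto intro: sum.cong)
  also have "(\<Sum>i\<in>Z. int (\<sigma> i) - int i) = int (\<Sum>(\<sigma> ` Z)) - int (\<Sum>Z)"
    using inj by (simp add: sum_subtractf sum.reindex)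
  finally have height: "int (word_height (minor_word ?r \<sigma> k)) = 2 * (int (\<Sum>(\<sigma> ` Z)) - int (\<Sum>Z))" by simp
  have low: "\<Sum>{1..n} + card (Z - {1..n}) \<le> \<Sum>Z"
    using Z by (intro sum_separated[of _ _ n]) auto
  have high: "\<Sum>(\<sigma> ` Z) + card ({s + 1..?r} - \<sigma> ` Z) \<le> \<Sum>{s + 1..?r}"
    using \<sigma>Z by (intro sum_separated[of _ _ s]) auto
  have "\<Sum>{s + 1..?r} = (\<Sum>i\<in>{1..n}. i + s)"
    by (rule sum.reindex_bij_witness[of _ "\<lambda>i. i + s" "\<lambda>i. i - s"]) auto
  then have diff: "\<Sum>{s + 1..?r} = \<Sum>{1..n} + n * s" by (simp add: sum.distrib)
  \<comment> \<open>Here \<open>c\<close> and \<open>c'\<close> count how far \<open>Z\<close> and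
    its image are from the two extremal segments; at the maximal height both are zero.\<close>
  have arith: "w \<le> 2 * p \<and> (w = 2 * p \<longrightarrow> c = 0 \<and> c' = 0)"
    if "int w = 2 * (int a - int b)" "e + c \<le> b" "a + c' \<le> e'" "e' = e + p" for w p c c' a b e e' :: nat
    using that by presburger
  note bound = arith[OF height low high diff]
  then show "word_height (minor_word ?r \<sigma> k) \<le> 2 * n * s" by (simp add: mult.assoc)
  assume "word_height (minor_word ?r \<sigma> k) = 2 * n * s"
  then have "card (Z - {1..n}) = 0" "card ({s + 1..?r} - \<sigma> ` Z) = 0"
    using bound by (simp_all add: mult.assoc)
  then have "Z \<subseteq> {1..n}" "{s + 1..?r} \<subseteq> \<sigma> ` Z" using Z by auto
  then have eq: "Z = {1..n}" "\<sigma> ` Z = {s + 1..?r}"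
    using Z \<sigma>Z card_subset_eq[of "{1..n}" Z] card_subset_eq[of "\<sigma> ` Z" "{s + 1..?r}"] by auto
  then show "k = lead_sup n s \<and> \<sigma> ` {1..n} = {s + 1..?r}"
    using lead_sup_eqI[OF k] by (simp add: Z_def)
qed

lemma count_list_of_bool: "distinct xs \<Longrightarrow> count_list xs x = of_bool (x \<in> set xs)"
  using count_list_distinct[of xs x] by (cases "x \<in> set xs") (auto simp: count_list_0_iff)

lemma word_height_filter: "word_height (filter P w) \<le> word_height w"
  by (induction w) auto

text \<open>At equal height, at the most significant root where the exponents differ, the leading
  word has exponent 1 and the other word 0, because injectivity of \<open>\<sigma>\<close> reserves
  the remaining values for the positions that already agree.\<close>

lemma minor_word_top_lower:
  assumes n: "1 \<le> n" "1 \<le> s" "n + s \<le> N"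
    and \<sigma>: "\<sigma> permutes {1..n + s}" "\<sigma> ` {1..n} = {s + 1..n + s}" "\<sigma> \<noteq> lead_perm n s"
    and es: "set es = {(\<sigma> i, i) | i. i \<in> {n + 1..n + s} \<and> \<sigma> i \<noteq> i}" "distinct es"
    and fs: "set fs = {(i, \<sigma> i) | i. i \<in> {1..n} \<and> \<sigma> i \<noteq> i}" "distinct fs"
    and height: "expo_height N (map (count_list fs) (pos_roots N), \<mu>, map (count_list es) (pos_roots N)) \<le> 2 * n * s"
  shows "deg_less (total_degree N (map (count_list fs) (pos_roots N), \<mu>, map (count_list es) (pos_roots N)))
    (total_degree N (lead_expo N n s \<mu>'))"
proof -
  let ?R = "pos_roots N"
  note lead = expo_height_lead[OF n, of \<mu>']
  have inj: "i = j" if "\<sigma> i = \<sigma> j" for i j using permutes_inj[OF \<sigma>(1)] that by (auto dest: injD)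
  note countF = count_list_of_bool[OF fs(2)] count_list_of_bool[OF F_lead_props(2)[OF n(2,3)]]
  note countE = count_list_of_bool[OF es(2)] count_list_of_bool[OF E_lead_props(2)[OF n(1,3)]]
  have F_lead: "set (F_lead n s 1) = {(i, i + s) | i. i \<in> {1..n}}"
    by (auto simp: F_lead_def simp del: upt_Suc)
  have E_lead: "set (E_lead n s 1) = {(i, n + i) | i. i \<in> {1..s}}"
    by (auto simp: E_lead_def simp del: upt_Suc)
  show ?thesis
  proof (cases "expo_height N (map (count_list fs) ?R, \<mu>, map (count_list es) ?R) < 2 * n * s")
    case True
    then show ?thesis using lead unfolding lead_expo_def by (intro deg_less_height) simp_all
  next
    case False
    then have eq: "expo_height N (map (count_list fs) ?R, \<mu>, map (count_list es) ?R) = expo_height N (lead_expo N n s \<mu>')"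
      using height lead by simp
    show ?thesis
    proof (cases "\<exists>i\<in>{1..n}. \<sigma> i \<noteq> i + s")
      case True
      \<comment> \<open>The exponents of F are compared from the last root, hence the largest
        deviating index.\<close>
      define p where "p = Max {i \<in> {1..n}. \<sigma> i \<noteq> i + s}"
      have "p \<in> {i \<in> {1..n}. \<sigma> i \<noteq> i + s}" unfolding p_def using True by (intro Max_in) auto
      then have p: "1 \<le> p" "p \<le> n" "\<sigma> p \<noteq> p + s" by auto
      have above: "\<sigma> i = i + s" if "p < i" "i \<le> n" for i
      proof (rule ccontr)
        assume "\<sigma> i \<noteq> i + s"
        then have "i \<le> p" unfolding p_def using that by (intro Max_ge) auto
        with that show False by simp
      qed
      have "\<sigma> p \<in> {s + 1..n + s}" using p \<sigma>(2) by (metis atLeastAtMost_iff image_eqI)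
      moreover have "\<not> p + s < \<sigma> p"
      proof
        assume *: "p + s < \<sigma> p"
        then have "\<sigma> (\<sigma> p - s) = \<sigma> p" using above[of "\<sigma> p - s"] calculation by auto
        from inj[OF this] * show False by simp
      qed
      ultimately have p': "\<sigma> p < p + s" using p by auto
      have "(p, p + s) \<in> set ?R" using p n by (auto simp: set_pos_roots)
      then obtain i where i: "i < num_roots N" "?R ! i = (p, p + s)" by (auto simp: in_set_conv_nth length_pos_roots)
      show ?thesis unfolding lead_expo_def
      proof (rule deg_less_F_I[OF i(1)])
        show "count_list fs (?R ! i) < count_list (F_lead n s 1) (?R ! i)"
          unfolding i(2) countF fs(1) F_lead using p by auto
        show "count_list fs \<gamma> = count_list (F_lead n s 1) \<gamma>" if "?R ! i < \<gamma>" for \<gamma>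
        proof -
          obtain a b where \<gamma>: "\<gamma> = (a, b)" by fastforce
          then have "p < a \<or> a = p \<and> p + s < b" using that i(2) by auto
          then have "\<gamma> \<in> set fs \<longleftrightarrow> \<gamma> \<in> set (F_lead n s 1)"
            unfolding \<gamma> fs(1) F_lead using above p' n by auto
          then show ?thesis unfolding countF by simp
        qed
      qed (use eq in \<open>simp_all add: lead_expo_def\<close>)
    next
      case False
      then have low: "\<sigma> i = i + s" if "i \<in> {1..n}" for i using that by auto
      have "\<gamma> \<in> set fs \<longleftrightarrow> \<gamma> \<in> set (F_lead n s 1)" for \<gamma>
        unfolding fs(1) F_lead using low n by force
      then have fs_eq: "count_list fs = count_list (F_lead n s 1)" by (intro ext) (simp only: countF)
      have "\<exists>a\<in>{1..s}. \<sigma> (n + a) \<noteq> a"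
      proof (rule ccontr)
        assume "\<not> (\<exists>a\<in>{1..s}. \<sigma> (n + a) \<noteq> a)"
        then have high: "\<sigma> (n + a) = a" if "a \<in> {1..s}" for a using that by blast
        have "\<sigma> i = lead_perm n s i" for i
        proof -
          consider "i \<in> {1..n}" | "i \<in> {n + 1..n + s}" | "i \<notin> {1..n + s}" by force
          then show ?thesis
          proof cases
            case 2
            then obtain a where "i = n + a" using le_Suc_ex[of n i] by auto
            then show ?thesis using high[of a] 2 by (auto simp: lead_perm_def)
          qed (use low permutes_not_in[OF \<sigma>(1)] in \<open>auto simp: lead_perm_def\<close>)
        qed
        with \<sigma>(3) show False by blast
      qed
      \<comment> \<open>The exponents of E are compared from the first root, hence the least
        deviating index.\<close>
      define p where "p = (LEAST a. a \<in> {1..s} \<and> \<sigma> (n + a) \<noteq> a)"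
      have p: "p \<in> {1..s} \<and> \<sigma> (n + p) \<noteq> p"
        unfolding p_def by (rule LeastI_ex) (use \<open>\<exists>a\<in>{1..s}. \<sigma> (n + a) \<noteq> a\<close> in blast)
      have below: "\<sigma> (n + a) = a" if "a < p" "1 \<le> a" for a
      proof -
        have "\<not> (a \<in> {1..s} \<and> \<sigma> (n + a) \<noteq> a)"
          by (rule not_less_Least) (use that(1) in \<open>simp only: p_def\<close>)
        moreover have "a \<in> {1..s}" using that p by simp
        ultimately show ?thesis by blast
      qed
      have "(p, n + p) \<in> set ?R" using p n by (auto simp: set_pos_roots)
      then obtain i where i: "i < num_roots N" "?R ! i = (p, n + p)" by (auto simp: in_set_conv_nth length_pos_roots)
      show ?thesis unfolding lead_expo_def fs_eq
      proof (rule deg_less_E_I[OF i(1)])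
        show "count_list es (?R ! i) < count_list (E_lead n s 1) (?R ! i)"
          unfolding i(2) countE es(1) E_lead using p by auto
        show "count_list es \<gamma> = count_list (E_lead n s 1) \<gamma>" if "\<gamma> \<in> set ?R" "\<gamma> < ?R ! i" for \<gamma>
        proof -
          obtain a b where \<gamma>: "\<gamma> = (a, b)" by fastforce
          then have "1 \<le> a" and ab: "a < p \<or> a = p \<and> b < n + p" using that i(2) by (auto simp: set_pos_roots)
          from ab have "\<gamma> \<in> set es \<longleftrightarrow> \<gamma> \<in> set (E_lead n s 1)"
          proof
            assume a: "a < p"
            then have \<sigma>a: "\<sigma> (n + a) = a" using below \<open>1 \<le> a\<close> by blast
            have "(a, b) \<in> set es \<longleftrightarrow> b = n + a"
            proof
              assume "(a, b) \<in> set es"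
              then have "\<sigma> b = a" unfolding es(1) by auto
              then show "b = n + a" using \<sigma>a inj by simp
            next
              assume "b = n + a"
              then show "(a, b) \<in> set es" unfolding es(1) using \<sigma>a a p n \<open>1 \<le> a\<close> by auto
            qed
            then show ?thesis unfolding \<gamma> E_lead using a p \<open>1 \<le> a\<close> by auto
          next
            assume a: "a = p \<and> b < n + p"
            have "(a, b) \<notin> set es"
            proof
              assume "(a, b) \<in> set es"
              then have b: "\<sigma> b = p" "n + 1 \<le> b" unfolding es(1) using a by auto
              have "\<sigma> b = b - n" using below[of "b - n"] a b(2) by auto
              with a b show False by linarith
            qed
            then show ?thesis unfolding \<gamma> E_lead using a by auto
          qed
          then show ?thesis unfolding countE by simp
        qed
      qed (use eq in \<open>simp add: lead_expo_def fs_eq\<close>)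
    qed
  qed
qed

lemma minor_word_lower:
  assumes q: "q \<noteq> 0" and n: "1 \<le> n" "1 \<le> s" "n + s \<le> N"
    and \<sigma>: "\<sigma> permutes {1..n + s}" and k: "k \<in> sup_choices (n + s) s"
    and ne: "(\<sigma>, k) \<noteq> (lead_perm n s, lead_sup n s)"
  shows "word (minor_word (n + s) \<sigma> k) \<in> pbw_span N q (\<lambda>y. deg_less (total_degree N y) (total_degree N (lead_expo N n s \<mu>)))"
    (is "_ \<in> ?D")
proof (cases "\<exists>g\<in>set (minor_word (n + s) \<sigma> k). zero_gen g")
  case True
  then show ?thesis using minor_word_gens[OF \<sigma> n(3)] by (intro pbw_span.rel zero_word_rel_ideal)
next
  case False
  then have nz: "\<forall>g\<in>set (minor_word (n + s) \<sigma> k). \<not> zero_gen g" by blast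
  note height = minor_word_height[OF \<sigma> k nz]
  note lead = expo_height_lead[OF n, of \<mu>]
  show ?thesis
  proof (cases "word_height (minor_word (n + s) \<sigma> k) = 2 * n * s")
    case False
    then have lt: "word_height (minor_word (n + s) \<sigma> k) < 2 * n * s" using height(1) by simp
    have "word (minor_word (n + s) \<sigma> k) \<in> pbw_span N q (\<lambda>x. expo_height N x \<le> word_height (minor_word (n + s) \<sigma> k))"
      by (rule straightening[OF q minor_word_gens[OF \<sigma> n(3)] order_refl])
    then show ?thesis
    proof (rule pbw_span_mono)
      fix x assume "x \<in> expos N" "expo_height N x \<le> word_height (minor_word (n + s) \<sigma> k)"
      then show "deg_less (total_degree N x) (total_degree N (lead_expo N n s \<mu>))"
        using lt lead unfolding lead_expo_def
        by (cases x) (auto simp: expos_def length_pos_roots intro!: deg_less_height)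
    qed
  next
    case True
    from height(2)[OF this] have k_eq: "k = lead_sup n s" and img: "\<sigma> ` {1..n} = {s + 1..n + s}" by auto
    have \<sigma>_ne: "\<sigma> \<noteq> lead_perm n s" using ne k_eq by auto
    have inj: "i = j" if "\<sigma> i = \<sigma> j" for i j using permutes_inj[OF \<sigma>] that by (auto dest: injD)
    have range: "\<sigma> i \<in> {1..n + s}" if "i \<in> {1..n + s}" for i using permutes_in_image[OF \<sigma>] that by blast
    define W1 where "W1 = map (\<lambda>i. T (\<sigma> i) i) [1..<Suc n]"
    define W2 where "W2 = map (\<lambda>i. Tbar (\<sigma> i) i) [Suc n..<Suc (n + s)]"
    define fs where "fs = map (\<lambda>i. (i, \<sigma> i)) (filter (\<lambda>i. \<sigma> i \<noteq> i) [1..<Suc n])"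
    define es where "es = map (\<lambda>i. (\<sigma> i, i)) (filter (\<lambda>i. \<sigma> i \<noteq> i) [Suc n..<Suc (n + s)])"
    have "[1..<Suc (n + s)] = [1..<Suc n] @ [Suc n..<Suc (n + s)]"
      using upt_add_eq_append[of 1 "Suc n" s] by (simp del: upt_Suc)
    then have W: "minor_word (n + s) \<sigma> k = W1 @ W2"
      unfolding minor_word_def k_eq W1_def W2_def by (simp add: lead_sup_def del: upt_Suc)
    have gens: "set W1 \<subseteq> gens N" "set W2 \<subseteq> gens N" using minor_word_gens[OF \<sigma> n(3), of k] unfolding W by simp_all
    have le1: "i \<le> \<sigma> i" if "i \<in> {1..n}" for i
    proof -
      have "T (\<sigma> i) i \<in> set (W1 @ W2)" using that unfolding W1_def by (auto simp del: upt_Suc)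
      then have "\<not> zero_gen (T (\<sigma> i) i)" using nz unfolding W by blast
      then show ?thesis by simp
    qed
    have le2: "\<sigma> i \<le> i" if "i \<in> {n + 1..n + s}" for i
    proof -
      have "Tbar (\<sigma> i) i \<in> set (W1 @ W2)" using that unfolding W2_def by (auto simp del: upt_Suc)
      then have "\<not> zero_gen (Tbar (\<sigma> i) i)" using nz unfolding W by blast
      then show ?thesis by simp
    qed
    have set_fs: "set fs = {(i, \<sigma> i) | i. i \<in> {1..n} \<and> \<sigma> i \<noteq> i}" by (auto simp: fs_def simp del: upt_Suc)
    have set_es: "set es = {(\<sigma> i, i) | i. i \<in> {n + 1..n + s} \<and> \<sigma> i \<noteq> i}" by (auto simp: es_def simp del: upt_Suc)
    have fs_R: "set fs \<subseteq> set (pos_roots N)"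
    proof
      fix f assume "f \<in> set fs"
      then obtain i where "f = (i, \<sigma> i)" "i \<in> {1..n}" "\<sigma> i \<noteq> i" unfolding set_fs by blast
      then show "f \<in> set (pos_roots N)" using le1[of i] range[of i] n by (auto simp: set_pos_roots)
    qed
    have es_R: "set es \<subseteq> set (pos_roots N)"
    proof
      fix e assume "e \<in> set es"
      then obtain i where "e = (\<sigma> i, i)" "i \<in> {n + 1..n + s}" "\<sigma> i \<noteq> i" unfolding set_es by blast
      then show "e \<in> set (pos_roots N)" using le2[of i] range[of i] n by (auto simp: set_pos_roots)
    qed
    have "distinct fs" "distinct es" by (auto simp: fs_def es_def distinct_map inj_on_def simp del: upt_Suc)
    \<comment> \<open>The letters come by increasing column. For F letters the column is the first
      component of the root, so they are in order already; for E letters it is the second component,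
      and they still have to be sorted.\<close>
    have "sorted_wrt (<) (filter (\<lambda>i. \<sigma> i \<noteq> i) [1..<Suc n])" by (intro sorted_wrt_filter sorted_wrt_upt)
    then have "sorted fs" unfolding fs_def sorted_map by (rule sorted_wrt_mono_rel[rotated]) auto
    have "sorted_wrt (<) (filter (\<lambda>i. \<sigma> i \<noteq> i) [Suc n..<Suc (n + s)])" by (intro sorted_wrt_filter sorted_wrt_upt)
    then have es_sorted: "sorted_wrt (\<lambda>x y. snd x < snd y \<and> fst x \<noteq> fst y) es"
      unfolding es_def sorted_wrt_map by (rule sorted_wrt_mono_rel[rotated]) (auto dest: inj)
    have K_gen_iff: "K_gen (T a b) \<longleftrightarrow> a = b" "K_gen (Tbar a b) \<longleftrightarrow> a = b" for a b
      by (auto simp: K_gen_def)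
    have filter1: "filter (\<lambda>g. \<not> K_gen g) W1 = map F_gen fs"
      unfolding W1_def fs_def by (simp add: filter_map comp_def F_gen_def K_gen_iff del: upt_Suc)
    have filter2: "filter (\<lambda>g. \<not> K_gen g) W2 = map E_gen es"
      unfolding W2_def es_def by (simp add: filter_map comp_def E_gen_def K_gen_iff del: upt_Suc)
    define K1 where "K1 = filter K_gen W1"
    define K2 where "K2 = filter K_gen W2"
    have K: "K_word N K1" "K_word N K2" using gens by (auto simp: K_word_def K1_def K2_def)
    have gens': "set (map F_gen fs) \<subseteq> gens N" "set (map E_gen es) \<subseteq> gens N" "set (map E_gen (sort es)) \<subseteq> gens N"
      "set K1 \<subseteq> gens N" "set K2 \<subseteq> gens N"
      using set_F_gen[OF fs_R] set_E_gen[OF es_R] set_E_gen[of "sort es" N] es_R K by (auto simp: K_word_def)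
    have "wprop N q (W1 @ W2) ((map F_gen fs @ K1) @ (map E_gen es @ K2))"
      using wprop_filter_K[OF q gens(1)] wprop_filter_K[OF q gens(2)] gens gens'
      unfolding filter1 filter2 K1_def[symmetric] K2_def[symmetric] by (intro wprop_append) auto
    also have "wprop N q ((map F_gen fs @ K1) @ (map E_gen es @ K2) @ []) ((map F_gen fs @ K1) @ (K2 @ map E_gen es) @ [])"
      using gens' K by (intro wprop_context wprop_sym[OF K_word_commute] q) auto
    then have "wprop N q ((map F_gen fs @ K1) @ (map E_gen es @ K2)) ((map F_gen fs @ K1 @ K2) @ map E_gen es @ [])" by simp
    also have "wprop N q ((map F_gen fs @ K1 @ K2) @ map E_gen es @ []) ((map F_gen fs @ K1 @ K2) @ map E_gen (sort es) @ [])"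
      using gens' by (intro wprop_context wprop_E_sort[OF es_R es_sorted]) auto
    finally have normal: "wprop N q (minor_word (n + s) \<sigma> k) (map F_gen fs @ (K1 @ K2) @ map E_gen (sort es))"
      unfolding W by simp
    obtain \<mu>' where \<mu>': "length \<mu>' = N" "wprop N q (map F_gen fs @ (K1 @ K2) @ map E_gen (sort es))
        (pbw_word N (map (count_list fs) (pos_roots N), \<mu>', map (count_list (sort es)) (pos_roots N)))"
      using sorted_word_normal[OF q fs_R \<open>sorted fs\<close>, of "K1 @ K2" "sort es"] K es_R by auto
    have "sum_list (map height (sort es)) = sum_list (map height es)"
      by (metis mset_map mset_sort sum_mset_sum_list)
    then have "expo_height N (map (count_list fs) (pos_roots N), \<mu>', map (count_list (sort es)) (pos_roots N))
        = word_height (map F_gen fs) + word_height (map E_gen es)"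
      using es_R by (subst expo_height_count[OF fs_R]) (simp_all add: word_height_gens)
    also have "\<dots> \<le> 2 * n * s"
      using word_height_filter[of "\<lambda>g. \<not> K_gen g" W1] word_height_filter[of "\<lambda>g. \<not> K_gen g" W2] True
      unfolding filter1 filter2 W by simp
    finally have "deg_less (total_degree N (map (count_list fs) (pos_roots N), \<mu>', map (count_list (sort es)) (pos_roots N)))
      (total_degree N (lead_expo N n s \<mu>))"
      using minor_word_top_lower[OF n \<sigma> img \<sigma>_ne, of "sort es" fs \<mu>'] set_es set_fs \<open>distinct fs\<close> \<open>distinct es\<close> by simp
    then show ?thesis
      using \<mu>' by (intro pbw_span_wprop[OF wprop_trans[OF normal \<mu>'(2)]]) (auto simp: expos_def length_pos_roots)
  qed
qed

section \<open>The leading term of the whole sum\<close>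

definition drs_falg :: "complex \<Rightarrow> nat \<Rightarrow> nat \<Rightarrow> falg" where
  "drs_falg q r s = (\<Sum>\<sigma>\<in>{\<sigma>. \<sigma> permutes {1..r}}. \<Sum>k\<in>sup_choices r s.
     monomial (minor_word r \<sigma> k) ((- q) powi (- int (perm_length r \<sigma>)) * q ^ (2 * (\<Sum>i=1..r. i * k i))))"

lemma uprod_word:
  assumes "set w \<subseteq> gens N"
  shows "uprod N q (map (\<lambda>g. proj N q (var g)) w) = proj N q (word w)"
proof -
  have "uprod N q (map (proj N q) (map var w)) = proj N q (prod_list (map var w))"
    using assms by (intro uprod_proj(1)) auto
  then show ?thesis by (simp add: prod_list_var comp_def)
qed

lemma finite_sup_choices: "finite (sup_choices r s)"
  unfolding sup_choices_def by (rule finite_subset[OF _ finite_PiE[of "{1..r}" "\<lambda>_. {0, 1::nat}"]]) auto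

lemma drs_eq_proj:
  assumes "r \<le> N"
  shows "drs N q r s = proj N q (drs_falg q r s)" "drs_falg q r s \<in> falg_on N"
proof -
  interpret ring "Uq N q" by (rule ring_Uq)
  define a where "a \<sigma> = (- q) powi (- int (perm_length r \<sigma>))" for \<sigma>
  define b where "b k = q ^ (2 * (\<Sum>i=1..r. i * k i))" for k :: "nat \<Rightarrow> nat"
  let ?P = "{\<sigma>. \<sigma> permutes {1..r}}"
  define p where "p \<sigma> = (\<Sum>k\<in>sup_choices r s. monomial (minor_word r \<sigma> k) (b k))" for \<sigma>
  have gens: "set (minor_word r \<sigma> k) \<subseteq> gens N" if "\<sigma> \<in> ?P" for \<sigma> k
    using that minor_word_gens assms by auto
  have p_on: "p \<sigma> \<in> falg_on N" if "\<sigma> \<in> ?P" for \<sigma>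
    unfolding p_def using gens[OF that] by (intro falg_on_sum) simp
  have word: "smul N q (b k) (uprod N q (map (\<lambda>i. tk N q (k i) (\<sigma> i) i) [1..<Suc r]))
      = proj N q (monomial (minor_word r \<sigma> k) (b k))" if "\<sigma> \<in> ?P" for \<sigma> k
  proof -
    have "map (\<lambda>i. tk N q (k i) (\<sigma> i) i) [1..<Suc r] = map (\<lambda>g. proj N q (var g)) (minor_word r \<sigma> k)"
      by (simp add: minor_word_def tk_def comp_def if_distrib del: upt_Suc)
    then show ?thesis using gens[OF that] by (simp add: uprod_word smul_proj const_mult_single del: upt_Suc)
  qed
  have inner: "(\<Oplus>\<^bsub>Uq N q\<^esub>k\<in>sup_choices r s. smul N q (b k) (uprod N q (map (\<lambda>i. tk N q (k i) (\<sigma> i) i) [1..<Suc r])))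
      = proj N q (p \<sigma>)" if "\<sigma> \<in> ?P" for \<sigma>
    unfolding word[OF that] p_def using gens[OF that] finite_sup_choices by (intro finsum_proj) auto
  have "drs N q r s = (\<Oplus>\<^bsub>Uq N q\<^esub>\<sigma>\<in>?P. smul N q (a \<sigma>)
      (\<Oplus>\<^bsub>Uq N q\<^esub>k\<in>sup_choices r s. smul N q (b k) (uprod N q (map (\<lambda>i. tk N q (k i) (\<sigma> i) i) [1..<Suc r]))))"
    by (simp only: drs_def a_def b_def sup_choices_def)
  also have "\<dots> = (\<Oplus>\<^bsub>Uq N q\<^esub>\<sigma>\<in>?P. proj N q (const (a \<sigma>) * p \<sigma>))"
  proof (rule finsum_cong'[OF refl])
    show "(\<lambda>\<sigma>. proj N q (const (a \<sigma>) * p \<sigma>)) \<in> ?P \<rightarrow> carrier (Uq N q)"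
      using p_on by (intro Pi_I proj_closed falg_on_mult) auto
  qed (simp only: inner smul_proj p_on)
  also have "\<dots> = proj N q (\<Sum>\<sigma>\<in>?P. const (a \<sigma>) * p \<sigma>)"
    using p_on finite_permutations[of "{1..r}"] by (intro finsum_proj falg_on_mult) auto
  also have eq: "(\<Sum>\<sigma>\<in>?P. const (a \<sigma>) * p \<sigma>) = drs_falg q r s"
    by (simp add: drs_falg_def p_def a_def b_def sum_distrib_left const_mult_single)
  finally show "drs N q r s = proj N q (drs_falg q r s)" .
  show "drs_falg q r s \<in> falg_on N"
    unfolding eq[symmetric] using p_on by (intro falg_on_sum falg_on_mult) auto
qed

lemma lead_sup_choices: "lead_sup n s \<in> sup_choices (n + s) s"
proof -
  have "(\<Sum>i=1..n + s. lead_sup n s i) = (\<Sum>i\<in>{n + 1..n + s}. 1)"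
    by (intro sum.mono_neutral_cong_right) (auto simp: lead_sup_def)
  then show ?thesis by (auto simp: sup_choices_def lead_sup_def)
qed

text \<open>The predicate is arbitrary so that both cases are covered: lower degree for
  \<open>n \<ge> 1\<close>, and the empty condition, that is, the relation ideal, for
  \<open>n = 0\<close>.\<close>

lemma drs_falg_minus_lead:
  assumes "q \<noteq> 0"
    and others: "\<And>\<sigma> k. \<sigma> permutes {1..n + s} \<Longrightarrow> k \<in> sup_choices (n + s) s \<Longrightarrow> (\<sigma>, k) \<noteq> (lead_perm n s, lead_sup n s) \<Longrightarrow>
      word (minor_word (n + s) \<sigma> k) \<in> pbw_span N q P"
  shows "\<exists>c. c \<noteq> 0 \<and> drs_falg q (n + s) s - monomial (map F_gen (F_lead n s 1) @ map E_gen (E_lead n s 1)) c \<in> pbw_span N q P"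
proof -
  let ?A = "{\<sigma>. \<sigma> permutes {1..n + s}} \<times> sup_choices (n + s) s"
  let ?x = "(lead_perm n s, lead_sup n s)"
  define c where "c = (\<lambda>(\<sigma>, k). (- q) powi (- int (perm_length (n + s) \<sigma>)) * q ^ (2 * (\<Sum>i=1..n + s. i * k i :: nat)))"
  define f where "f = (\<lambda>(\<sigma>, k). monomial (minor_word (n + s) \<sigma> k) (c (\<sigma>, k)))"
  have fin: "finite ?A" using finite_permutations[of "{1..n + s}"] finite_sup_choices by blast
  have x: "?x \<in> ?A" using lead_perm_permutes lead_sup_choices by blast
  have "drs_falg q (n + s) s = sum f ?A"
    unfolding drs_falg_def f_def c_def by (simp add: sum.cartesian_product)
  also have "\<dots> = f ?x + sum f (?A - {?x})" by (rule sum.remove[OF fin x])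
  finally have "drs_falg q (n + s) s - f ?x = sum f (?A - {?x})" by simp
  also have "\<dots> \<in> pbw_span N q P"
  proof (rule pbw_span_sum)
    fix y assume "y \<in> ?A - {?x}"
    then obtain \<sigma> k where y: "y = (\<sigma>, k)" "\<sigma> permutes {1..n + s}" "k \<in> sup_choices (n + s) s" "(\<sigma>, k) \<noteq> ?x" by blast
    show "f y \<in> pbw_span N q P"
      using pbw_span_scale[OF others[OF y(2-4)], of "c (\<sigma>, k)"] by (simp add: f_def y(1) const_mult_single)
  qed
  finally show ?thesis
    using assms(1) by (intro exI[of _ "c ?x"]) (simp add: f_def c_def minor_word_lead)
qed

text \<open>All superscripts are 1, so a term without zero letter satisfies
  \<open>\<sigma> i \<le> i\<close> throughout, and the identity is the only such
  permutation.\<close>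

lemma minor_word_only_bar:
  assumes "\<sigma> permutes {1..s}" "k \<in> sup_choices s s" "(\<sigma>, k) \<noteq> (lead_perm 0 s, lead_sup 0 s)"
  shows "\<exists>g\<in>set (minor_word s \<sigma> k). zero_gen g"
proof (rule ccontr)
  assume nz: "\<not> (\<exists>g\<in>set (minor_word s \<sigma> k). zero_gen g)"
  have "card {i \<in> {1..s}. k i = 0} = 0" using card_zero_choices[of k 0 s] assms(2) unfolding add_0 by blast
  moreover have "finite {i \<in> {1..s}. k i = 0}" by (rule finite_subset[of _ "{1..s}"]) blast+
  ultimately have empty: "{i \<in> {1..s}. k i = 0} = {}" by (simp only: card_0_eq)
  have k: "k i \<noteq> 0" if "i \<in> {1..s}" for i
    using empty that unfolding Collect_empty_eq by (elim allE[of _ i]) simp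
  have "{i \<in> {1..s}. k i = 0} = {1..0}" unfolding empty by simp
  then have "k = lead_sup 0 s" using lead_sup_eqI[of k 0 s] assms(2) unfolding add_0 by blast
  have "\<sigma> i \<le> i" if "i \<in> {1..s}" for i
  proof -
    have "Tbar (\<sigma> i) i \<in> set (minor_word s \<sigma> k)"
      using that k[OF that] by (auto simp: minor_word_def image_iff simp del: upt_Suc intro!: bexI[of _ i])
    then show ?thesis using nz by fastforce
  qed
  then have "\<sigma> = id" using assms(1) by (intro permutes_natset_le) auto
  then have "\<sigma> = lead_perm 0 s" by (auto simp: lead_perm_def)
  with \<open>k = lead_sup 0 s\<close> assms(3) show False by blast
qed

lemma lead_uprod:
  assumes "n + s \<le> N"
  shows "smul N q c (uprod N q (map (\<lambda>j. tk N q 0 (j + s) j) [1..<Suc n] @ map (\<lambda>i. tk N q 1 i (n + i)) [1..<Suc s]))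
    = proj N q (monomial (map F_gen (F_lead n s 1) @ map E_gen (E_lead n s 1)) c)"
    "set (map F_gen (F_lead n s 1) @ map E_gen (E_lead n s 1)) \<subseteq> gens N"
proof -
  let ?w = "map F_gen (F_lead n s 1) @ map E_gen (E_lead n s 1)"
  have w: "?w = map (\<lambda>j. T (j + s) j) [1..<Suc n] @ map (\<lambda>i. Tbar i (n + i)) [1..<Suc s]"
    by (simp add: F_lead_def E_lead_def F_gen_def E_gen_def comp_def del: upt_Suc)
  show gens: "set ?w \<subseteq> gens N" unfolding w using assms by auto
  have "map (\<lambda>j. tk N q 0 (j + s) j) [1..<Suc n] @ map (\<lambda>i. tk N q 1 i (n + i)) [1..<Suc s] = map (\<lambda>g. proj N q (var g)) ?w"
    unfolding w by (simp add: tk_def comp_def del: upt_Suc)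
  moreover have "word ?w \<in> falg_on N" using gens by simp
  ultimately show "smul N q c (uprod N q (map (\<lambda>j. tk N q 0 (j + s) j) [1..<Suc n] @ map (\<lambda>i. tk N q 1 i (n + i)) [1..<Suc s]))
    = proj N q (monomial ?w c)"
    by (simp only: uprod_word[OF gens] smul_proj const_mult_single mult_1_right)
qed

lemma has_lt_refl: "u \<in> carrier (Uq N q) \<Longrightarrow> u \<noteq> \<zero>\<^bsub>Uq N q\<^esub> \<Longrightarrow> has_lt N q u u"
  by (simp add: has_lt_def)

text \<open>For \<open>n = 0\<close> the word consists of letters \<open>Tbar i i\<close>. On the
  zeroth tensor power, that is, under the counit, each of them acts as 1.\<close>

lemma E_lead_0_nonzero:
  assumes "q \<noteq> 0" "c \<noteq> 0" "s \<le> N"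
  shows "proj N q (monomial (map E_gen (E_lead 0 s 1)) c) \<noteq> \<zero>\<^bsub>Uq N q\<^esub>"
proof
  assume "proj N q (monomial (map E_gen (E_lead 0 s 1)) c) = \<zero>\<^bsub>Uq N q\<^esub>"
  then have "monomial (map E_gen (E_lead 0 s 1)) c - 0 \<in> rel_ideal N q"
    unfolding proj_0[symmetric] using assms lead_uprod(2)[of 0 s N]
    by (subst proj_eq_iff[symmetric]) (auto simp: F_lead_def)
  from falg_rep_rel_ideal[OF assms(1) this, of "[]" 0 "[]"]
  have "c * word_rep N q 0 (map E_gen (E_lead 0 s 1)) [] [] = 0" by (simp add: tensor_index_0)
  moreover have "word_rep N q 0 (map E_gen (map (\<lambda>i. (i, i)) is)) [] [] = 1" for "is"
    by (induction "is") (auto simp: matmul_def tensor_index_0 E_gen_def)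
  ultimately show False using assms(2) by (simp add: E_lead_def del: upt_Suc)
qed

theorem theorem1p1:
  fixes N r s :: nat and q :: complex
  assumes "N \<ge> 1"
    and "q \<noteq> 0"
    and "\<And>n::nat. n > 0 \<Longrightarrow> q ^ n \<noteq> 1"
    and "1 \<le> s" and "s \<le> r" and "r \<le> N"
  shows "\<exists>c::complex. c \<noteq> 0 \<and>
    has_lt N q (drs N q r s)
      (smul N q c
        (uprod N q
          (map (\<lambda>j. tk N q 0 (j + s) j) [1..<Suc (r - s)]
           @ map (\<lambda>i. tk N q 1 i (r - s + i)) [1..<Suc s])))"
proof -
  define n where "n = r - s"
  have r: "r = n + s" "n + s \<le> N" using assms by (simp_all add: n_def)
  \<comment> \<open>Equality of \<open>q\<close> and its inverse would mean that the square of
    \<open>q\<close> is 1.\<close>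
  have q: "q - inverse q \<noteq> 0"
    using assms(2) assms(3)[of 2] by (auto simp: field_simps power2_eq_square)
  let ?w = "map F_gen (F_lead n s 1) @ map E_gen (E_lead n s 1)"
  have "\<exists>c. c \<noteq> 0 \<and> has_lt N q (drs N q r s) (proj N q (monomial ?w c))"
  proof (cases "n = 0")
    case True
    \<comment> \<open>With a predicate that is never true the span is the relation ideal, so every
      other term vanishes in \<open>Uq\<close> and \<open>d_rs\<close> equals its leading
      term.\<close>
    have "word (minor_word (n + s) \<sigma> k) \<in> pbw_span N q (\<lambda>_. False)"
      if "\<sigma> permutes {1..n + s}" "k \<in> sup_choices (n + s) s" "(\<sigma>, k) \<noteq> (lead_perm n s, lead_sup n s)" for \<sigma> k
      using that minor_word_only_bar[of \<sigma> s k] minor_word_gens[OF that(1) r(2)] True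
      by (intro pbw_span.rel zero_word_rel_ideal) auto
    then obtain c where c: "c \<noteq> 0" "drs_falg q (n + s) s - monomial ?w c \<in> pbw_span N q (\<lambda>_. False)"
      using drs_falg_minus_lead[OF assms(2)] by blast
    from c(2) have "drs_falg q (n + s) s - monomial ?w c \<in> rel_ideal N q"
      by cases auto
    then have "drs N q r s = proj N q (monomial ?w c)"
      unfolding r(1) drs_eq_proj(1)[OF r(2)] using drs_eq_proj(2)[OF r(2)] lead_uprod(2)[OF r(2)]
      by (subst proj_eq_iff) auto
    moreover have "proj N q (monomial ?w c) \<noteq> \<zero>\<^bsub>Uq N q\<^esub>"
      using E_lead_0_nonzero[OF assms(2) c(1)] True r by (simp add: F_lead_def)
    ultimately show ?thesis using c(1) lead_uprod(2)[OF r(2)]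
      by (intro exI[of _ c]) (auto intro!: has_lt_refl proj_closed simp del: set_append)
  next
    case False
    then have n: "1 \<le> n" "1 \<le> s" "n + s \<le> N" using assms(4) r by auto
    \<comment> \<open>The leading word has no diagonal letters between its F and E parts;
      \<open>\<mu>\<close> arises from completing the letters to root vectors.\<close>
    obtain \<mu> where \<mu>: "length \<mu> = N" "wprop N q (map F_gen (F_lead n s 1) @ [] @ map E_gen (E_lead n s 1)) (pbw_word N (lead_expo N n s \<mu>))"
      unfolding lead_expo_def
      using sorted_word_normal[OF assms(2) F_lead_props(3,1)[OF n(2,3)] K_word_simps(1) E_lead_props(3,1)[OF n(1,3)]] by blast
    let ?D = "\<lambda>y. deg_less (total_degree N y) (total_degree N (lead_expo N n s \<mu>))"
    obtain c where c: "c \<noteq> 0" "drs_falg q (n + s) s - monomial ?w c \<in> pbw_span N q ?D"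
      using drs_falg_minus_lead[OF assms(2)] minor_word_lower[OF assms(2) n] by blast
    obtain d where d: "d \<noteq> 0" "req N q (word ?w) (monomial (pbw_word N (lead_expo N n s \<mu>)) d)"
      using \<mu>(2) by (auto simp: wprop_def)
    have "has_lt N q (proj N q (drs_falg q (n + s) s)) (proj N q (monomial ?w c))"
    proof (rule has_lt_proj[OF q])
      show "drs_falg q (n + s) s \<in> falg_on N" by (rule drs_eq_proj(2)[OF r(2)])
      show "monomial ?w c \<in> falg_on N" using lead_uprod(2)[OF r(2)] by simp
      show "lead_expo N n s \<mu> \<in> expos N" using \<mu>(1) by (simp add: lead_expo_def expos_def length_pos_roots)
      show "req N q (monomial ?w c) (monomial (pbw_word N (lead_expo N n s \<mu>)) (c * d))"
        using req_single_scale[OF d(2), of c] by simp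
      show "c * d \<noteq> 0" using c(1) d(1) by simp
      show "drs_falg q (n + s) s - monomial ?w c \<in> pbw_span N q ?D" by (rule c(2))
      show "word (pbw_word N (lead_expo N n s \<mu>)) \<notin> pbw_span N q ?D"
        using \<mu>(2) by (intro lead_word_independent assms(2) q n) simp
    qed
    then show ?thesis unfolding r(1) drs_eq_proj(1)[OF r(2)] using c(1) by blast
  qed
  then show ?thesis unfolding n_def[symmetric] lead_uprod(1)[OF r(2)] .
qed

end
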